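(* For every $p>1$, $$A_p=W_p\cap C_p.$$ That is, a weight $w$ on $\mathbb{R}^n$ belongs to $A_p$ if and only if $w\in W_p$ and $w\in C_p$.
   Context: Throughout, $\mathbb{R}^n$ carries Lebesgue measure. Cubes have sides parallel to the axes. A weight is a non-negative locally integrable function on $\mathbb{R}^n$; write $w(E)=\int_E w$. The Hardy–Littlewood maximal operator is $$Mf(x)=\sup_{Q\ni x}\frac{1}{|Q|}\int_Q|f|,$$ where the supremum is over all cubes $Q$ containing $x$. For $p>1$, $w\in A_p$ means $$[w]_{A_p}:=\sup_Q\Big(\frac1{|Q|}\int_Q w\Big)\Big(\frac1{|Q|}\int_Q w^{-\frac1{p-1}}\Big)^{p-1}<\infty.$$ For $p>1$, $N_p$ is the class of weights with $$\int_{\mathbb{R}^n}\frac{w(x)}{(1+|x|)^{np}}\,dx<\infty.$$ For $p>1$, $W_p$ is the class of weights $w\in N_p$ for which there is $C>0$ such that $$\int_{\mathbb{R}^n}(M(Mf))^p w\le C\int_{\mathbb{R}^n}(Mf)^p w$$ whenever the right-hand side is finite. For $p>0$, $w\in C_p$ means there exist $C,\delta>0$ such that for every cube $Q$ and every measurable $E\subset Q$, $$\int_E w\le C\Big(\frac{|E|}{|Q|}\Big)^{\delta}\int_{\mathbb{R}^n}(M\chi_Q)^p w.$$ *)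

theory Defs
  imports "HOL-Analysis.Analysis"
begin

text \<open>Real powers of extended non-negative reals (exponent assumed positive):
  infinity to a positive power is infinity.\<close>
definition epowr :: "ennreal \<Rightarrow> real \<Rightarrow> ennreal" where
  "epowr a r = (if a = \<infinity> then \<infinity> else ennreal (enn2real a powr r))"

definition cube :: "(real^'n) set \<Rightarrow> bool" where
  "cube Q \<longleftrightarrow> (\<exists>a h. h > 0 \<and> Q = cbox a (a + h *\<^sub>R One))"

definition maxop :: "(real^'n \<Rightarrow> ennreal) \<Rightarrow> real^'n \<Rightarrow> ennreal" where
  "maxop f x = (SUP Q \<in> {Q. cube Q \<and> x \<in> Q}.
      (\<integral>\<^sup>+ y. f y * indicator Q y \<partial>lebesgue) / emeasure lebesgue Q)"

definition Mreal :: "(real^'n \<Rightarrow> real) \<Rightarrow> real^'n \<Rightarrow> ennreal" where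
  "Mreal f = maxop (\<lambda>y. ennreal \<bar>f y\<bar>)"

definition weight :: "(real^'n \<Rightarrow> real) \<Rightarrow> bool" where
  "weight w \<longleftrightarrow> (\<forall>x. 0 \<le> w x) \<and>
     (\<forall>K. compact K \<longrightarrow> set_integrable lebesgue K w)"

definition dualw :: "real \<Rightarrow> (real^'n \<Rightarrow> real) \<Rightarrow> real^'n \<Rightarrow> ennreal" where
  "dualw p w x = (if w x = 0 then \<infinity> else ennreal (w x powr (- 1 / (p - 1))))"

definition avg :: "(real^'n) set \<Rightarrow> (real^'n \<Rightarrow> ennreal) \<Rightarrow> ennreal" where
  "avg Q g = (\<integral>\<^sup>+ y. g y * indicator Q y \<partial>lebesgue) / emeasure lebesgue Q"

definition Ap_class :: "real \<Rightarrow> (real^'n \<Rightarrow> real) \<Rightarrow> bool" where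
  "Ap_class p w \<longleftrightarrow> (\<exists>C::real. \<forall>Q. cube Q \<longrightarrow>
      avg Q (\<lambda>y. ennreal (w y)) * epowr (avg Q (dualw p w)) (p - 1) \<le> ennreal C)"

definition Np_class :: "real \<Rightarrow> (real^'n \<Rightarrow> real) \<Rightarrow> bool" where
  "Np_class p w \<longleftrightarrow>
     (\<integral>\<^sup>+ x. ennreal (w x / (1 + norm x) powr (real CARD('n) * p)) \<partial>lebesgue) < \<infinity>"

definition Wp_class :: "real \<Rightarrow> (real^'n \<Rightarrow> real) \<Rightarrow> bool" where
  "Wp_class p w \<longleftrightarrow> Np_class p w \<and>
     (\<exists>C>0. \<forall>f. f \<in> borel_measurable lebesgue \<longrightarrow>
        (\<integral>\<^sup>+ x. epowr (Mreal f x) p * ennreal (w x) \<partial>lebesgue) < \<infinity> \<longrightarrow>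
        (\<integral>\<^sup>+ x. epowr (maxop (Mreal f) x) p * ennreal (w x) \<partial>lebesgue)
          \<le> ennreal C * (\<integral>\<^sup>+ x. epowr (Mreal f x) p * ennreal (w x) \<partial>lebesgue))"

definition Cp_class :: "real \<Rightarrow> (real^'n \<Rightarrow> real) \<Rightarrow> bool" where
  "Cp_class p w \<longleftrightarrow> (\<exists>C>0. \<exists>\<delta>>0. \<forall>Q E. cube Q \<longrightarrow> E \<in> sets lebesgue \<longrightarrow> E \<subseteq> Q \<longrightarrow>
      (\<integral>\<^sup>+ x. ennreal (w x) * indicator E x \<partial>lebesgue)
        \<le> ennreal C * epowr (emeasure lebesgue E / emeasure lebesgue Q) \<delta>
          * (\<integral>\<^sup>+ x. epowr (maxop (indicator Q) x) p * ennreal (w x) \<partial>lebesgue))"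

end

theory Submission
  imports Defs
begin

text \<open>
  The direction from \<open>A\<^sub>p\<close> is Muckenhoupt's theorem in Lerner's form: with
  \<open>\<sigma> = w\<^bsup>-1/(p-1)\<^esup>\<close>, the \<open>A\<^sub>p\<close> condition gives the pointwise bound
  \<open>(Mf)\<^bsup>p-1\<^esup> \<le> K M\<^sub>w(M\<^sub>\<sigma>(f/\<sigma>)\<^bsup>p-1\<^esup>/w)\<close>, and the maximal operators \<open>M\<^sub>w\<close>, \<open>M\<^sub>\<sigma>\<close> with respect to
  the doubling measures \<open>w dx\<close>, \<open>\<sigma> dx\<close> are of strong type by Vitali's covering lemma. Applied to \<open>\<chi>\<^sub>Q\<close>
  it gives \<open>N\<^sub>p\<close>, applied to \<open>Mf\<close> it gives \<open>W\<^sub>p\<close>; \<open>C\<^sub>p\<close> is the \<open>A\<^sub>\<infinity>\<close> property of \<open>w\<close>.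

  Conversely, iterating \<open>W\<^sub>p\<close> on \<open>\<chi>\<^sub>E\<close> shows that \<open>R = \<Sum>\<^sub>k \<epsilon>\<^sup>k M\<^sup>k \<chi>\<^sub>E\<close> is essentially bounded in
  \<open>L\<^sup>p(w)\<close> by \<open>M\<chi>\<^sub>E\<close>. Since \<open>R\<close> is an \<open>A\<^sub>1\<close> weight with constant \<open>1/\<epsilon>\<close>, its \<open>A\<^sub>\<infinity>\<close> property yields
  \<open>(M\<chi>\<^sub>E)\<^bsup>1-\<delta>\<^esup> \<le> C R\<close>, whence \<open>\<integral> (M\<chi>\<^sub>E)\<^sup>s w \<le> C \<integral> (M\<chi>\<^sub>E)\<^sup>p w\<close> for some \<open>s < p\<close>. Small values of
  \<open>M\<chi>\<^sub>E\<close> can be absorbed, so the left side is at most \<open>C w{M\<chi>\<^sub>E > t}\<close> for a fixed \<open>t\<close>. For cubes \<open>E\<close>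
  this makes \<open>w\<close> doubling and removes the tail in \<open>C\<^sub>p\<close>, so that \<open>w\<close> is an \<open>A\<^sub>\<infinity>\<close> weight and
  \<open>w{M\<chi>\<^sub>E > t} \<le> C w(E)\<close>. Altogether \<open>w(Q) (|E|/|Q|)\<^sup>s \<le> C w(E)\<close> for \<open>E \<subseteq> Q\<close> with \<open>s < p\<close>, and
  summing over the level sets of \<open>w\<close> in \<open>Q\<close> gives \<open>A\<^sub>p\<close>.
\<close>

subsection \<open>Cubes and a Vitali covering lemma\<close>

text \<open>Three quite different weights pass through one inequality,
  \<open>(|E|/|Q|)^q \<nu>(Q) \<le> C \<nu>(E)\<close> for \<open>E\<close> inside a cube
  \<open>Q\<close> (locale \<open>cube_lower\<close>): an \<open>A_p\<close> weight with q = p, the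
  Rubio de Francia sum with q = 1, and finally the given weight with some q = s < p. This inequality
  already contains doubling and the \<open>A_infty\<close> property. The gain s < p is decisive. In
  the last sum the dual weight grows like \<open>2^(k/(p-1))\<close> on the k-th level set, while
  the volume of that set is bounded by a multiple of \<open>2^(-k/(s-1))\<close>; for s = p the
  bound no longer decays. So the gain has to be extracted from \<open>W_p\<close> beforehand, and
  for arbitrary bounded sets, not only for cubes. \<open>W_p\<close> speaks only of functions with
  finite right-hand side. \<open>N_p\<close> makes the integral of \<open>(M \<chi>_E)^p w\<close>
  finite for bounded \<open>E\<close>, which starts the iteration and later permits absorption.
  \<open>W_p\<close> alone controls the tail of \<open>M \<chi>_Q\<close> for cubes and gives
  doubling. For a thin set \<open>E\<close>, however, a cube of positive volume density must also
  have positive \<open>w\<close>-density before w(E) can control the superlevel set, and this is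
  what \<open>C_p\<close> supplies.\<close>

lemma epowr_ennreal [simp]: "x \<ge> 0 \<Longrightarrow> epowr (ennreal x) r = ennreal (x powr r)"
  by (simp add: epowr_def)

lemma epowr_top [simp]: "epowr \<infinity> r = \<infinity>" "epowr top r = top"
  by (simp_all add: epowr_def)

lemma epowr_0 [simp]: "epowr 0 r = 0"
  by (simp add: epowr_def)

lemma epowr_1 [simp]: "epowr 1 r = 1"
  by (simp add: epowr_def)

lemma epowr_mono: "a \<le> b \<Longrightarrow> r > 0 \<Longrightarrow> epowr a r \<le> epowr b r"
  by (cases a; cases b) (auto simp: powr_mono2 top_unique)

lemma epowr_mult: "r > 0 \<Longrightarrow> epowr (a * b) r = epowr a r * epowr b r"
proof -
  \<comment> \<open>The delicate case is infinity times a finite factor: both sides are 0 if the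
    factor is 0, and infinite otherwise.\<close>
  have *: "epowr (\<infinity> * ennreal y) r = \<infinity> * ennreal (y powr r)" if "y \<ge> 0" "r > 0" for y
    using that by (cases "y = 0") (auto simp: ennreal_top_mult)
  assume r: "r > 0"
  show ?thesis
  proof (cases a)
    case (real x) note a = this
    show ?thesis
    proof (cases b)
      case (real y)
      then show ?thesis using a r by (simp add: ennreal_mult[symmetric] powr_mult)
    next
      case top
      then show ?thesis using a r *[of x] by (simp add: mult.commute)
    qed
  next
    case top note a = this
    show ?thesis
    proof (cases b)
      case (real y)
      then show ?thesis using a r *[of y] by simp
    next
      case top
      then show ?thesis using a by (simp add: ennreal_mult_top)
    qed
  qed
qed

lemma epowr_epowr: "epowr (epowr a r) s = epowr a (r * s)"
  by (cases a) (auto simp: powr_powr)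

lemma epowr_one_exp [simp]: "epowr a 1 = a"
  by (cases a) auto

lemma epowr_add: "r > 0 \<Longrightarrow> s > 0 \<Longrightarrow> epowr a (r + s) = epowr a r * epowr a s"
  by (cases a) (auto simp: powr_add ennreal_mult)

lemma epowr_measurable [measurable]:
  "f \<in> borel_measurable M \<Longrightarrow> (\<lambda>x. epowr (f x) r) \<in> borel_measurable M"
proof -
  assume [measurable]: "f \<in> borel_measurable M"
  have "(\<lambda>x. if f x = \<infinity> then \<infinity> else ennreal (enn2real (f x) powr r)) \<in> borel_measurable M"
    by (intro measurable_If measurable_compose[OF _ measurable_ennreal] powr_real_measurable) (auto intro!: measurable_If)
  then show ?thesis by (simp add: epowr_def)
qed

section \<open>Closed and open cubes, described by lower corner and side length\<close>

definition cb :: "real^'n \<Rightarrow> real \<Rightarrow> (real^'n) set" where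
  "cb a h = cbox a (a + h *\<^sub>R One)"

definition ob :: "real^'n \<Rightarrow> real \<Rightarrow> (real^'n) set" where
  "ob a h = box a (a + h *\<^sub>R One)"

lemma One_nth [simp]: "(One :: real^'n) $ i = 1"
  by (simp add: cart_eq_inner_axis inner_sum_left_Basis axis_in_Basis_iff)

lemma mem_cb: "x \<in> cb a h \<longleftrightarrow> (\<forall>i. a $ i \<le> x $ i \<and> x $ i \<le> a $ i + h)"
  unfolding cb_def mem_box_cart by (simp only: vector_add_component vector_scaleR_component One_nth) simp

lemma mem_ob: "x \<in> ob a h \<longleftrightarrow> (\<forall>i. a $ i < x $ i \<and> x $ i < a $ i + h)"
  unfolding ob_def mem_box_cart by (simp only: vector_add_component vector_scaleR_component One_nth) simp

lemma ob_subset_cb: "ob a h \<subseteq> cb a h"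
  by (auto simp: mem_cb mem_ob less_imp_le)

lemma open_ob [simp]: "open (ob a h)"
  unfolding ob_def by (rule open_box)

lemma compact_cb [simp]: "compact (cb a h)"
  by (simp add: cb_def)

lemma cb_lebesgue [measurable, simp]: "cb a h \<in> sets lebesgue"
  by (simp add: cb_def)

lemma cube_iff: "cube Q \<longleftrightarrow> (\<exists>a h. h > 0 \<and> Q = cb a h)"
  by (simp add: cube_def cb_def)

lemma cube_cb [simp]: "h > 0 \<Longrightarrow> cube (cb a h)"
  by (auto simp: cube_iff)

abbreviation vol :: "(real^'n) set \<Rightarrow> real" where
  "vol \<equiv> measure lebesgue"

lemma emeasure_cb: "h \<ge> 0 \<Longrightarrow> emeasure lebesgue (cb (a :: real^'n) h) = ennreal (h ^ CARD('n))"
proof -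
  assume h: "h \<ge> 0"
  then have ne: "cbox a (a + h *\<^sub>R One) \<noteq> {}"
    using mem_cb[of a a h] by (auto simp: cb_def)
  have "measure lborel (cbox a (a + h *\<^sub>R One)) = (\<Prod>i\<in>(UNIV::'n set). h)"
    unfolding content_cbox_cart[OF ne]
    by (rule prod.cong, simp, simp only: vector_add_component vector_scaleR_component One_nth) simp
  then show ?thesis
    unfolding cb_def using emeasure_lborel_cbox_finite[of a "a + h *\<^sub>R One"]
    by (simp add: emeasure_eq_ennreal_measure less_top)
qed

lemma null_cb_diff_ob: "cb a h - ob a h \<in> null_sets lebesgue"
  unfolding cb_def ob_def using negligible_frontier_interval negligible_iff_null_sets by blast

text \<open>Greedy selection: take an index with the largest \<open>r\<close>, discard everything
  that meets its set, and recurse on the rest. Whatever is discarded meets a chosen set with at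
  least as large an \<open>r\<close>.\<close>

lemma vitali_finite:
  fixes c :: "'i \<Rightarrow> 'a set" and r :: "'i \<Rightarrow> real"
  assumes "finite F" and "\<And>i. i \<in> F \<Longrightarrow> c i \<noteq> {}"
  shows "\<exists>G\<subseteq>F. disjoint_family_on c G \<and> (\<forall>i\<in>F. \<exists>j\<in>G. r i \<le> r j \<and> c i \<inter> c j \<noteq> {})"
  using assms
proof (induction F rule: finite_psubset_induct)
  case (psubset F)
  show ?case
  proof (cases "F = {}")
    case False
    then obtain m where m: "m \<in> F" "\<And>i. i \<in> F \<Longrightarrow> r i \<le> r m"
    proof -
      have fin: "finite (r ` F)" "r ` F \<noteq> {}" using psubset.hyps False by auto
      then obtain m where "m \<in> F" "r m = Max (r ` F)" using Max_in[OF fin] by (metis imageE)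
      then show thesis using that Max_ge[OF fin(1)] by simp
    qed
    define F' where "F' = {i \<in> F. c i \<inter> c m = {}}"
    have "F' \<subset> F" using m psubset.prems[of m] by (auto simp: F'_def)
    then obtain G where G: "G \<subseteq> F'" "disjoint_family_on c G"
      "\<forall>i\<in>F'. \<exists>j\<in>G. r i \<le> r j \<and> c i \<inter> c j \<noteq> {}"
      using psubset.IH[of F'] psubset.prems by blast
    have "disjoint_family_on c (insert m G)"
      using G(1,2) by (auto simp: disjoint_family_on_def F'_def)
    moreover have "\<exists>j\<in>insert m G. r i \<le> r j \<and> c i \<inter> c j \<noteq> {}" if "i \<in> F" for i
      using that G(3) m(2) by (cases "i \<in> F'") (auto simp: F'_def)
    ultimately show ?thesis
      using G(1) m(1) by (intro exI[of _ "insert m G"]) (auto simp: F'_def)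
  qed (auto simp: disjoint_family_on_def)
qed

section \<open>Dilated cubes and the covering lemma for measures\<close>

definition dil5 :: "real^'n \<Rightarrow> real \<Rightarrow> (real^'n) set" where
  "dil5 a h = cb (a - (2 * h) *\<^sub>R One) (5 * h)"

text \<open>The concentric open triple contains the closed cube including its boundary. A cover by
  closed cubes thus becomes an open cover, to which the Lindelof property applies;
  \<open>dil5\<close> is just large enough to swallow such triples.\<close>

definition ob3 :: "real^'n \<Rightarrow> real \<Rightarrow> (real^'n) set" where
  "ob3 a h = ob (a - h *\<^sub>R One) (3 * h)"

lemma mem_dil5: "x \<in> dil5 a h \<longleftrightarrow> (\<forall>i. a $ i - 2 * h \<le> x $ i \<and> x $ i \<le> a $ i + 3 * h)"
  unfolding dil5_def mem_cb
  by (simp only: vector_minus_component vector_scaleR_component One_nth) (auto simp: algebra_simps)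

lemma mem_ob3: "x \<in> ob3 a h \<longleftrightarrow> (\<forall>i. a $ i - h < x $ i \<and> x $ i < a $ i + 2 * h)"
  unfolding ob3_def mem_ob
  by (simp only: vector_minus_component vector_scaleR_component One_nth) (auto simp: algebra_simps)

lemma dil5_lebesgue [measurable, simp]: "dil5 a h \<in> sets lebesgue"
  by (simp add: dil5_def)

lemma open_ob3 [simp]: "open (ob3 a h)"
  by (simp add: ob3_def)

text \<open>In each coordinate, a point of the triple differs by at most \<open>2 * h\<close>, hence
  by at most \<open>2 * k\<close>, from a common point of the two cubes.\<close>

lemma ob3_subset_dil5:
  assumes "h \<le> k" "cb a h \<inter> cb b k \<noteq> {}"
  shows "ob3 a h \<subseteq> dil5 b k"
proof
  fix y assume y: "y \<in> ob3 a h"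
  obtain z where z: "z \<in> cb a h" "z \<in> cb b k" using assms(2) by blast
  show "y \<in> dil5 b k"
    unfolding mem_dil5
  proof
    fix i
    show "b $ i - 2 * k \<le> y $ i \<and> y $ i \<le> b $ i + 3 * k"
      using z[unfolded mem_cb, rule_format, of i] y[unfolded mem_ob3, rule_format, of i] assms(1)
      by auto
  qed
qed

lemma cb_ne: "h \<ge> 0 \<Longrightarrow> a \<in> cb a h"
  by (simp add: mem_cb)

lemma cb_subset_ob3: "h > 0 \<Longrightarrow> cb a h \<subseteq> ob3 a h"
proof
  fix x assume h: "h > 0" and x: "x \<in> cb a h"
  show "x \<in> ob3 a h"
    unfolding mem_ob3
  proof
    fix i show "a $ i - h < x $ i \<and> x $ i < a $ i + 2 * h"
      using x[unfolded mem_cb, rule_format, of i] h by auto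
  qed
qed

lemma cb_subset_dil5: "h > 0 \<Longrightarrow> cb a h \<subseteq> dil5 a h"
  using cb_subset_ob3[of h a] ob3_subset_dil5[of h h a a] cb_ne[of h a] by auto

lemma subset_big_cube:
  assumes "norm c + l \<le> m"
  shows "cb c l \<subseteq> cb (- m *\<^sub>R One) (2 * m)"
proof
  have nth: "(- m *\<^sub>R One :: real^'n) $ i = - m" for i
    by (simp only: vector_scaleR_component One_nth) simp
  fix y assume y: "y \<in> cb c l"
  show "y \<in> cb (- m *\<^sub>R One) (2 * m)"
    unfolding mem_cb nth
  proof
    fix i
    have "\<bar>c $ i\<bar> \<le> norm c" by (rule component_le_norm_cart)
    then show "- m \<le> y $ i \<and> y $ i \<le> - m + 2 * m"
      using y[unfolded mem_cb, rule_format, of i] assms by auto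
  qed
qed

lemma UN_big_cubes: "(\<Union>m. cb (- real (Suc m) *\<^sub>R One :: real^'n) (2 * real (Suc m))) = UNIV"
proof safe
  fix x :: "real^'n"
  obtain m where m: "norm x \<le> real m" using real_arch_simple by blast
  have "x \<in> cb x 0" by (simp add: cb_ne)
  also have "cb x 0 \<subseteq> cb (- real (Suc m) *\<^sub>R One :: real^'n) (2 * real (Suc m))"
    by (rule subset_big_cube) (use m in simp)
  finally show "x \<in> (\<Union>m. cb (- real (Suc m) *\<^sub>R One :: real^'n) (2 * real (Suc m)))" by blast
qed auto

lemma open_lebesgue: "open (U :: 'a::euclidean_space set) \<Longrightarrow> U \<in> sets lebesgue"
  by simp

text \<open>For a finite subfamily, the dilates of a disjoint selection cover all triples, and the
  masses under \<open>N\<close> of disjoint cubes add up to at most the total mass. Since the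
  selection runs only on finite families, unbounded side lengths do no harm. The second measure
  \<open>N\<close> is a slot for a density, such as a multiple of \<open>\<mu>\<close> restricted to
  a set.\<close>

lemma vitali_measure:
  fixes \<mu> N :: "(real^'n) measure" and F :: "((real^'n) \<times> real) set" and D :: ennreal
  assumes sets [measurable_cong, simp]: "sets \<mu> = sets lebesgue" "sets N = sets lebesgue"
    and F: "\<And>a h. (a, h) \<in> F \<Longrightarrow> h > 0 \<and> emeasure \<mu> (cb a h) \<le> emeasure N (cb a h)"
    and dbl: "\<And>a h. h > 0 \<Longrightarrow> emeasure \<mu> (dil5 a h) \<le> D * emeasure \<mu> (cb a h)"
  shows "emeasure \<mu> (\<Union>(a, h)\<in>F. ob3 a h) \<le> D * emeasure N UNIV"
proof -
  have [simp]: "U \<in> sets \<mu>" if "open U" for U using that by simp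
  have fin: "emeasure \<mu> (\<Union>(a, h)\<in>F'. ob3 a h) \<le> D * emeasure N UNIV"
    if F': "finite F'" "F' \<subseteq> F" for F'
  proof -
    obtain G where G: "G \<subseteq> F'" "disjoint_family_on (\<lambda>(a, h). cb a h) G"
      "\<And>a h. (a, h) \<in> F' \<Longrightarrow> \<exists>(b, k)\<in>G. h \<le> k \<and> cb a h \<inter> cb b k \<noteq> {}"
    proof -
      have "(\<lambda>(a, h). cb a h) q \<noteq> {}" if "q \<in> F'" for q
        using F[of "fst q" "snd q"] cb_ne[of "snd q" "fst q"] that F'(2) by (auto simp: case_prod_unfold)
      from vitali_finite[of F' "\<lambda>(a, h). cb a h" snd, OF F'(1) this] obtain G where
        "G \<subseteq> F'" "disjoint_family_on (\<lambda>(a, h). cb a h) G"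
        "\<forall>i\<in>F'. \<exists>j\<in>G. snd i \<le> snd j \<and> (\<lambda>(a, h). cb a h) i \<inter> (\<lambda>(a, h). cb a h) j \<noteq> {}"
        by metis
      then show thesis by (intro that[of G]) (auto simp: case_prod_unfold, fastforce)
    qed
    have fG: "finite G" using G(1) F'(1) by (rule finite_subset)
    have "(\<Union>(a, h)\<in>F'. ob3 a h) \<subseteq> (\<Union>(a, h)\<in>G. dil5 a h)"
      using G(3) ob3_subset_dil5 by fastforce
    then have "emeasure \<mu> (\<Union>(a, h)\<in>F'. ob3 a h) \<le> emeasure \<mu> (\<Union>(a, h)\<in>G. dil5 a h)"
      using fG by (intro emeasure_mono sets.finite_UN) auto
    also have "\<dots> \<le> (\<Sum>(a, h)\<in>G. emeasure \<mu> (dil5 a h))"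
      unfolding case_prod_unfold by (rule emeasure_subadditive_finite[OF fG]) auto
    also have "\<dots> \<le> (\<Sum>(a, h)\<in>G. D * emeasure N (cb a h))"
    proof (rule sum_mono, clarify)
      fix a h assume "(a, h) \<in> G"
      then have "(a, h) \<in> F" using G(1) F'(2) by auto
      then show "emeasure \<mu> (dil5 a h) \<le> D * emeasure N (cb a h)"
        using dbl[of h a] F[of a h] by (meson mult_left_mono order_trans zero_le)
    qed
    also have "\<dots> = D * (\<Sum>(a, h)\<in>G. emeasure N (cb a h))"
      by (simp add: sum_distrib_left case_prod_unfold)
    also have "(\<Sum>(a, h)\<in>G. emeasure N (cb a h)) = emeasure N (\<Union>(a, h)\<in>G. cb a h)"
      using G(2) fG unfolding case_prod_unfold by (intro sum_emeasure) auto
    also have "D * \<dots> \<le> D * emeasure N UNIV"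
      by (intro mult_left_mono emeasure_mono) (auto simp: sets_eq_imp_space_eq[OF sets(2)])
    finally show ?thesis .
  qed
  \<comment> \<open>Passage to the whole family: a countable subfamily has the same union, and that
    union is the increasing limit of finite unions.\<close>
  have op: "\<And>S. S \<in> (\<lambda>(a, h). ob3 a h) ` F \<Longrightarrow> open S" by auto
  obtain \<F> where \<F>: "\<F> \<subseteq> (\<lambda>(a, h). ob3 a h) ` F" "countable \<F>"
      "\<Union>\<F> = (\<Union>(a, h)\<in>F. ob3 a h)"
    using Lindelof[OF op] by blast
  obtain F0 where F0: "F0 \<subseteq> F" "countable F0" "(\<Union>(a, h)\<in>F0. ob3 a h) = (\<Union>(a, h)\<in>F. ob3 a h)"
    using \<F> by (metis (no_types, lifting) countable_subset_image)
  show ?thesis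
  proof (cases "F0 = {}")
    case True
    then have "(\<Union>(a, h)\<in>F. ob3 a h) = {}" using F0(3) by simp
    then show ?thesis by (metis emeasure_empty zero_le)
  next
    case False
    define q where "q = from_nat_into F0"
    have q: "range q = F0" using False F0(2) by (simp add: q_def)
    define A where "A = (\<lambda>n. \<Union>(a, h)\<in>q ` {..n::nat}. ob3 a h)"
    have inc: "incseq A" unfolding incseq_def A_def by (intro allI impI UN_mono image_mono) auto
    have "(\<Union>(a, h)\<in>F. ob3 a h) = \<Union>(range A)"
    proof -
      have "(\<Union>(a, h)\<in>F. ob3 a h) = (\<Union>p\<in>range q. ob3 (fst p) (snd p))"
        unfolding q using F0(3) by (simp add: case_prod_unfold)
      also have "\<dots> = \<Union>(range A)"
        unfolding A_def case_prod_unfold UN_simps image_image by (auto intro: order_refl)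
      finally show ?thesis .
    qed
    also have "emeasure \<mu> (\<Union>(range A)) = (SUP n. emeasure \<mu> (A n))"
      by (rule SUP_emeasure_incseq[symmetric, OF _ inc]) (auto simp: A_def case_prod_unfold)
    also have "\<dots> \<le> D * emeasure N UNIV"
    proof (rule SUP_least)
      fix n
      have "q ` {..n} \<subseteq> F" using q F0(1) by auto
      then show "emeasure \<mu> (A n) \<le> D * emeasure N UNIV"
        unfolding A_def by (intro fin) auto
    qed
    finally show ?thesis .
  qed
qed

subsection \<open>The \<open>A\<^sub>\<infinity>\<close> property for pairs of doubling measures\<close>

declare sets.Int [simp] sets.Diff [simp]

text \<open>The setting for all covering arguments. The assumption \<open>ac\<close> lets outer
  regularity be inherited from Lebesgue measure and makes the boundaries of cubes
  negligible.\<close>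

locale cube_doubling =
  fixes \<mu> :: "(real^'n) measure" and D :: real
  assumes sets_mu [measurable_cong, simp]: "sets \<mu> = sets lebesgue"
    and fin: "h > 0 \<Longrightarrow> emeasure \<mu> (cb a h) < top"
    and pos: "h > 0 \<Longrightarrow> emeasure \<mu> (cb a h) > 0"
    and dbl: "h > 0 \<Longrightarrow> emeasure \<mu> (dil5 a h) \<le> ennreal D * emeasure \<mu> (cb a h)"
    and ac: "N \<in> null_sets lebesgue \<Longrightarrow> N \<in> null_sets \<mu>"
begin

lemma space_mu [simp]: "space \<mu> = UNIV"
  using sets_eq_imp_space_eq[OF sets_mu] by simp

lemma fin_sub:
  assumes "h > 0" "A \<subseteq> cb a h"
  shows "emeasure \<mu> A < top"
proof -
  have "emeasure \<mu> A \<le> emeasure \<mu> (cb a h)" using assms(2) by (rule emeasure_mono) simp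
  then show ?thesis using fin[OF assms(1)] by (rule le_less_trans)
qed

lemma emeasure_eq:
  assumes "h > 0" "A \<subseteq> cb a h"
  shows "emeasure \<mu> A = ennreal (measure \<mu> A)"
  using fin_sub[OF assms] by (simp add: emeasure_eq_ennreal_measure)

lemma fmeas: "h > 0 \<Longrightarrow> A \<in> sets lebesgue \<Longrightarrow> A \<subseteq> cb a h \<Longrightarrow> A \<in> fmeasurable \<mu>"
  using fin_sub by (auto intro!: fmeasurableI)

lemma measure_pos: "h > 0 \<Longrightarrow> measure \<mu> (cb a h) > 0"
  using pos[of h a] emeasure_eq[of h "cb a h" a] by simp

lemma measure_mono:
  assumes "h > 0" "A \<subseteq> B" "B \<subseteq> cb a h" "A \<in> sets lebesgue" "B \<in> sets lebesgue"
  shows "measure \<mu> A \<le> measure \<mu> B"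
  using assms fmeas[of h B a] by (intro measure_mono_fmeasurable) auto

lemma dil5_measure:
  assumes "h > 0" shows "measure \<mu> (dil5 a h) \<le> D * measure \<mu> (cb a h)"
    and D_ge_1: "D \<ge> 1"
proof -
  have e: "emeasure \<mu> (dil5 a h) = ennreal (measure \<mu> (dil5 a h))"
    unfolding dil5_def by (rule emeasure_eq[of "5 * h"]) (use assms in auto)
  have sub: "cb a h \<subseteq> dil5 a h" by (rule cb_subset_dil5[OF assms])
  have le: "ennreal (measure \<mu> (dil5 a h)) \<le> ennreal D * ennreal (measure \<mu> (cb a h))"
    using dbl[OF assms, of a] e emeasure_eq[OF assms order_refl, of a] by simp
  have le1: "measure \<mu> (cb a h) \<le> measure \<mu> (dil5 a h)"
    using measure_mono[of "5*h" "cb a h" "dil5 a h" "a - (2 * h) *\<^sub>R One"] sub assms by (simp add: dil5_def)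
  have "D > 0"
  proof (rule ccontr)
    assume "\<not> D > 0"
    then have "ennreal (measure \<mu> (dil5 a h)) \<le> 0" using le by (simp add: ennreal_neg)
    then show False using le1 measure_pos[OF assms, of a] by simp
  qed
  then show *: "measure \<mu> (dil5 a h) \<le> D * measure \<mu> (cb a h)"
    using le by (simp add: ennreal_mult[symmetric] flip: ennreal_mult)
  with le1 have "1 * measure \<mu> (cb a h) \<le> D * measure \<mu> (cb a h)" by linarith
  then show "D \<ge> 1" using measure_pos[OF assms, of a] by simp
qed

text \<open>Open supersets with Lebesgue excess tending to 0 are intersected finitely often to make
  them decreasing. Inside the cube \<open>\<mu>\<close> is finite, so continuity from above applies;
  the limit differs from \<open>E\<close> by a Lebesgue null set, which \<open>ac\<close> makes null
  for \<open>\<mu>\<close>.\<close>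

lemma outer_open:
  assumes "h > 0" "E \<subseteq> cb a h" "E \<in> sets lebesgue" "measure \<mu> E < t"
  shows "\<exists>U. open U \<and> E \<subseteq> U \<and> measure \<mu> (U \<inter> cb a h) < t"
proof -
  have "\<exists>T. open T \<and> E \<subseteq> T \<and> emeasure lebesgue (T - E) < ennreal (inverse (Suc n))" for n
  proof -
    obtain T where "open T" "E \<subseteq> T" "emeasure lebesgue (T - E) < ennreal (inverse (Suc n))"
      using sets_lebesgue_outer_open[OF assms(3), of "inverse (Suc n)"] by (metis inverse_positive_iff_positive of_nat_0_less_iff zero_less_Suc)
    then show ?thesis by blast
  qed
  then obtain T where T: "\<And>n. open (T n)" "\<And>n. E \<subseteq> T n"
    "\<And>n. emeasure lebesgue (T n - E) < ennreal (inverse (Suc n))" by metis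
  define V where "V n = (\<Inter>k\<in>{..n}. T k)" for n :: nat
  have V: "open (V n)" "E \<subseteq> V n" for n using T by (auto simp: V_def)
  define A where "A n = V n \<inter> cb a h" for n
  have Asets [simp]: "A n \<in> sets lebesgue" for n
    using V(1)[of n] open_lebesgue by (auto simp: A_def intro!: sets.Int)
  have dec: "decseq A" by (auto simp: decseq_def A_def V_def)
  have finA: "emeasure \<mu> (A n) < top" for n
    by (rule fin_sub[OF assms(1), of _ a]) (auto simp: A_def)
  have "(\<lambda>n. emeasure \<mu> (A n)) \<longlonglongrightarrow> emeasure \<mu> (\<Inter>n. A n)"
    using dec Asets finA
    by (intro Lim_emeasure_decseq) (auto simp: less_top[symmetric])
  moreover have "emeasure \<mu> (\<Inter>n. A n) = emeasure \<mu> E"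
  proof -
    have "emeasure lebesgue ((\<Inter>n. A n) - E) \<le> ennreal (inverse (Suc n))" for n
    proof -
      have "emeasure lebesgue ((\<Inter>n. A n) - E) \<le> emeasure lebesgue (T n - E)"
        using T(1)[of n] assms(3) by (intro emeasure_mono) (auto simp: A_def V_def)
      then show ?thesis using T(3)[of n] by (meson less_imp_le order_trans)
    qed
    then have "emeasure lebesgue ((\<Inter>n. A n) - E) \<le> 0"
      by (intro LIMSEQ_le_const[OF tendsto_ennrealI[OF LIMSEQ_inverse_real_of_nat, unfolded ennreal_0]]) auto
    then have "(\<Inter>n. A n) - E \<in> null_sets lebesgue"
      using assms(3) by (intro null_setsI sets.Diff sets.countable_INT) auto
    then have "(\<Inter>n. A n) - E \<in> null_sets \<mu>" by (rule ac)
    then have "emeasure \<mu> (E \<union> ((\<Inter>n. A n) - E)) = emeasure \<mu> E"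
      using assms(3) by (intro emeasure_Un_null_set) auto
    moreover have "E \<union> ((\<Inter>n. A n) - E) = (\<Inter>n. A n)" using V(2) assms(2) by (auto simp: A_def)
    ultimately show ?thesis by simp
  qed
  ultimately have "(\<lambda>n. emeasure \<mu> (A n)) \<longlonglongrightarrow> emeasure \<mu> E" by simp
  moreover have "emeasure \<mu> E < ennreal t"
    using assms emeasure_eq[OF assms(1,2)] by (simp add: ennreal_less_iff)
  ultimately have "\<forall>\<^sub>F n in sequentially. emeasure \<mu> (A n) < ennreal t"
    by (rule order_tendstoD(2))
  then obtain n where "emeasure \<mu> (A n) < ennreal t" by (auto simp: eventually_sequentially)
  then have "measure \<mu> (V n \<inter> cb a h) < t"
    using emeasure_eq[OF assms(1), of "A n" a] by (auto simp: A_def ennreal_less_iff)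
  then show ?thesis using V by blast
qed

end

lemma emeasure_density_indicator:
  assumes "S \<in> sets M" "A \<in> sets M"
  shows "emeasure (density M (\<lambda>x. c * indicator S x)) A = c * emeasure M (S \<inter> A)"
proof -
  have "emeasure (density M (\<lambda>x. c * indicator S x)) A = (\<integral>\<^sup>+x. c * indicator S x * indicator A x \<partial>M)"
    using assms by (intro emeasure_density) auto
  also have "\<dots> = (\<integral>\<^sup>+x. c * indicator (S \<inter> A) x \<partial>M)"
    by (intro nn_integral_cong) (auto split: split_indicator)
  also have "\<dots> = c * emeasure M (S \<inter> A)" using assms by (intro nn_integral_cmult_indicator) auto
  finally show ?thesis .
qed

text \<open>\<open>absorb\<close> is the weakest \<open>A_infty\<close> condition: one fixed pair of
  proportions for all cubes. Iteration upgrades it to a power bound. It is used with Lebesgue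
  measure as \<open>\<mu>\<close> and a weight as \<open>\<nu>\<close>, and once with the roles
  exchanged.\<close>

locale cube_doubling_pair = M: cube_doubling \<mu> D + N: cube_doubling \<nu> B
  for \<mu> \<nu> :: "(real^'n) measure" and D B :: real +
  fixes \<alpha> \<beta> :: real
  assumes \<alpha>: "0 < \<alpha>" "\<alpha> < 1" and \<beta>: "0 \<le> \<beta>" "\<beta> < 1"
    and absorb: "\<lbrakk>h > 0; E \<in> sets lebesgue; E \<subseteq> cb a h; measure \<mu> E \<le> \<alpha> * measure \<mu> (cb a h)\<rbrakk>
      \<Longrightarrow> measure \<nu> E \<le> \<beta> * measure \<nu> (cb a h)"
begin

text \<open>Stopping threshold: if the predecessor of the stopped cube has density at most
  \<open>lam\<close>, doubling gives density at most \<open>lam * D = \<alpha>\<close> in the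
  stopped cube, so that \<open>absorb\<close> applies there.\<close>

definition "lam = \<alpha> / D"

lemma D1: "D \<ge> 1" and B1: "B \<ge> 1"
  using M.D_ge_1[of 1] N.D_ge_1[of 1] by auto

lemma lam: "0 < lam" "lam < 1"
  using \<alpha> D1 by (auto simp: lam_def field_simps)

text \<open>The cubes \<open>x + 2\<^sup>-\<^sup>k (Q - x)\<close> shrink to \<open>x\<close> inside \<open>Q\<close>; we stop at the first one in which \<open>E\<close> is dense.\<close>
lemma stopping_cube:
  assumes h: "h > 0" and U: "open U" and E: "E = U \<inter> cb a h"
    and small: "measure \<mu> E \<le> lam * measure \<mu> (cb a h)" and x: "x \<in> E"
  shows "\<exists>b k. k > 0 \<and> x \<in> cb b k \<and> cb b k \<subseteq> cb a h \<and>
    lam * measure \<mu> (cb b k) \<le> measure \<mu> (E \<inter> cb b k) \<and>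
    measure \<mu> (E \<inter> cb b k) \<le> \<alpha> * measure \<mu> (cb b k)"
proof -
  define r where "r k = (1/2::real) ^ k" for k :: nat
  have r: "0 < r k" "r k \<le> 1" for k by (auto simp: r_def power_le_one)
  define c where "c k = x + r k *\<^sub>R (a - x)" for k
  define Q where "Q k = cb (c k) (r k * h)" for k
  have c_nth: "c k $ i = x $ i + r k * (a $ i - x $ i)" for k i by (simp add: c_def)
  have xQ: "a $ i \<le> x $ i" "x $ i \<le> a $ i + h" for i using x by (auto simp: E mem_cb)
  have rh: "r k * h > 0" for k using r(1) h by simp
  have [simp]: "Q k \<in> sets lebesgue" "E \<in> sets lebesgue" for k using U by (auto simp: Q_def E)
  have xin: "x \<in> Q k" for k
    unfolding Q_def mem_cb c_nth
  proof
    fix i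
    have "r k * (a $ i - x $ i) \<le> 0" "0 \<le> r k * (a $ i - x $ i + h)"
      using r[of k] xQ[of i] by (auto simp: mult_nonneg_nonpos)
    then show "x $ i + r k * (a $ i - x $ i) \<le> x $ i \<and> x $ i \<le> x $ i + r k * (a $ i - x $ i) + r k * h"
      by (simp add: algebra_simps)
  qed
  have sub: "Q k \<subseteq> cb a h" for k
  proof
    fix y assume y: "y \<in> Q k"
    show "y \<in> cb a h"
      unfolding mem_cb
    proof
      fix i
      have "0 \<le> (1 - r k) * (x $ i - a $ i)" "0 \<le> (1 - r k) * (a $ i + h - x $ i)"
        using r[of k] xQ[of i] by auto
      moreover have "c k $ i \<le> y $ i" "y $ i \<le> c k $ i + r k * h" using y by (auto simp: Q_def mem_cb)
      ultimately show "a $ i \<le> y $ i \<and> y $ i \<le> a $ i + h"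
        by (auto simp: c_nth algebra_simps)
    qed
  qed
  have Q0: "Q 0 = cb a h" by (simp add: Q_def c_def r_def)
  \<comment> \<open>Openness of \<open>U\<close> guarantees that the stopping criterion is met at
    every point of \<open>E\<close>: a small enough cube of the sequence has density 1.\<close>
  have "\<exists>k. Q k \<subseteq> E"
  proof -
    obtain e where e: "e > 0" "ball x e \<subseteq> U" using U x by (auto simp: E open_contains_ball)
    have "(\<lambda>k. r k * (real CARD('n) * h)) \<longlonglongrightarrow> 0 * (real CARD('n) * h)"
      unfolding r_def by (intro tendsto_mult LIMSEQ_power_zero tendsto_const) auto
    then have "\<forall>\<^sub>F k in sequentially. r k * (real CARD('n) * h) < e"
      using e(1) by (intro order_tendstoD(2)) auto
    then obtain k where k: "r k * (real CARD('n) * h) < e" by (auto simp: eventually_sequentially)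
    have "y \<in> U" if y: "y \<in> Q k" for y
    proof -
      have "norm (y - x) \<le> (\<Sum>i\<in>UNIV. \<bar>(y - x) $ i\<bar>)" by (rule norm_le_l1_cart)
      also have "\<dots> \<le> (\<Sum>i\<in>(UNIV::'n set). r k * h)"
      proof (rule sum_mono)
        fix i
        have "c k $ i \<le> y $ i" "y $ i \<le> c k $ i + r k * h" "c k $ i \<le> x $ i" "x $ i \<le> c k $ i + r k * h"
          using y xin[of k] by (auto simp: Q_def mem_cb)
        then show "\<bar>(y - x) $ i\<bar> \<le> r k * h" by simp
      qed
      also have "\<dots> < e" using k by (simp add: mult_ac)
      finally show ?thesis using e(2) by (auto simp: dist_norm norm_minus_commute)
    qed
    then show ?thesis using sub[of k] E by blast
  qed
  then obtain k0 where k0: "Q k0 \<subseteq> E" by blast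
  define P where "P k \<longleftrightarrow> measure \<mu> (E \<inter> Q k) > lam * measure \<mu> (Q k)" for k
  have "P k0"
  proof -
    have "E \<inter> Q k0 = Q k0" using k0 by blast
    moreover have "measure \<mu> (Q k0) > 0" unfolding Q_def by (rule M.measure_pos[OF rh])
    ultimately show ?thesis using lam by (simp add: P_def)
  qed
  define k where "k = (LEAST k. P k)"
  have Pk: "P k" unfolding k_def using \<open>P k0\<close> by (rule LeastI)
  have "\<not> P 0"
  proof -
    have "E \<inter> Q 0 = E" by (auto simp: Q0 E)
    then show ?thesis using small by (simp add: P_def Q0)
  qed
  with Pk obtain j where j: "k = Suc j" by (cases k) auto
  have nP: "\<not> P j" using not_less_Least[of j P] j by (simp add: k_def)
  have rj: "r j = 2 * r k" by (simp add: r_def j)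
  have shift: "c j $ i = c k $ i + r k * (a $ i - x $ i)" "r k * (a $ i - x $ i) \<le> 0"
    "r k * (a $ i - x $ i) \<ge> - (r k * h)" for i
    using r[of k] xQ[of i] mult_left_mono[of "- h" "a $ i - x $ i" "r k"]
    by (auto simp: c_nth rj mult_nonneg_nonpos algebra_simps)
  \<comment> \<open>The predecessor has only twice the side and contains the stopped cube, so it
    fits into the fivefold dilate although the two are not concentric.\<close>
  have "Q j \<subseteq> dil5 (c k) (r k * h)"
  proof
    fix y assume y: "y \<in> Q j"
    show "y \<in> dil5 (c k) (r k * h)"
      unfolding mem_dil5
    proof
      fix i
      show "c k $ i - 2 * (r k * h) \<le> y $ i \<and> y $ i \<le> c k $ i + 3 * (r k * h)"
        using y[unfolded Q_def mem_cb, rule_format, of i] shift[of i] rh[of k] by (simp add: rj)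
    qed
  qed
  then have "measure \<mu> (Q j) \<le> measure \<mu> (dil5 (c k) (r k * h))"
    using rh[of k] by (intro M.measure_mono[of "5 * (r k * h)"]) (auto simp: dil5_def)
  also have "\<dots> \<le> D * measure \<mu> (Q k)" unfolding Q_def by (rule M.dil5_measure[OF rh])
  finally have Qj: "measure \<mu> (Q j) \<le> D * measure \<mu> (Q k)" .
  have "Q k \<subseteq> Q j"
  proof
    fix y assume y: "y \<in> Q k"
    show "y \<in> Q j"
      unfolding Q_def mem_cb
    proof
      fix i show "c j $ i \<le> y $ i \<and> y $ i \<le> c j $ i + r j * h"
        using y[unfolded Q_def mem_cb, rule_format, of i] shift[of i] by (simp add: rj)
    qed
  qed
  then have "measure \<mu> (E \<inter> Q k) \<le> measure \<mu> (E \<inter> Q j)"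
    using sub h by (intro M.measure_mono[of h _ _ a]) auto
  also have "\<dots> \<le> lam * measure \<mu> (Q j)" using nP by (simp add: P_def)
  also have "\<dots> \<le> lam * (D * measure \<mu> (Q k))" using Qj lam by simp
  also have "\<dots> = \<alpha> * measure \<mu> (Q k)" using D1 by (simp add: lam_def)
  finally show ?thesis
    using Pk xin[of k] sub[of k] rh[of k] unfolding P_def Q_def by (meson less_imp_le)
qed

text \<open>Both constants are read off from \<open>enlarge\<close>. There
  \<open>\<nu>(E) \<le> B/(1-\<beta>) \<nu>(V - E)\<close> inside the cube, which rearranges to
  \<open>\<nu>(E) \<le> theta \<nu>(V)\<close>, while \<open>\<mu>(V)\<close> exceeds
  \<open>\<mu>(E)\<close> at most by the factor \<open>D / lam = 1 / tau\<close>.\<close>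

definition "theta = 1 / (1 + (1 - \<beta>) / B)"
definition "tau = lam / D"

lemma theta: "0 < theta" "theta < 1"
  using \<beta> B1 by (auto simp: theta_def field_simps add_pos_pos)

lemma tau: "0 < tau" "tau < 1"
  using lam D1 by (auto simp: tau_def field_simps)

text \<open>\<open>V\<close> is the union of the tripled stopping cubes, in each of which
  \<open>E\<close> has \<open>\<mu>\<close>-density between \<open>lam\<close> and
  \<open>\<alpha>\<close>. The lower bound and Vitali keep \<open>V\<close> small for
  \<open>\<mu>\<close>. The upper bound and \<open>absorb\<close> give the part \<open>S\<close> of
  \<open>V\<close> outside \<open>E\<close> a \<open>\<nu>\<close>-share of at least
  \<open>1 - \<beta>\<close> in each cube, so Vitali for \<open>\<nu>\<close> bounds
  \<open>E\<close> by \<open>S\<close>. Since \<open>V\<close> is open again, the step can be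
  repeated.\<close>

lemma enlarge:
  assumes h: "h > 0" and U: "open U"
    and small: "measure \<mu> (U \<inter> cb a h) \<le> lam * measure \<mu> (cb a h)"
  shows "\<exists>V. open V \<and> measure \<mu> (V \<inter> cb a h) \<le> measure \<mu> (U \<inter> cb a h) / tau
    \<and> measure \<nu> (U \<inter> cb a h) \<le> theta * measure \<nu> (V \<inter> cb a h)"
proof -
  define E where "E = U \<inter> cb a h"
  have Eb [simp]: "E \<in> sets lebesgue" "E \<subseteq> cb a h" using U by (auto simp: E_def)
  define F where "F = {(b, k). k > 0 \<and> cb b k \<subseteq> cb a h \<and>
    lam * measure \<mu> (cb b k) \<le> measure \<mu> (E \<inter> cb b k) \<and>
    measure \<mu> (E \<inter> cb b k) \<le> \<alpha> * measure \<mu> (cb b k)}"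
  define V where "V = (\<Union>(b, k)\<in>F. ob3 b k)"
  have oV: "open V" unfolding V_def by auto
  have [simp]: "V \<in> sets lebesgue" using oV by simp
  have EV: "E \<subseteq> V"
  proof
    fix x assume "x \<in> E"
    then obtain b k where "(b, k) \<in> F" "x \<in> cb b k" "k > 0"
      using stopping_cube[OF h U E_def, of x] small by (auto simp: E_def F_def)
    then show "x \<in> V" using cb_subset_ob3[of k b] by (auto simp: V_def)
  qed
  have FV: "cb b k \<subseteq> V" if "(b, k) \<in> F" for b k
    using that cb_subset_ob3[of k b] by (auto simp: V_def F_def)
  have "emeasure \<mu> V \<le> ennreal D * emeasure (density \<mu> (\<lambda>x. ennreal (1 / lam) * indicator E x)) UNIV"
    unfolding V_def
  proof (rule vitali_measure)
    fix b k assume bk: "(b, k) \<in> F"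
    then have k: "k > 0" and s: "E \<inter> cb b k \<subseteq> cb a h" "cb b k \<subseteq> cb a h" by (auto simp: F_def)
    have "measure \<mu> (cb b k) \<le> 1 / lam * measure \<mu> (E \<inter> cb b k)"
      using bk lam by (auto simp: F_def field_simps)
    then show "0 < k \<and> emeasure \<mu> (cb b k) \<le> emeasure (density \<mu> (\<lambda>x. ennreal (1 / lam) * indicator E x)) (cb b k)"
      using lam k by (subst emeasure_density_indicator)
        (auto simp: M.emeasure_eq[OF h s(1)] M.emeasure_eq[OF h s(2)] ennreal_mult[symmetric] intro!: ennreal_leI simp flip: ennreal_mult)
  qed (auto simp: M.dbl)
  then have "emeasure \<mu> V \<le> ennreal D * (ennreal (1 / lam) * emeasure \<mu> E)"
    by (subst (asm) emeasure_density_indicator) auto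
  then have "emeasure \<mu> (V \<inter> cb a h) \<le> ennreal D * (ennreal (1 / lam) * emeasure \<mu> E)"
    by (rule order_trans[rotated]) (auto intro!: emeasure_mono)
  then have 1: "measure \<mu> (V \<inter> cb a h) \<le> measure \<mu> E / tau"
    using M.emeasure_eq[OF h, of "V \<inter> cb a h" a] M.emeasure_eq[OF h, of E a] D1 lam
    by (auto simp: tau_def mult.commute simp flip: ennreal_mult)
  define S where "S = (V \<inter> cb a h) - E"
  have [simp]: "S \<in> sets lebesgue" "S \<subseteq> cb a h" unfolding S_def by (intro sets.Diff sets.Int, auto)
  have "emeasure \<nu> V \<le> ennreal B * emeasure (density \<nu> (\<lambda>x. ennreal (1 / (1 - \<beta>)) * indicator S x)) UNIV"
    unfolding V_def
  proof (rule vitali_measure)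
    fix b k assume bk: "(b, k) \<in> F"
    then have k: "k > 0" and s: "E \<inter> cb b k \<subseteq> cb a h" "cb b k \<subseteq> cb a h" "S \<inter> cb b k \<subseteq> cb a h"
      by (auto simp: F_def)
    have "measure \<nu> (E \<inter> cb b k) \<le> \<beta> * measure \<nu> (cb b k)"
      using bk by (intro absorb) (auto simp: F_def)
    moreover have "measure \<nu> (cb b k) \<le> measure \<nu> (E \<inter> cb b k) + measure \<nu> (S \<inter> cb b k)"
    proof -
      have "cb b k = (E \<inter> cb b k) \<union> (S \<inter> cb b k)" using FV[OF bk] s(2) by (auto simp: S_def)
      then show ?thesis
        using measure_Un_le[of "E \<inter> cb b k" \<nu> "S \<inter> cb b k"] by simp
    qed
    ultimately have "measure \<nu> (cb b k) \<le> 1 / (1 - \<beta>) * measure \<nu> (S \<inter> cb b k)"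
      using \<beta> by (simp add: field_simps)
    then show "0 < k \<and> emeasure \<nu> (cb b k) \<le> emeasure (density \<nu> (\<lambda>x. ennreal (1 / (1 - \<beta>)) * indicator S x)) (cb b k)"
      using \<beta> k by (subst emeasure_density_indicator)
        (auto simp: N.emeasure_eq[OF h s(3)] N.emeasure_eq[OF h s(2)] intro!: ennreal_leI simp flip: ennreal_mult)
  qed (auto simp: N.dbl)
  then have "emeasure \<nu> V \<le> ennreal B * (ennreal (1 / (1 - \<beta>)) * emeasure \<nu> S)"
    by (subst (asm) emeasure_density_indicator) auto
  then have "emeasure \<nu> E \<le> ennreal B * (ennreal (1 / (1 - \<beta>)) * emeasure \<nu> S)"
    by (rule order_trans[rotated]) (use EV in \<open>auto intro!: emeasure_mono\<close>)
  then have "measure \<nu> E \<le> B * (1 / (1 - \<beta>) * measure \<nu> S)"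
    using N.emeasure_eq[OF h, of S a] N.emeasure_eq[OF h, of E a] B1 \<beta>
    by (auto simp flip: ennreal_mult)
  moreover have "measure \<nu> (V \<inter> cb a h) = measure \<nu> S + measure \<nu> E"
  proof -
    have "V \<inter> cb a h = S \<union> E" using EV by (auto simp: S_def E_def)
    moreover have "S \<inter> E = {}" by (auto simp: S_def)
    ultimately show ?thesis
      using N.fmeas[OF h, of S a] N.fmeas[OF h, of E a] by (simp add: measure_Union fmeasurable_def less_top)
  qed
  ultimately have "measure \<nu> E \<le> B / (1 - \<beta>) * (measure \<nu> (V \<inter> cb a h) - measure \<nu> E)" by simp
  then have "measure \<nu> E \<le> theta * measure \<nu> (V \<inter> cb a h)"
    using \<beta> B1 by (simp add: theta_def field_simps)
  then show ?thesis using 1 oV unfolding E_def by blast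
qed

text \<open>Each enlargement costs a factor \<open>1 / tau\<close> in \<open>\<mu>\<close>, gains a
  factor \<open>theta\<close> in \<open>\<nu>\<close>, and requires relative
  \<open>\<mu>\<close>-mass at most \<open>lam\<close>. The smallness assumed leaves room for
  exactly \<open>N\<close> of them.\<close>

lemma iterate_open:
  assumes h: "h > 0"
  shows "open U \<Longrightarrow> measure \<mu> (U \<inter> cb a h) \<le> tau ^ N * lam * measure \<mu> (cb a h)
    \<Longrightarrow> measure \<nu> (U \<inter> cb a h) \<le> theta ^ N * measure \<nu> (cb a h)"
proof (induction N arbitrary: U)
  case 0
  then show ?case using N.measure_mono[OF h, of "U \<inter> cb a h" "cb a h" a] open_lebesgue[of U] by (simp add: sets.Int)
next
  case (Suc N)
  have "tau ^ Suc N * lam * measure \<mu> (cb a h) \<le> 1 * lam * measure \<mu> (cb a h)"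
    using tau lam by (intro mult_right_mono power_le_one) auto
  then obtain V where V: "open V" "measure \<mu> (V \<inter> cb a h) \<le> measure \<mu> (U \<inter> cb a h) / tau"
    "measure \<nu> (U \<inter> cb a h) \<le> theta * measure \<nu> (V \<inter> cb a h)"
    using enlarge[OF h Suc.prems(1), of a] Suc.prems(2) by auto
  have "measure \<mu> (U \<inter> cb a h) / tau \<le> tau ^ N * lam * measure \<mu> (cb a h)"
    using Suc.prems(2) tau by (simp add: field_simps)
  then have "measure \<nu> (V \<inter> cb a h) \<le> theta ^ N * measure \<nu> (cb a h)"
    using V by (intro Suc.IH) auto
  then have "theta * measure \<nu> (V \<inter> cb a h) \<le> theta * (theta ^ N * measure \<nu> (cb a h))"
    using theta by simp
  then show ?case using V(3) by (simp add: mult_ac)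
qed

lemma iterate:
  assumes h: "h > 0" and E: "E \<in> sets lebesgue" "E \<subseteq> cb a h"
    and "measure \<mu> E < tau ^ N * lam * measure \<mu> (cb a h)"
  shows "measure \<nu> E \<le> theta ^ N * measure \<nu> (cb a h)"
proof -
  obtain U where U: "open U" "E \<subseteq> U" "measure \<mu> (U \<inter> cb a h) < tau ^ N * lam * measure \<mu> (cb a h)"
    using M.outer_open[OF h E(2,1) assms(4)] by blast
  have "measure \<nu> E \<le> measure \<nu> (U \<inter> cb a h)"
    using U E by (intro N.measure_mono[OF h, of _ _ a]) auto
  also have "\<dots> \<le> theta ^ N * measure \<nu> (cb a h)"
    using U by (intro iterate_open h) auto
  finally show ?thesis .
qed

text \<open>Enough iterations push \<open>theta ^ N\<close> below \<open>\<epsilon>\<close>. Read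
  contrapositively, a lower bound for the \<open>\<nu>\<close>-density of a set yields one for its
  \<open>\<mu>\<close>-density.\<close>

lemma small_imp_small:
  assumes "\<epsilon> > 0"
  shows "\<exists>\<eta>>0. \<forall>a h E. h > 0 \<longrightarrow> E \<in> sets lebesgue \<longrightarrow> E \<subseteq> cb a h \<longrightarrow>
    measure \<mu> E < \<eta> * measure \<mu> (cb a h) \<longrightarrow> measure \<nu> E < \<epsilon> * measure \<nu> (cb a h)"
proof -
  obtain N where N: "theta ^ N < \<epsilon>" using real_arch_pow_inv[OF assms theta(2)] by blast
  have "measure \<nu> E < \<epsilon> * measure \<nu> (cb a h)"
    if "h > 0" "E \<in> sets lebesgue" "E \<subseteq> cb a h" "measure \<mu> E < (tau ^ N * lam) * measure \<mu> (cb a h)" for a h E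
    using iterate[OF that] mult_strict_right_mono[OF N N.measure_pos[OF that(1), of a]] by linarith
  then show ?thesis using tau lam by (intro exI[of _ "tau ^ N * lam"]) auto
qed

text \<open>The exponent solves \<open>tau powr delta = theta\<close>. The two factors
  \<open>tau\<close> in \<open>const\<close> pay for rounding the density to a power of
  \<open>tau\<close>: one secures the strict inequality in \<open>iterate\<close>, the other the use
  of \<open>N - 1\<close> in place of \<open>N\<close>.\<close>

definition "delta = ln theta / ln tau"
definition "const = (tau * tau * lam) powr (- delta)"

lemma delta_pos: "delta > 0"
  using theta tau by (simp add: delta_def divide_neg_neg)

lemma const_pos: "const > 0"
  using tau lam by (simp add: const_def)

lemma power_bound:
  assumes "h > 0" "E \<in> sets lebesgue" "E \<subseteq> cb a h"
  shows "measure \<nu> E \<le> const * (measure \<mu> E / measure \<mu> (cb a h)) powr delta * measure \<nu> (cb a h)"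
proof -
  define \<delta> where "\<delta> = delta"
  define C where "C = const"
  have C_def: "C = (tau * tau * lam) powr (- \<delta>)" by (simp add: C_def \<delta>_def const_def)
  have lt: "ln theta < 0" "ln tau < 0" using theta tau by auto
  have \<delta>: "\<delta> > 0" by (simp add: \<delta>_def delta_pos)
  have td: "tau powr \<delta> = theta" using lt theta tau by (simp add: \<delta>_def delta_def powr_def)
  have "measure \<nu> E \<le> C * (measure \<mu> E / measure \<mu> (cb a h)) powr \<delta> * measure \<nu> (cb a h)"
    if h: "h > 0" and E: "E \<in> sets lebesgue" "E \<subseteq> cb a h" for a h E
  proof -
    define \<rho> where "\<rho> = measure \<mu> E / measure \<mu> (cb a h)"
    note mp = M.measure_pos[OF h, of a]
    have \<rho>0: "\<rho> \<ge> 0" by (simp add: \<rho>_def)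
    have step: "measure \<nu> E \<le> theta ^ N * measure \<nu> (cb a h)" if "\<rho> < tau ^ N * lam" for N
      using that mp by (intro iterate[OF h E]) (simp add: \<rho>_def field_simps)
    have "measure \<nu> E \<le> C * \<rho> powr \<delta> * measure \<nu> (cb a h)"
    proof (cases "\<rho> = 0")
      case True
      \<comment> \<open>Density 0 permits every number of iterations, so \<open>E\<close> is null
        for \<open>\<nu>\<close>.\<close>
      have "(\<lambda>N. theta ^ N * measure \<nu> (cb a h)) \<longlonglongrightarrow> 0 * measure \<nu> (cb a h)"
        using theta by (intro tendsto_mult LIMSEQ_power_zero tendsto_const) auto
      moreover have "measure \<nu> E \<le> theta ^ N * measure \<nu> (cb a h)" for N
        using step[of N] True tau lam by simp
      ultimately have "measure \<nu> E \<le> 0" by (intro LIMSEQ_le_const) auto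
      then show ?thesis using True \<delta> by simp
    next
      case False
      with \<rho>0 have \<rho>: "\<rho> > 0" by simp
      obtain N0 where N0: "tau ^ N0 < \<rho> / (tau * lam)"
        using real_arch_pow_inv[of "\<rho> / (tau * lam)" tau] tau lam \<rho> by auto
      define N where "N = (LEAST N. tau ^ N < \<rho> / (tau * lam))"
      have N: "tau ^ N < \<rho> / (tau * lam)" unfolding N_def using N0 by (rule LeastI)
      \<comment> \<open>By minimality of \<open>N\<close>, the density still admits
        \<open>N - 1\<close> iterations. Subtraction is truncated, so \<open>N = 0\<close> and
        \<open>N = 1\<close> both fall under the trivial bound with exponent 0.\<close>
      have "measure \<nu> E \<le> theta ^ (N - 1) * measure \<nu> (cb a h)"
      proof (cases "N - 1")
        case 0
        then show ?thesis using N.measure_mono[OF h E(2) order_refl E(1)] by simp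
      next
        case (Suc j)
        then have "\<not> tau ^ Suc j < \<rho> / (tau * lam)" using not_less_Least[of "Suc j" "\<lambda>N. tau ^ N < \<rho> / (tau * lam)"]
          by (simp add: N_def)
        then have "\<rho> \<le> tau ^ (N - 1) * tau * lam" using tau lam Suc by (simp add: field_simps)
        also have "\<dots> < tau ^ (N - 1) * 1 * lam" using tau lam by (intro mult_strict_right_mono mult_strict_left_mono) auto
        finally show ?thesis by (intro step) simp
      qed
      also have "theta ^ (N - 1) \<le> C * \<rho> powr \<delta>"
      proof -
        have "theta ^ (N - 1) = (tau ^ (N - 1)) powr \<delta>"
          unfolding td[symmetric] using tau by (simp add: powr_powr powr_realpow[symmetric] mult.commute)
        also have "\<dots> \<le> (\<rho> / (tau * tau * lam)) powr \<delta>"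
        proof (intro powr_mono2)
          have "tau ^ (N - 1) * tau \<le> tau ^ N"
            by (cases N) (use tau in auto)
          also have "\<dots> \<le> \<rho> / (tau * lam)" using N by simp
          finally show "tau ^ (N - 1) \<le> \<rho> / (tau * tau * lam)"
            using tau lam by (simp add: field_simps)
        qed (use \<delta> tau in auto)
        also have "\<dots> = C * \<rho> powr \<delta>"
          using tau lam \<rho> by (simp add: C_def powr_divide powr_minus field_simps)
        finally show ?thesis .
      qed
      finally show ?thesis by (simp add: mult_right_mono)
    qed
    then show ?thesis by (simp add: \<rho>_def)
  qed
  then show ?thesis using assms by (simp add: C_def \<delta>_def const_def)
qed

end

subsection \<open>Maximal operators with respect to doubling measures\<close>

declare emeasure_completion [simp del]

text \<open>All positive \<open>r\<close> are covered because the strong type estimate uses the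
  exponent \<open>q - 1\<close>, which may be below 1; the integrand is then unbounded near 0 but
  integrable. For infinite \<open>a\<close> the integral dominates every finite value.\<close>

lemma epowr_layer_cake:
  assumes r: "r > 0"
  shows "(\<integral>\<^sup>+t. ennreal (r * t powr (r - 1)) * indicator {t. 0 < t \<and> ennreal t < a} t \<partial>lborel) = epowr a r"
proof -
  have fin: "(\<integral>\<^sup>+t. ennreal (r * t powr (r - 1)) * indicator {t. 0 < t \<and> ennreal t < ennreal c} t \<partial>lborel)
    = ennreal (c powr r)" if c: "c \<ge> 0" for c
  proof -
    have "((\<lambda>t. r * t powr (r - 1)) has_integral (r * (c powr (r - 1 + 1) / (r - 1 + 1)))) {0..c}"
      using r c by (intro has_integral_mult_right has_integral_powr_from_0) auto
    then have i: "((\<lambda>t. r * t powr (r - 1)) has_integral (c powr r)) {0..c}" using r by simp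
    have "(\<integral>\<^sup>+t. ennreal (r * t powr (r - 1)) * indicator {t. 0 < t \<and> ennreal t < ennreal c} t \<partial>lborel)
      = (\<integral>\<^sup>+t. ennreal (r * t powr (r - 1)) * indicator {0..c} t \<partial>lborel)"
    proof (rule nn_integral_cong_AE)
      show "AE t in lborel. ennreal (r * t powr (r - 1)) * indicator {t. 0 < t \<and> ennreal t < ennreal c} t
        = ennreal (r * t powr (r - 1)) * indicator {0..c} t"
        using AE_lborel_singleton[of c]
        by eventually_elim (use c in \<open>auto split: split_indicator simp: ennreal_less_iff\<close>)
    qed
    also have "\<dots> = ennreal (c powr r)"
      using r by (intro nn_integral_has_integral_lebesgue' i) auto
    finally show ?thesis .
  qed
  show ?thesis
  proof (cases a)
    case (real c)
    then show ?thesis using fin[of c] by simp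
  next
    case top
    have "ennreal x \<le> (\<integral>\<^sup>+t. ennreal (r * t powr (r - 1)) * indicator {t. 0 < t \<and> ennreal t < a} t \<partial>lborel)"
      (is "_ \<le> ?I") if "x \<ge> 0" for x
    proof -
      have "ennreal x = ennreal ((x powr (1 / r)) powr r)" using that r by (simp add: powr_powr)
      also have "\<dots> = (\<integral>\<^sup>+t. ennreal (r * t powr (r - 1)) * indicator {t. 0 < t \<and> ennreal t < ennreal (x powr (1/r))} t \<partial>lborel)"
        by (rule fin[symmetric]) simp
      also have "\<dots> \<le> ?I"
        by (intro nn_integral_mono mult_left_mono) (auto split: split_indicator simp: top)
      finally show ?thesis .
    qed
    note ge = this
    have "?I = top"
    proof (rule ccontr)
      assume "?I \<noteq> top"
      then obtain b where b: "?I = ennreal b" "b \<ge> 0" by (cases ?I) auto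
      have "ennreal (b + 1) \<le> ennreal b" using ge[of "b + 1"] b by simp
      then show False using b(2) by simp
    qed
    then show ?thesis using top by simp
  qed
qed

text \<open>The averages are over closed cubes, but the point has to lie in the open one. This makes
  superlevel sets open, hence measurable, whatever \<open>g\<close> is.\<close>

definition mmax :: "(real^'n) measure \<Rightarrow> (real^'n \<Rightarrow> ennreal) \<Rightarrow> real^'n \<Rightarrow> ennreal" where
  "mmax \<mu> g x = (SUP (a, h)\<in>{(a, h). h > 0 \<and> x \<in> ob a h}.
     (set_nn_integral \<mu> (cb a h) g) / emeasure \<mu> (cb a h))"

lemma mmax_ge:
  assumes "h > 0" "x \<in> ob a h"
  shows "set_nn_integral \<mu> (cb a h) g / emeasure \<mu> (cb a h) \<le> mmax \<mu> g x"
  unfolding mmax_def using assms by (intro SUP_upper2[of "(a, h)"]) auto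

lemma less_mmax_iff:
  "t < mmax \<mu> g x \<longleftrightarrow> (\<exists>a h. h > 0 \<and> x \<in> ob a h \<and>
     t < set_nn_integral \<mu> (cb a h) g / emeasure \<mu> (cb a h))"
  by (auto simp: mmax_def less_SUP_iff)

lemma open_mmax: "open {x. t < mmax \<mu> g x}"
proof -
  have "{x. t < mmax \<mu> g x} = \<Union>{ob a h |a h. h > 0 \<and>
      t < set_nn_integral \<mu> (cb a h) g / emeasure \<mu> (cb a h)}"
    by (auto simp: less_mmax_iff)
  then show ?thesis by (auto intro!: open_Union)
qed

lemma measurable_mmax [measurable]: "mmax \<mu> g \<in> borel_measurable lebesgue"
  using open_lebesgue[OF open_mmax] by (intro borel_measurableI_greater) simp

lemma divide_less_ennreal_iff:
  fixes x y t :: ennreal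
  assumes "0 < y" "y < top"
  shows "t < x / y \<longleftrightarrow> t * y < x"
proof -
  obtain b where b: "y = ennreal b" "b > 0" using assms by (cases y) auto
  show ?thesis
  proof (cases x)
    case (real a)
    show ?thesis
    proof (cases t)
      case (real c)
      then show ?thesis using \<open>x = ennreal a\<close> \<open>0 \<le> a\<close> b
        by (simp add: divide_ennreal ennreal_less_iff pos_less_divide_eq flip: ennreal_mult)
    next
      case top
      then show ?thesis using b by (simp add: ennreal_top_mult)
    qed
  next
    case top
    then have "x / y = top" using b by (simp add: ennreal_top_divide)
    moreover have "t * y < top \<longleftrightarrow> t < top"
    proof (cases t)
      case (real c)
      then show ?thesis using b by (simp flip: ennreal_mult)
    next
      case top
      then show ?thesis using b by (simp add: ennreal_top_mult)
    qed
    ultimately show ?thesis using top by simp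
  qed
qed

context cube_doubling
begin

text \<open>A cube on which the average of \<open>g\<close> exceeds \<open>t\<close> has
  \<open>\<mu>\<close>-measure at most its mass for the density \<open>g / t\<close>, which is the
  comparison that \<open>vitali_measure\<close> asks for.\<close>

lemma weak_type:
  assumes g [measurable]: "g \<in> borel_measurable lebesgue" and t: "t > 0"
  shows "emeasure \<mu> {x. ennreal t < mmax \<mu> g x} \<le> ennreal (D / t) * (\<integral>\<^sup>+x. g x \<partial>\<mu>)"
proof -
  define F where "F = {(a, h). h > 0 \<and>
     ennreal t < set_nn_integral \<mu> (cb a h) g / emeasure \<mu> (cb a h)}"
  have gm [measurable]: "g \<in> borel_measurable \<mu>" by (simp add: measurable_cong_sets[OF sets_mu refl])
  define N where "N = density \<mu> (\<lambda>x. ennreal (1 / t) * g x)"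
  have [simp]: "sets N = sets lebesgue" by (simp add: N_def)
  have "ob a h \<subseteq> ob3 a h" if "h > 0" for a :: "real^'n" and h
    using cb_subset_ob3[OF that] ob_subset_cb by blast
  then have "{x. ennreal t < mmax \<mu> g x} \<subseteq> (\<Union>(a, h)\<in>F. ob3 a h)"
    by (force simp: less_mmax_iff F_def)
  then have "emeasure \<mu> {x. ennreal t < mmax \<mu> g x} \<le> emeasure \<mu> (\<Union>(a, h)\<in>F. ob3 a h)"
    by (rule emeasure_mono) (auto intro!: open_lebesgue open_UN)
  also have "\<dots> \<le> ennreal D * emeasure N UNIV"
  proof (rule vitali_measure)
    fix a h assume "(a, h) \<in> F"
    then have h: "h > 0" and "ennreal t < set_nn_integral \<mu> (cb a h) g / emeasure \<mu> (cb a h)"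
      by (auto simp: F_def)
    then have *: "ennreal t * emeasure \<mu> (cb a h) \<le> set_nn_integral \<mu> (cb a h) g"
      using pos[OF h, of a] fin[OF h, of a] by (simp add: divide_less_ennreal_iff)
    have "emeasure \<mu> (cb a h) = ennreal (1 / t) * (ennreal t * emeasure \<mu> (cb a h))"
      using t by (simp add: mult.assoc[symmetric] flip: ennreal_mult)
    also have "\<dots> \<le> ennreal (1 / t) * set_nn_integral \<mu> (cb a h) g"
      using * by (rule mult_left_mono) simp
    also have "\<dots> = (\<integral>\<^sup>+y. ennreal (1 / t) * g y * indicator (cb a h) y \<partial>\<mu>)"
      by (subst nn_integral_cmult[symmetric]) (auto simp: mult.assoc)
    also have "\<dots> = emeasure N (cb a h)" unfolding N_def by (subst emeasure_density) auto
    finally show "0 < h \<and> emeasure \<mu> (cb a h) \<le> emeasure N (cb a h)" using h by simp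
  qed (auto simp: dbl)
  also have "emeasure N UNIV = ennreal (1 / t) * (\<integral>\<^sup>+x. g x \<partial>\<mu>)"
    unfolding N_def by (subst emeasure_density) (auto simp: nn_integral_cmult)
  also have "ennreal D * \<dots> = ennreal (D / t) * (\<integral>\<^sup>+x. g x \<partial>\<mu>)"
    using D_ge_1[of 1] t by (simp add: mult.assoc[symmetric] flip: ennreal_mult)
  finally show ?thesis .
qed

text \<open>The part of \<open>g\<close> at or below height \<open>t\<close> contributes at most
  \<open>t\<close> to any average, so an average above \<open>2 * t\<close> leaves more than
  \<open>t\<close> for the part above.\<close>

lemma weak_type_truncated:
  assumes g [measurable]: "g \<in> borel_measurable lebesgue" and t: "t > 0"
  shows "emeasure \<mu> {x. ennreal t < mmax \<mu> g x / 2} \<le>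
    ennreal (D / t) * (\<integral>\<^sup>+x. g x * indicator {x. ennreal t < g x} x \<partial>\<mu>)"
proof -
  have gm [measurable]: "g \<in> borel_measurable \<mu>" by (simp add: measurable_cong_sets[OF sets_mu refl])
  let ?g = "\<lambda>x. g x * indicator {x. ennreal t < g x} x"
  have "{x. ennreal t < mmax \<mu> g x / 2} \<subseteq> {x. ennreal t < mmax \<mu> ?g x}"
  proof
    fix x assume "x \<in> {x. ennreal t < mmax \<mu> g x / 2}"
    then have "ennreal t * 2 < mmax \<mu> g x" by (simp add: divide_less_ennreal_iff)
    then obtain a h where h: "h > 0" "x \<in> ob a h"
      "ennreal t * 2 * emeasure \<mu> (cb a h) < set_nn_integral \<mu> (cb a h) g"
      using pos fin by (auto simp: less_mmax_iff divide_less_ennreal_iff)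
    note h(3)
    also have "set_nn_integral \<mu> (cb a h) g
        \<le> (\<integral>\<^sup>+y. ?g y * indicator (cb a h) y + ennreal t * indicator (cb a h) y \<partial>\<mu>)"
      by (rule nn_integral_mono) (auto split: split_indicator)
    also have "\<dots> = (set_nn_integral \<mu> (cb a h) ?g) + ennreal t * emeasure \<mu> (cb a h)"
      by (subst nn_integral_add) (auto simp: nn_integral_cmult_indicator)
    finally have "ennreal t * emeasure \<mu> (cb a h) + ennreal t * emeasure \<mu> (cb a h)
        < (set_nn_integral \<mu> (cb a h) ?g) + ennreal t * emeasure \<mu> (cb a h)"
      by (simp only: mult_2_right distrib_right)
    then have "ennreal t * emeasure \<mu> (cb a h) < set_nn_integral \<mu> (cb a h) ?g"
      by (rule contrapos_pp) (simp add: not_less add_right_mono)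
    then show "x \<in> {x. ennreal t < mmax \<mu> ?g x}"
      using h(1,2) pos fin unfolding less_mmax_iff mem_Collect_eq
      by (intro exI[of _ a] exI[of _ h]) (simp add: divide_less_ennreal_iff)
  qed
  then have "emeasure \<mu> {x. ennreal t < mmax \<mu> g x / 2} \<le> emeasure \<mu> {x. ennreal t < mmax \<mu> ?g x}"
    by (rule emeasure_mono) (use open_mmax in \<open>auto intro!: open_lebesgue\<close>)
  also have "\<dots> \<le> ennreal (D / t) * (\<integral>\<^sup>+x. ?g x \<partial>\<mu>)"
    by (rule weak_type[OF _ t]) measurable
  finally show ?thesis .
qed

lemma sigma_finite: "sigma_finite_measure \<mu>"
proof
  have "emeasure \<mu> (cb (- real (Suc n) *\<^sub>R One :: real^'n) (2 * real (Suc n))) \<noteq> \<infinity>" for n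
    using fin[of "2 * real (Suc n)" "- real (Suc n) *\<^sub>R One"] by simp
  with UN_big_cubes show "\<exists>A. countable A \<and> A \<subseteq> sets \<mu> \<and> \<Union>A = space \<mu> \<and> (\<forall>a\<in>A. emeasure \<mu> a \<noteq> \<infinity>)"
    by (intro exI[of _ "range (\<lambda>n. cb (- real (Suc n) *\<^sub>R One :: real^'n) (2 * real (Suc n)))"]) auto
qed

text \<open>Marcinkiewicz interpolation: the truncated weak type inequality is integrated over all
  levels and the integrals are exchanged. The factor \<open>1 / (q - 1)\<close> comes from
  integrating \<open>t powr (q - 2)\<close> up to \<open>g x\<close>, which is where q > 1 enters;
  \<open>2 powr q\<close> comes from halving \<open>mmax\<close>.\<close>

lemma strong_type:
  assumes g [measurable]: "g \<in> borel_measurable lebesgue" and q: "q > 1"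
  shows "(\<integral>\<^sup>+x. epowr (mmax \<mu> g x) q \<partial>\<mu>)
    \<le> ennreal (2 powr q * (D * q / (q - 1))) * (\<integral>\<^sup>+x. epowr (g x) q \<partial>\<mu>)"
proof -
  interpret P: pair_sigma_finite \<mu> lborel
    by (intro pair_sigma_finite.intro sigma_finite lborel.sigma_finite_measure_axioms)
  have gm [measurable]: "g \<in> borel_measurable \<mu>" by (simp add: measurable_cong_sets[OF sets_mu refl])
  have mm [measurable]: "mmax \<mu> g \<in> borel_measurable \<mu>" by (simp add: measurable_cong_sets[OF sets_mu refl])
  note D1 = D_ge_1[of 1]
  have "(\<integral>\<^sup>+x. epowr (mmax \<mu> g x / 2) q \<partial>\<mu>) =
     (\<integral>\<^sup>+x. (\<integral>\<^sup>+t. ennreal (q * t powr (q - 1)) * indicator {t. 0 < t \<and> ennreal t < mmax \<mu> g x / 2} t \<partial>lborel) \<partial>\<mu>)"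
    using q by (intro nn_integral_cong epowr_layer_cake[symmetric]) simp
  also have "\<dots> = (\<integral>\<^sup>+t. (\<integral>\<^sup>+x. ennreal (q * t powr (q - 1)) * indicator {t. 0 < t \<and> ennreal t < mmax \<mu> g x / 2} t \<partial>\<mu>) \<partial>lborel)"
    by (rule P.Fubini'[symmetric]) measurable
  also have "\<dots> \<le> (\<integral>\<^sup>+t. (\<integral>\<^sup>+x. ennreal (D * q / (q - 1)) * g x * (ennreal ((q - 1) * t powr (q - 1 - 1)) * indicator {t. 0 < t \<and> ennreal t < g x} t) \<partial>\<mu>) \<partial>lborel)"
  proof (rule nn_integral_mono)
    fix t :: real
    show "(\<integral>\<^sup>+x. ennreal (q * t powr (q - 1)) * indicator {t. 0 < t \<and> ennreal t < mmax \<mu> g x / 2} t \<partial>\<mu>)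
      \<le> (\<integral>\<^sup>+x. ennreal (D * q / (q - 1)) * g x * (ennreal ((q - 1) * t powr (q - 1 - 1)) * indicator {t. 0 < t \<and> ennreal t < g x} t) \<partial>\<mu>)"
    proof (cases "t > 0")
      case True
      have "(\<integral>\<^sup>+x. ennreal (q * t powr (q - 1)) * indicator {t. 0 < t \<and> ennreal t < mmax \<mu> g x / 2} t \<partial>\<mu>)
        = (\<integral>\<^sup>+x. ennreal (q * t powr (q - 1)) * indicator {x. ennreal t < mmax \<mu> g x / 2} x \<partial>\<mu>)"
        using True by (intro nn_integral_cong) (auto split: split_indicator)
      also have "\<dots> = ennreal (q * t powr (q - 1)) * emeasure \<mu> {x. ennreal t < mmax \<mu> g x / 2}"
      proof (rule nn_integral_cmult_indicator)
        have "{x \<in> space \<mu>. ennreal t < mmax \<mu> g x / 2} \<in> sets \<mu>" by measurable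
        then show "{x. ennreal t < mmax \<mu> g x / 2} \<in> sets \<mu>" by simp
      qed
      also have "\<dots> \<le> ennreal (q * t powr (q - 1)) * (ennreal (D / t) * (\<integral>\<^sup>+x. g x * indicator {x. ennreal t < g x} x \<partial>\<mu>))"
        by (intro mult_left_mono weak_type_truncated) (use True in auto)
      also have "\<dots> = ennreal (q * t powr (q - 1) * (D / t)) * (\<integral>\<^sup>+x. g x * indicator {x. ennreal t < g x} x \<partial>\<mu>)"
        using q True D1 by (subst ennreal_mult[of "q * t powr (q - 1)"]) (auto simp: mult.assoc)
      \<comment> \<open>Regrouped so that the inner integral over \<open>t\<close> becomes the
        layer-cake formula with exponent \<open>q - 1\<close>.\<close>
      also have "q * t powr (q - 1) * (D / t) = D * q / (q - 1) * ((q - 1) * t powr (q - 1 - 1))"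
        using True q by (simp add: powr_diff field_simps power2_eq_square)
      also have "ennreal \<dots> * (\<integral>\<^sup>+x. g x * indicator {x. ennreal t < g x} x \<partial>\<mu>)
        = (\<integral>\<^sup>+x. ennreal (D * q / (q - 1) * ((q - 1) * t powr (q - 1 - 1))) * (g x * indicator {x. ennreal t < g x} x) \<partial>\<mu>)"
        by (rule nn_integral_cmult[symmetric]) measurable
      also have "\<dots> = (\<integral>\<^sup>+x. ennreal (D * q / (q - 1)) * g x * (ennreal ((q - 1) * t powr (q - 1 - 1)) * indicator {t. 0 < t \<and> ennreal t < g x} t) \<partial>\<mu>)"
      proof (rule nn_integral_cong)
        fix x
        have "ennreal (D * q / (q - 1) * ((q - 1) * t powr (q - 1 - 1))) =
            ennreal (D * q / (q - 1)) * ennreal ((q - 1) * t powr (q - 1 - 1))"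
          using q D1 by (intro ennreal_mult) auto
        then show "ennreal (D * q / (q - 1) * ((q - 1) * t powr (q - 1 - 1))) * (g x * indicator {x. ennreal t < g x} x) =
            ennreal (D * q / (q - 1)) * g x * (ennreal ((q - 1) * t powr (q - 1 - 1)) * indicator {t. 0 < t \<and> ennreal t < g x} t)"
          using True by (simp only:) (simp add: indicator_def mult_ac)
      qed
      finally show ?thesis by simp
    qed simp
  qed
  also have "\<dots> = (\<integral>\<^sup>+x. (\<integral>\<^sup>+t. ennreal (D * q / (q - 1)) * g x * (ennreal ((q - 1) * t powr (q - 1 - 1)) * indicator {t. 0 < t \<and> ennreal t < g x} t) \<partial>lborel) \<partial>\<mu>)"
    by (rule P.Fubini') measurable
  also have "\<dots> = (\<integral>\<^sup>+x. ennreal (D * q / (q - 1)) * g x * epowr (g x) (q - 1) \<partial>\<mu>)"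
    using q by (intro nn_integral_cong) (subst nn_integral_cmult, measurable, subst epowr_layer_cake, auto)
  also have "\<dots> = (\<integral>\<^sup>+x. ennreal (D * q / (q - 1)) * epowr (g x) q \<partial>\<mu>)"
  proof (rule nn_integral_cong)
    fix x
    have "epowr (g x) q = epowr (g x) 1 * epowr (g x) (q - 1)"
      using q epowr_add[of 1 "q - 1" "g x"] by simp
    then show "ennreal (D * q / (q - 1)) * g x * epowr (g x) (q - 1) = ennreal (D * q / (q - 1)) * epowr (g x) q"
      by (simp add: mult.assoc)
  qed
  also have "\<dots> = ennreal (D * q / (q - 1)) * (\<integral>\<^sup>+x. epowr (g x) q \<partial>\<mu>)"
    by (rule nn_integral_cmult) measurable
  finally have half: "(\<integral>\<^sup>+x. epowr (mmax \<mu> g x / 2) q \<partial>\<mu>) \<le> ennreal (D * q / (q - 1)) * (\<integral>\<^sup>+x. epowr (g x) q \<partial>\<mu>)" .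
  have "epowr (mmax \<mu> g x) q = ennreal (2 powr q) * epowr (mmax \<mu> g x / 2) q" for x
  proof -
    have "mmax \<mu> g x = ennreal 2 * (mmax \<mu> g x / 2)"
      using ennreal_mult_divide_eq[of 2 "mmax \<mu> g x"] by (simp add: ennreal_times_divide mult.commute[of 2])
    then have "epowr (mmax \<mu> g x) q = epowr (ennreal 2 * (mmax \<mu> g x / 2)) q" by (rule arg_cong)
    then show ?thesis using q epowr_mult[of q "ennreal 2" "mmax \<mu> g x / 2"] by (simp del: ennreal_numeral)
  qed
  then have "(\<integral>\<^sup>+x. epowr (mmax \<mu> g x) q \<partial>\<mu>) = ennreal (2 powr q) * (\<integral>\<^sup>+x. epowr (mmax \<mu> g x / 2) q \<partial>\<mu>)"
    by (simp add: nn_integral_cmult)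
  also have "\<dots> \<le> ennreal (2 powr q) * (ennreal (D * q / (q - 1)) * (\<integral>\<^sup>+x. epowr (g x) q \<partial>\<mu>))"
    by (intro mult_left_mono half) simp
  finally show ?thesis
    using q D1 by (subst ennreal_mult) (auto simp: mult.assoc)
qed

end

section \<open>Lebesgue measure as a doubling measure, and the operator \<open>maxop\<close>\<close>

lemma cube_doubling_lebesgue: "cube_doubling (lebesgue :: (real^'n) measure) (5 ^ CARD('n))"
proof
  fix a :: "real^'n" and h :: real assume "h > 0"
  then show "emeasure lebesgue (dil5 a h) \<le> ennreal (5 ^ CARD('n)) * emeasure lebesgue (cb a h)"
    by (simp add: dil5_def emeasure_cb power_mult_distrib ennreal_mult)
qed (auto simp: emeasure_cb)

lemma measure_cb: "h \<ge> 0 \<Longrightarrow> vol (cb (a :: real^'n) h) = h ^ CARD('n)"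
  using emeasure_cb[of h a] by (simp add: measure_def)

text \<open>Enlarging a closed cube by \<open>e\<close> on all sides moves \<open>x\<close> into the
  interior, does not decrease the integral, and changes the volume by a factor tending to 1 as
  \<open>e\<close> tends to 0.\<close>

lemma maxop_eq_mmax: "maxop f x = mmax lebesgue f x"
proof (rule antisym)
  show "mmax lebesgue f x \<le> maxop f x"
    unfolding mmax_def maxop_def
  proof (rule SUP_least, clarify)
    fix a h assume "h > 0" "x \<in> ob a h"
    then show "set_nn_integral lebesgue (cb a h) f / emeasure lebesgue (cb a h)
       \<le> (SUP Q\<in>{Q. cube Q \<and> x \<in> Q}. (set_nn_integral lebesgue Q f) / emeasure lebesgue Q)"
      using ob_subset_cb[of a h] by (intro SUP_upper) auto
  qed
  show "maxop f x \<le> mmax lebesgue f x"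
    unfolding maxop_def
  proof (rule SUP_least, clarify)
    fix Q :: "(real^'a) set" assume "cube Q" and xQ: "x \<in> Q"
    then obtain a h where h: "h > 0" and Q: "Q = cb a h" by (auto simp: cube_iff)
    define A where "A = set_nn_integral lebesgue Q f"
    have le: "A / ennreal ((h + 2 * e) ^ CARD('a)) \<le> mmax lebesgue f x" if e: "e > 0" for e
    proof -
      have nth: "(a - e *\<^sub>R One) $ i = a $ i - e" for i
        by (simp only: vector_minus_component vector_scaleR_component One_nth) simp
      have x: "x \<in> ob (a - e *\<^sub>R One) (h + 2 * e)"
        unfolding mem_ob nth
      proof
        fix i show "a $ i - e < x $ i \<and> x $ i < a $ i - e + (h + 2 * e)"
          using xQ[unfolded Q mem_cb, rule_format, of i] e by auto
      qed
      have sub: "Q \<subseteq> cb (a - e *\<^sub>R One) (h + 2 * e)"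
      proof
        fix y assume y: "y \<in> Q"
        show "y \<in> cb (a - e *\<^sub>R One) (h + 2 * e)"
          unfolding mem_cb nth
        proof
          fix i show "a $ i - e \<le> y $ i \<and> y $ i \<le> a $ i - e + (h + 2 * e)"
            using y[unfolded Q mem_cb, rule_format, of i] e by auto
        qed
      qed
      have "A \<le> (\<integral>\<^sup>+ y. f y * indicator (cb (a - e *\<^sub>R One) (h + 2 * e)) y \<partial>lebesgue)"
        unfolding A_def using sub by (intro nn_integral_mono mult_left_mono) (auto split: split_indicator)
      then have "A / ennreal ((h + 2 * e) ^ CARD('a)) \<le>
          (\<integral>\<^sup>+ y. f y * indicator (cb (a - e *\<^sub>R One) (h + 2 * e)) y \<partial>lebesgue) / emeasure lebesgue (cb (a - e *\<^sub>R One) (h + 2 * e))"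
        using h e by (simp add: emeasure_cb divide_right_mono_ennreal)
      also have "\<dots> \<le> mmax lebesgue f x" using h e x by (intro mmax_ge) auto
      finally show ?thesis .
    qed
    have "A / ennreal (h ^ CARD('a)) \<le> mmax lebesgue f x"
    proof (cases "A = top")
      case True
      then show ?thesis using le[of 1] h by (simp add: ennreal_top_divide top_unique)
    next
      case False
      then obtain r where r: "A = ennreal r" "r \<ge> 0" by (cases A) auto
      have "(\<lambda>k. r / (h + 2 * inverse (real (Suc k))) ^ CARD('a)) \<longlonglongrightarrow> r / (h + 2 * 0) ^ CARD('a)"
        using h by (intro tendsto_intros LIMSEQ_inverse_real_of_nat) auto
      then have "(\<lambda>k. ennreal (r / (h + 2 * inverse (real (Suc k))) ^ CARD('a))) \<longlonglongrightarrow> ennreal (r / h ^ CARD('a))"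
        by (intro tendsto_ennrealI) simp
      moreover have "ennreal (r / (h + 2 * inverse (real (Suc k))) ^ CARD('a)) \<le> mmax lebesgue f x" for k
      proof -
        have "0 < h + 2 * inverse (real (Suc k))" using h by (intro add_pos_pos) auto
        then show ?thesis using le[of "inverse (real (Suc k))"] r by (simp add: divide_ennreal)
      qed
      ultimately have "ennreal (r / h ^ CARD('a)) \<le> mmax lebesgue f x"
        by (intro LIMSEQ_le_const2) auto
      then show ?thesis using r h by (simp add: divide_ennreal)
    qed
    then show "set_nn_integral lebesgue Q f / emeasure lebesgue Q \<le> mmax lebesgue f x"
      using h by (simp add: A_def Q emeasure_cb)
  qed
qed

lemma measurable_maxop [measurable]: "maxop f \<in> borel_measurable lebesgue"
  using measurable_mmax[of lebesgue f] by (simp add: maxop_eq_mmax[abs_def])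

lemma open_maxop: "open {x. t < maxop f x}"
  using open_mmax[of t lebesgue f] by (simp add: maxop_eq_mmax)

text \<open>The inequality \<open>lower\<close> bounds the mass of \<open>E\<close> from below.
  Applied to a cube inside its dilate it gives doubling; applied to the complement of a set it gives
  \<open>absorb\<close>. Hence everything proved for doubling pairs becomes available with Lebesgue
  measure as \<open>\<mu>\<close>.\<close>

locale cube_lower =
  fixes \<nu> :: "(real^'n) measure" and C q :: real
  assumes sets_nu [simp]: "sets \<nu> = sets lebesgue"
    and finite_nu: "h > 0 \<Longrightarrow> emeasure \<nu> (cb a h) < top"
    and nontriv: "\<exists>a h. h > 0 \<and> emeasure \<nu> (cb a h) > 0"
    and ac_nu: "N \<in> null_sets lebesgue \<Longrightarrow> N \<in> null_sets \<nu>"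
    and q_pos: "q > 0"
    and lower: "\<lbrakk>h > 0; E \<in> sets lebesgue; E \<subseteq> cb a h\<rbrakk> \<Longrightarrow>
      (vol E / h ^ CARD('n)) powr q * measure \<nu> (cb a h) \<le> C * measure \<nu> E"
begin

lemma meas_eq:
  assumes "h > 0" "A \<subseteq> cb a h"
  shows "emeasure \<nu> A = ennreal (measure \<nu> A)"
proof -
  have "emeasure \<nu> A \<le> emeasure \<nu> (cb a h)" using assms(2) by (rule emeasure_mono) simp
  also have "\<dots> < top" by (rule finite_nu[OF assms(1)])
  finally show ?thesis by (simp add: emeasure_eq_ennreal_measure)
qed

text \<open>One large cube contains both the given cube and a cube of positive mass;
  \<open>lower\<close> hands the positivity down.\<close>

lemma nu_pos: assumes "h > 0" shows "measure \<nu> (cb a h) > 0"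
proof -
  obtain b k where k: "k > 0" "emeasure \<nu> (cb b k) > 0" using nontriv by blast
  define m where "m = norm a + norm b + h + k"
  have m: "m > 0" using assms k by (simp add: m_def add_nonneg_pos)
  have s: "cb a h \<subseteq> cb (- m *\<^sub>R One) (2 * m)" "cb b k \<subseteq> cb (- m *\<^sub>R One) (2 * m)"
    by (rule subset_big_cube; use assms k in \<open>simp add: m_def\<close>)+
  have "emeasure \<nu> (cb b k) \<le> emeasure \<nu> (cb (- m *\<^sub>R One) (2 * m))"
    by (rule emeasure_mono) (use s in auto)
  with k(2) have "emeasure \<nu> (cb (- m *\<^sub>R One) (2 * m)) > 0" by (rule less_le_trans)
  moreover have "emeasure \<nu> (cb (- m *\<^sub>R One) (2 * m)) = ennreal (measure \<nu> (cb (- m *\<^sub>R One) (2 * m)))"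
    by (rule meas_eq[of "2 * m" _ "- m *\<^sub>R One"]) (use m in auto)
  ultimately have "measure \<nu> (cb (- m *\<^sub>R One) (2 * m)) > 0" by (simp only: ennreal_less_zero_iff)
  moreover have "(vol (cb a h) / (2 * m) ^ CARD('n)) powr q > 0"
    using assms m by (simp add: measure_cb)
  ultimately have "0 < (vol (cb a h) / (2 * m) ^ CARD('n)) powr q * measure \<nu> (cb (- m *\<^sub>R One) (2 * m))"
    by (intro mult_pos_pos)
  also have "\<dots> \<le> C * measure \<nu> (cb a h)" by (rule lower) (use s m in auto)
  finally have "0 < C * measure \<nu> (cb a h)" .
  then show ?thesis by (metis measure_nonneg mult_zero_right order_less_irrefl order_less_le)
qed

lemma C_ge_1: "C \<ge> 1"
  using lower[of 1 "cb 0 1" 0] nu_pos[of 1 0] by (simp add: measure_cb)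

lemma cube_doubling: "cube_doubling \<nu> (C * (5 ^ CARD('n)) powr q)"
proof
  fix a :: "real^'n" and h :: real assume h: "h > 0"
  show "emeasure \<nu> (cb a h) > 0" using nu_pos[OF h, of a] meas_eq[OF h order_refl, of a] by simp
  have sub: "cb a h \<subseteq> dil5 a h" by (rule cb_subset_dil5[OF h])
  have "(vol (cb a h) / (5 * h) ^ CARD('n)) powr q * measure \<nu> (dil5 a h) \<le> C * measure \<nu> (cb a h)"
    unfolding dil5_def by (rule lower) (use h sub in \<open>auto simp: dil5_def\<close>)
  moreover have "(vol (cb a h) / (5 * h) ^ CARD('n)) powr q = 1 / (5 ^ CARD('n)) powr q"
    using h by (simp add: measure_cb power_mult_distrib powr_divide)
  ultimately have "measure \<nu> (dil5 a h) \<le> C * (5 ^ CARD('n)) powr q * measure \<nu> (cb a h)"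
    by (simp only:) (simp add: field_simps)
  then have "ennreal (measure \<nu> (dil5 a h)) \<le> ennreal (C * (5 ^ CARD('n)) powr q * measure \<nu> (cb a h))"
    by (rule ennreal_leI)
  also have "\<dots> = ennreal (C * (5 ^ CARD('n)) powr q) * ennreal (measure \<nu> (cb a h))"
    using C_ge_1 by (intro ennreal_mult) auto
  finally show "emeasure \<nu> (dil5 a h) \<le> ennreal (C * (5 ^ CARD('n)) powr q) * emeasure \<nu> (cb a h)"
    using h meas_eq[OF h order_refl, of a] meas_eq[of "5 * h" "dil5 a h" "a - (2 * h) *\<^sub>R One"] by (simp add: dil5_def)
qed (use finite_nu ac_nu in auto)

text \<open>If \<open>E\<close> fills at most half of the cube, its complement fills at least half
  and so carries at least the share \<open>(1/2) powr q / C\<close> of the mass.\<close>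

lemma pair: "cube_doubling_pair lebesgue \<nu> (5 ^ CARD('n)) (C * (5 ^ CARD('n)) powr q) (1/2) (1 - (1/2) powr q / C)"
proof (intro cube_doubling_pair.intro cube_doubling_pair_axioms.intro cube_doubling_lebesgue cube_doubling)
  have "(1/2::real) powr q \<le> 1 powr q" using q_pos by (intro powr_mono2) auto
  then show "0 \<le> 1 - (1/2) powr q / C" "1 - (1/2) powr q / C < 1" using C_ge_1 by (auto simp: field_simps)
  fix a :: "real^'n" and h E assume h: "h > 0" and E: "E \<in> sets lebesgue" "E \<subseteq> cb a h"
    and small: "vol E \<le> 1/2 * vol (cb a h)"
  note L_fmeas = cube_doubling.fmeas[OF cube_doubling_lebesgue]
  interpret N: cube_doubling \<nu> "C * (5 ^ CARD('n)) powr q" by (rule cube_doubling)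
  let ?F = "cb a h - E"
  have [simp]: "?F \<in> sets lebesgue" "?F \<subseteq> cb a h" using E by auto
  have l: "vol ?F = vol (cb a h) - vol E"
    using L_fmeas[OF h, of E a] L_fmeas[OF h, of "cb a h" a] E by (intro measure_Diff) (auto simp: fmeasurable_def)
  have n: "measure \<nu> ?F = measure \<nu> (cb a h) - measure \<nu> E"
    using N.fmeas[OF h, of E a] N.fmeas[OF h, of "cb a h" a] E by (intro measure_Diff) (auto simp: fmeasurable_def)
  have "1/2 \<le> vol ?F / h ^ CARD('n)"
    using small l h by (simp add: measure_cb field_simps)
  then have "(1/2) powr q \<le> (vol ?F / h ^ CARD('n)) powr q"
    using q_pos by (intro powr_mono2) auto
  then have "(1/2) powr q * measure \<nu> (cb a h) \<le> (vol ?F / h ^ CARD('n)) powr q * measure \<nu> (cb a h)"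
    by (rule mult_right_mono) simp
  also have "\<dots> \<le> C * measure \<nu> ?F" by (rule lower[OF h]) auto
  finally show "measure \<nu> E \<le> (1 - (1/2) powr q / C) * measure \<nu> (cb a h)"
    using C_ge_1 by (simp add: n field_simps)
qed auto

end

subsection \<open>Muckenhoupt's theorem\<close>

abbreviation wmeasure :: "(real^'n \<Rightarrow> real) \<Rightarrow> (real^'n) measure" where
  "wmeasure w \<equiv> density lebesgue (\<lambda>x. ennreal (w x))"

abbreviation wint :: "real \<Rightarrow> (real^'n \<Rightarrow> real) \<Rightarrow> (real^'n \<Rightarrow> ennreal) \<Rightarrow> ennreal" where
  "wint p w g \<equiv> \<integral>\<^sup>+x. epowr (g x) p * ennreal (w x) \<partial>lebesgue"

lemma emeasure_wmeasure:
  assumes "w \<in> borel_measurable lebesgue" "A \<in> sets lebesgue"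
  shows "emeasure (wmeasure w) A = (\<integral>\<^sup>+x. ennreal (w x) * indicator A x \<partial>lebesgue)"
  using assms by (intro emeasure_density) auto

lemma nn_integral_wmeasure:
  assumes "w \<in> borel_measurable lebesgue" "f \<in> borel_measurable lebesgue"
  shows "(\<integral>\<^sup>+x. f x \<partial>wmeasure w) = (\<integral>\<^sup>+x. ennreal (w x) * f x \<partial>lebesgue)"
  using assms by (intro nn_integral_density) auto

lemma null_sets_wmeasure:
  assumes "w \<in> borel_measurable lebesgue" "N \<in> null_sets lebesgue"
  shows "N \<in> null_sets (wmeasure w)"
  using absolutely_continuousI_density[of "\<lambda>x. ennreal (w x)" lebesgue] assms
  by (auto simp: absolutely_continuous_def)

lemma AE_cubesI:
  assumes "\<And>a h. h > 0 \<Longrightarrow> AE x in lebesgue. x \<in> cb (a :: real^'n) h \<longrightarrow> P x"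
  shows "AE x in lebesgue. P x"
proof -
  have "AE x in lebesgue. \<forall>m. x \<in> cb (- real (Suc m) *\<^sub>R One :: real^'n) (2 * real (Suc m)) \<longrightarrow> P x"
    by (subst AE_all_countable) (auto intro!: assms)
  then show ?thesis
    by eventually_elim (use UN_big_cubes in blast)
qed

text \<open>A symmetric form of the \<open>A_p\<close> condition. The dual weight \<open>v\<close>
  is real-valued and \<open>dual\<close> is required only almost everywhere, so that the two weights
  can be exchanged and both measures turn out doubling.\<close>

locale muckenhoupt_pair =
  fixes u v :: "real^'n \<Rightarrow> real" and p K :: real
  assumes p: "p > 1" and K: "K > 0"
    and u_meas [measurable]: "u \<in> borel_measurable lebesgue"
    and v_meas [measurable]: "v \<in> borel_measurable lebesgue"
    and dual: "AE x in lebesgue. 0 < u x \<and> v x = u x powr (- 1 / (p - 1))"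
    and fin_u: "h > 0 \<Longrightarrow> emeasure (wmeasure u) (cb a h) < top"
    and fin_v: "h > 0 \<Longrightarrow> emeasure (wmeasure v) (cb a h) < top"
    and Ap: "h > 0 \<Longrightarrow> measure (wmeasure u) (cb a h) * measure (wmeasure v) (cb a h) powr (p - 1)
      \<le> K * (h ^ CARD('n)) powr p"
begin

lemma v_pos: "AE x in lebesgue. 0 < v x"
  using dual by eventually_elim auto

lemma pos_cube:
  assumes "f \<in> borel_measurable lebesgue" "AE x in lebesgue. 0 < f x" "h > 0"
    "emeasure (wmeasure f) (cb a h) < top"
  shows "measure (wmeasure f) (cb a h) > 0"
proof -
  have "emeasure (wmeasure f) (cb a h) \<noteq> 0"
  proof
    assume "emeasure (wmeasure f) (cb a h) = 0"
    then have "AE x in lebesgue. ennreal (f x) * indicator (cb a h) x = 0"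
      using assms(1) by (simp add: emeasure_wmeasure nn_integral_0_iff_AE)
    with assms(2) have "AE x in lebesgue. x \<notin> cb a h"
      by eventually_elim (auto simp: indicator_def split: if_splits)
    then have "emeasure lebesgue (cb a h) = 0"
      by (subst emeasure_eq_0_AE[symmetric]) auto
    then show False using assms(3) by (simp add: emeasure_cb)
  qed
  then have "emeasure (wmeasure f) (cb a h) > 0" by (simp add: zero_less_iff_neq_zero)
  moreover have "emeasure (wmeasure f) (cb a h) = ennreal (measure (wmeasure f) (cb a h))"
    using assms(4) by (simp add: emeasure_eq_ennreal_measure)
  ultimately show ?thesis by (simp only: ennreal_less_zero_iff)
qed

text \<open>A Hoelder-type estimate obtained from a pointwise alternative: at almost every point
  either \<open>l * u\<close> or \<open>e / (2 * VQ) * v\<close> is at least 1. Integrating their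
  sum over \<open>E\<close>, the second term contributes at most \<open>e / 2\<close>, which is
  absorbed; the \<open>A_p\<close> condition then eliminates \<open>VQ\<close>.\<close>

lemma lower: "cube_lower (wmeasure u) (2 powr p * K) p"
proof
  show "\<exists>a h. h > 0 \<and> emeasure (wmeasure u) (cb (a :: real^'n) h) > 0"
  proof (intro exI conjI)
    have "measure (wmeasure u) (cb (0 :: real^'n) 1) > 0"
      using dual by (intro pos_cube fin_u) auto
    then show "emeasure (wmeasure u) (cb (0 :: real^'n) 1) > 0"
      using fin_u[of 1 0] by (simp add: emeasure_eq_ennreal_measure)
  qed simp
next
  fix a :: "real^'n" and h E
  assume h: "h > 0" and E [measurable]: "E \<in> sets lebesgue" and sub: "E \<subseteq> cb a h"
  define e where "e = vol E"
  define UE where "UE = measure (wmeasure u) E"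
  define UQ where "UQ = measure (wmeasure u) (cb a h)"
  define VQ where "VQ = measure (wmeasure v) (cb a h)"
  have VQ: "VQ > 0" unfolding VQ_def by (rule pos_cube[OF v_meas v_pos h fin_v[OF h]])
  have em: "emeasure M E = ennreal (measure M E)"
    if "emeasure M (cb a h) < top" "sets M = sets lebesgue" for M
  proof -
    have "emeasure M E \<le> emeasure M (cb a h)" using sub that by (intro emeasure_mono) auto
    then show ?thesis using that(1) by (metis emeasure_eq_ennreal_measure le_less_trans less_irrefl)
  qed
  have le: "(e / h ^ CARD('n)) powr p * UQ \<le> 2 powr p * K * UE"
  proof (cases "e = 0")
    case True
    then show ?thesis using p K by (simp add: UE_def)
  next
    case False
    then have e: "e > 0" by (simp add: e_def order_less_le)
    \<comment> \<open>Chosen so that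
      \<open>(l * u x) powr (- 1 / (p - 1)) = e / (2 * VQ) * v x\<close>; the two quantities
      therefore cannot both be below 1.\<close>
    define l where "l = (2 * VQ / e) powr (p - 1)"
    have l: "l > 0" using e VQ by (simp add: l_def)
    have lv: "l powr - (1 / (p - 1)) = e / (2 * VQ)"
      unfolding l_def using p e VQ by (simp add: powr_powr powr_minus_divide)
    have "AE x in lebesgue. ennreal 1 * indicator E x \<le>
      ennreal l * (ennreal (u x) * indicator E x) + ennreal (e / (2 * VQ)) * (ennreal (v x) * indicator (cb a h) x)"
      using dual
    proof eventually_elim
      case (elim x)
      have "1 \<le> l * u x \<or> 1 \<le> e / (2 * VQ) * v x"
      proof (rule disjCI)
        assume "\<not> 1 \<le> e / (2 * VQ) * v x"
        then have "(l * u x) powr (- 1 / (p - 1)) < 1"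
          using elim l by (simp add: powr_mult lv not_le)
        moreover have "1 powr (- 1 / (p - 1)) \<le> (l * u x) powr (- 1 / (p - 1))" if "l * u x \<le> 1"
          using that p l elim by (intro powr_mono2') auto
        ultimately show "1 \<le> l * u x" by fastforce
      qed
      moreover have "0 \<le> l * u x" "0 \<le> e / (2 * VQ) * v x" using elim l e VQ by auto
      ultimately have "1 \<le> l * u x + e / (2 * VQ) * v x" by linarith
      then have "ennreal 1 \<le> ennreal (l * u x + e / (2 * VQ) * v x)" by (rule ennreal_leI)
      also have "\<dots> = ennreal l * ennreal (u x) + ennreal (e / (2 * VQ)) * ennreal (v x)"
      proof -
        have "0 \<le> v x" "0 \<le> u x" "0 \<le> l" "0 \<le> e / (2 * VQ)" using elim l e VQ by auto
        then show ?thesis by (simp only: ennreal_plus ennreal_mult mult_nonneg_nonneg)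
      qed
      finally have "ennreal 1 \<le> ennreal l * ennreal (u x) + ennreal (e / (2 * VQ)) * ennreal (v x)" .
      then show ?case using sub by (auto split: split_indicator)
    qed
    then have "(\<integral>\<^sup>+x. ennreal 1 * indicator E x \<partial>lebesgue) \<le>
      (\<integral>\<^sup>+x. ennreal l * (ennreal (u x) * indicator E x) + ennreal (e / (2 * VQ)) * (ennreal (v x) * indicator (cb a h) x) \<partial>lebesgue)"
      by (rule nn_integral_mono_AE)
    also have "\<dots> = ennreal l * emeasure (wmeasure u) E + ennreal (e / (2 * VQ)) * emeasure (wmeasure v) (cb a h)"
      by (subst nn_integral_add) (auto simp: nn_integral_cmult emeasure_wmeasure)
    also have "\<dots> = ennreal (l * UE + e / (2 * VQ) * VQ)"
      using em[OF fin_u[OF h]] fin_v[OF h, of a] l e VQ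
      by (simp add: UE_def VQ_def emeasure_eq_ennreal_measure flip: ennreal_mult ennreal_plus)
    also have "(\<integral>\<^sup>+x. ennreal 1 * indicator E x \<partial>lebesgue) = ennreal e"
      using em[of lebesgue] h by (simp add: e_def emeasure_cb)
    finally have "e \<le> l * UE + e / (2 * VQ) * VQ"
      using l e VQ by (subst (asm) ennreal_le_iff) (auto simp: UE_def)
    then have "e / 2 \<le> (2 * VQ / e) powr (p - 1) * UE" using VQ by (simp add: l_def)
    then have "e powr (p - 1) * (e / 2) \<le> e powr (p - 1) * ((2 * VQ / e) powr (p - 1) * UE)"
      by (rule mult_left_mono) simp
    also have "\<dots> = (2 * VQ) powr (p - 1) * UE" using e VQ by (simp add: powr_divide)
    also have "e powr (p - 1) * (e / 2) = e powr p / 2" using e by (simp add: powr_diff)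
    finally have "e powr p \<le> 2 * (2 * VQ) powr (p - 1) * UE" by simp
    also have "2 * (2 * VQ) powr (p - 1) = 2 powr p * VQ powr (p - 1)"
      using VQ by (simp add: powr_mult powr_diff)
    finally have "e powr p * UQ \<le> 2 powr p * VQ powr (p - 1) * UE * UQ"
      by (rule mult_right_mono) (simp add: UQ_def)
    also have "\<dots> = 2 powr p * UE * (UQ * VQ powr (p - 1))" by simp
    also have "\<dots> \<le> 2 powr p * UE * (K * (h ^ CARD('n)) powr p)"
      unfolding UQ_def VQ_def by (intro mult_left_mono Ap h) (simp add: UE_def)
    finally show ?thesis using h e by (simp add: powr_divide field_simps)
  qed
  then show "(vol E / h ^ CARD('n)) powr p * measure (wmeasure u) (cb a h) \<le> 2 powr p * K * measure (wmeasure u) E"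
    by (simp add: e_def UE_def UQ_def)
qed (use p fin_u null_sets_wmeasure[OF u_meas] in auto)

text \<open>The conjugate exponent p' = p/(p-1) satisfies p' - 1 = 1/(p-1), so the condition for the
  exchanged pair is the original one raised to the power 1/(p-1).\<close>

lemma swap: "muckenhoupt_pair v u (p / (p - 1)) (K powr (1 / (p - 1)))"
proof
  have q: "p / (p - 1) - 1 = 1 / (p - 1)" using p by (simp add: field_simps)
  show "AE x in lebesgue. 0 < v x \<and> u x = v x powr (- 1 / (p / (p - 1) - 1))"
    using dual
  proof eventually_elim
    case (elim x)
    have "(1 - p) / (p - 1) = - 1" using p by (simp add: field_simps)
    then show ?case using elim p by (simp add: q powr_powr)
  qed
  fix a :: "real^'n" and h :: real assume h: "h > 0"
  have "(measure (wmeasure u) (cb a h) * measure (wmeasure v) (cb a h) powr (p - 1)) powr (1 / (p - 1))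
    \<le> (K * (h ^ CARD('n)) powr p) powr (1 / (p - 1))"
    using p by (intro powr_mono2 Ap h) auto
  then show "measure (wmeasure v) (cb a h) * measure (wmeasure u) (cb a h) powr (p / (p - 1) - 1)
    \<le> K powr (1 / (p - 1)) * (h ^ CARD('n)) powr (p / (p - 1))"
    using p K h by (simp add: powr_mult powr_powr q mult.commute)
qed (use p K fin_u fin_v in auto)

text \<open>Once the pointwise bound is raised to the power p' = p/(p-1), the strong type bounds for
  \<open>u\<close> with exponent p' and for \<open>v\<close> with exponent p fit together: (p-1)p' =
  p, and the weights cancel through \<open>u powr (1 - p') = v\<close> and
  \<open>v powr (1 - p) = u\<close>.\<close>

lemma norm_inequality:
  "\<exists>C>0. \<forall>f \<in> borel_measurable lebesgue.
    wint p u (maxop f)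
      \<le> ennreal C * wint p u f"
proof -
  interpret S: muckenhoupt_pair v u "p / (p - 1)" "K powr (1 / (p - 1))" by (rule swap)
  interpret U: cube_lower "wmeasure u" "2 powr p * K" p by (rule lower)
  interpret V: cube_lower "wmeasure v" "2 powr (p / (p - 1)) * K powr (1 / (p - 1))" "p / (p - 1)" by (rule S.lower)
  obtain DU where "cube_doubling (wmeasure u) DU" using U.cube_doubling by blast
  then interpret U: cube_doubling "wmeasure u" DU .
  obtain DV where "cube_doubling (wmeasure v) DV" using V.cube_doubling by blast
  then interpret V: cube_doubling "wmeasure v" DV .
  define p' where "p' = p / (p - 1)"
  have p': "p' > 1" using p by (simp add: p'_def field_simps)
  obtain CU where CU: "CU \<ge> 0" "\<And>g. g \<in> borel_measurable lebesgue \<Longrightarrow>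
      (\<integral>\<^sup>+x. epowr (mmax (wmeasure u) g x) p' \<partial>wmeasure u) \<le> ennreal CU * (\<integral>\<^sup>+x. epowr (g x) p' \<partial>wmeasure u)"
  proof
    show "0 \<le> 2 powr p' * (DU * p' / (p' - 1))" using p' U.D_ge_1[of 1] by simp
  qed (rule U.strong_type[OF _ p'])
  obtain CV where CV: "CV \<ge> 0" "\<And>g. g \<in> borel_measurable lebesgue \<Longrightarrow>
      (\<integral>\<^sup>+x. epowr (mmax (wmeasure v) g x) p \<partial>wmeasure v) \<le> ennreal CV * (\<integral>\<^sup>+x. epowr (g x) p \<partial>wmeasure v)"
  proof
    show "0 \<le> 2 powr p * (DV * p / (p - 1))" using p V.D_ge_1[of 1] by simp
  qed (rule V.strong_type[OF _ p])
  have main: "wint p u (maxop f)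
      \<le> ennreal (K powr p' * (CU * CV)) * wint p u f"
    if f [measurable]: "f \<in> borel_measurable lebesgue" for f
  proof -
    define fv where "fv = (\<lambda>x. f x * ennreal (1 / v x))"
    have [measurable]: "fv \<in> borel_measurable lebesgue" unfolding fv_def by measurable
    define G where "G = (\<lambda>x. epowr (mmax (wmeasure v) fv x) (p - 1))"
    have [measurable]: "G \<in> borel_measurable lebesgue" unfolding G_def by measurable
    define H where "H = (\<lambda>x. G x * ennreal (1 / u x))"
    have [measurable]: "H \<in> borel_measurable lebesgue" unfolding H_def by measurable
    have up: "AE x in lebesgue. 0 < u x" using dual by eventually_elim auto
    have cancel: "AE x in lebesgue. ennreal (g x) * (k x * ennreal (1 / g x)) = k x"
      if "AE x in lebesgue. 0 < g x" for g :: "real^'n \<Rightarrow> real" and k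
      using that
    proof eventually_elim
      case (elim x)
      have "ennreal (g x) * (k x * ennreal (1 / g x)) = k x * (ennreal (g x) * ennreal (1 / g x))"
        by (simp add: mult_ac)
      also have "ennreal (g x) * ennreal (1 / g x) = 1" using elim by (simp flip: ennreal_mult)
      finally show ?case by simp
    qed
    have pointwise: "epowr ((set_nn_integral lebesgue (cb a h) f) / emeasure lebesgue (cb a h)) (p - 1)
        \<le> ennreal K * mmax (wmeasure u) H x" if h: "h > 0" and x: "x \<in> ob a h" for a h x
    proof -
      define A where "A = set_nn_integral lebesgue (cb a h) f"
      define UQ where "UQ = measure (wmeasure u) (cb a h)"
      define VQ where "VQ = measure (wmeasure v) (cb a h)"
      define d where "d = h ^ CARD('n)"
      have d: "d > 0" using h by (simp add: d_def)
      have UQ: "UQ > 0" "emeasure (wmeasure u) (cb a h) = ennreal UQ"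
        unfolding UQ_def using U.measure_pos[OF h] U.emeasure_eq[OF h order_refl] by auto
      have VQ: "VQ > 0" "emeasure (wmeasure v) (cb a h) = ennreal VQ"
        unfolding VQ_def using V.measure_pos[OF h] V.emeasure_eq[OF h order_refl] by auto
      define F where "F = A / ennreal VQ"
      have "A = set_nn_integral (wmeasure v) (cb a h) fv"
        unfolding A_def
        by (subst nn_integral_wmeasure) (auto intro!: nn_integral_cong_AE
          intro: AE_mp[OF cancel[OF v_pos, of f]] simp: fv_def mult.assoc[symmetric])
      then have F: "F \<le> mmax (wmeasure v) fv y" if "y \<in> ob a h" for y
        using mmax_ge[OF h that, of "wmeasure v" fv] VQ by (simp add: F_def)
      \<comment> \<open>\<open>F\<close> is a single number for the cube, and the maximal function
        of \<open>fv\<close> dominates it at every interior point. Its power is therefore at most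
        the Lebesgue average of \<open>G\<close> over the cube.\<close>
      have "epowr F (p - 1) * ennreal d = (\<integral>\<^sup>+y. epowr F (p - 1) * indicator (cb a h) y \<partial>lebesgue)"
        using h by (simp add: nn_integral_cmult_indicator emeasure_cb d_def)
      also have "\<dots> \<le> set_nn_integral lebesgue (cb a h) G"
      proof (rule nn_integral_mono_AE)
        show "AE y in lebesgue. epowr F (p - 1) * indicator (cb a h) y \<le> G y * indicator (cb a h) y"
          using AE_not_in[OF null_cb_diff_ob[of a h]]
        proof eventually_elim
          case (elim y)
          then show ?case
            using F[of y] p by (auto simp: G_def split: split_indicator intro!: epowr_mono)
        qed
      qed
      also have "\<dots> = set_nn_integral (wmeasure u) (cb a h) H"
        by (subst nn_integral_wmeasure) (auto intro!: nn_integral_cong_AE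
          intro: AE_mp[OF cancel[OF up, of G]] simp: H_def mult.assoc[symmetric])
      finally have 1: "epowr F (p - 1) * ennreal d \<le> set_nn_integral (wmeasure u) (cb a h) H" .
      have "A / emeasure lebesgue (cb a h) = F * ennreal (VQ / d)"
      proof (cases A)
        case (real r)
        then show ?thesis using d VQ h
          by (simp add: F_def emeasure_cb d_def[symmetric] divide_ennreal flip: ennreal_mult)
      next
        case top
        then show ?thesis using d VQ h
          by (simp add: F_def emeasure_cb d_def[symmetric] ennreal_top_divide ennreal_top_mult)
      qed
      then have "epowr (A / emeasure lebesgue (cb a h)) (p - 1) = epowr F (p - 1) * ennreal ((VQ / d) powr (p - 1))"
        using p d VQ by (simp add: epowr_mult)
      \<comment> \<open>The \<open>A_p\<close> condition trades the power of \<open>VQ\<close> for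
        \<open>1 / UQ\<close>, turning the expression into an average with respect to
        \<open>u\<close>.\<close>
      also have "\<dots> \<le> epowr F (p - 1) * ennreal (K * d / UQ)"
      proof (intro mult_left_mono ennreal_leI)
        have "UQ * VQ powr (p - 1) \<le> K * d powr p"
          using Ap[OF h, of a] by (simp add: UQ_def VQ_def d_def)
        then show "(VQ / d) powr (p - 1) \<le> K * d / UQ"
          using UQ VQ d by (simp add: powr_divide powr_diff field_simps)
      qed simp
      also have "\<dots> = ennreal K * ((epowr F (p - 1) * ennreal d) * ennreal (1 / UQ))"
      proof -
        have "ennreal (K * d / UQ) = ennreal K * (ennreal d * ennreal (1 / UQ))"
          using K d UQ by (simp flip: ennreal_mult)
        then show ?thesis by (simp add: mult_ac)
      qed
      also have "\<dots> \<le> ennreal K * ((set_nn_integral (wmeasure u) (cb a h) H) * ennreal (1 / UQ))"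
        by (intro mult_left_mono mult_right_mono 1) auto
      also have "(set_nn_integral (wmeasure u) (cb a h) H) * ennreal (1 / UQ)
          = set_nn_integral (wmeasure u) (cb a h) H / emeasure (wmeasure u) (cb a h)"
        using UQ by (simp add: divide_ennreal_def inverse_ennreal inverse_eq_divide)
      also have "ennreal K * \<dots> \<le> ennreal K * mmax (wmeasure u) H x"
        by (intro mult_left_mono mmax_ge h x) simp
      finally show ?thesis unfolding A_def .
    qed
    have "epowr (maxop f x) p \<le> ennreal (K powr p') * epowr (mmax (wmeasure u) H x) p'" for x
    proof -
      have "maxop f x \<le> epowr (ennreal K * mmax (wmeasure u) H x) (1 / (p - 1))"
        unfolding maxop_eq_mmax mmax_def
      proof (rule SUP_least, clarify)
        fix a h assume "h > 0" "x \<in> ob a h"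
        then have "epowr (epowr ((set_nn_integral lebesgue (cb a h) f) / emeasure lebesgue (cb a h)) (p - 1)) (1 / (p - 1))
           \<le> epowr (ennreal K * mmax (wmeasure u) H x) (1 / (p - 1))"
          using p by (intro epowr_mono pointwise) auto
        then show "set_nn_integral lebesgue (cb a h) f / emeasure lebesgue (cb a h)
           \<le> epowr (ennreal K * (SUP (a, h)\<in>{(a, h). 0 < h \<and> x \<in> ob a h}.
              (set_nn_integral (wmeasure u) (cb a h) H) / emeasure (wmeasure u) (cb a h))) (1 / (p - 1))"
          using p by (simp add: epowr_epowr mmax_def)
      qed
      then have "epowr (maxop f x) p \<le> epowr (epowr (ennreal K * mmax (wmeasure u) H x) (1 / (p - 1))) p"
        using p by (intro epowr_mono) auto
      also have "\<dots> = epowr (ennreal K * mmax (wmeasure u) H x) p'"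
        by (simp add: epowr_epowr p'_def)
      also have "\<dots> = ennreal (K powr p') * epowr (mmax (wmeasure u) H x) p'"
        using p' K by (simp add: epowr_mult)
      finally show ?thesis .
    qed
    then have "wint p u (maxop f)
        \<le> (\<integral>\<^sup>+x. ennreal (K powr p') * (ennreal (u x) * epowr (mmax (wmeasure u) H x) p') \<partial>lebesgue)"
      by (intro nn_integral_mono) (metis mult.assoc mult.commute mult_right_mono zero_le)
    also have "\<dots> = ennreal (K powr p') * (\<integral>\<^sup>+x. epowr (mmax (wmeasure u) H x) p' \<partial>wmeasure u)"
      by (subst nn_integral_wmeasure) (auto simp: nn_integral_cmult)
    also have "\<dots> \<le> ennreal (K powr p') * (ennreal CU * (\<integral>\<^sup>+x. epowr (H x) p' \<partial>wmeasure u))"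
      by (intro mult_left_mono CU) auto
    also have "(\<integral>\<^sup>+x. epowr (H x) p' \<partial>wmeasure u) = (\<integral>\<^sup>+x. epowr (mmax (wmeasure v) fv x) p \<partial>wmeasure v)"
    proof (subst (1 2) nn_integral_wmeasure; (measurable)?)
      show "(\<integral>\<^sup>+x. ennreal (u x) * epowr (H x) p' \<partial>lebesgue)
        = (\<integral>\<^sup>+x. ennreal (v x) * epowr (mmax (wmeasure v) fv x) p \<partial>lebesgue)"
      proof (rule nn_integral_cong_AE)
        show "AE x in lebesgue. ennreal (u x) * epowr (H x) p' = ennreal (v x) * epowr (mmax (wmeasure v) fv x) p"
          using dual
        proof eventually_elim
          case (elim x)
          have "epowr (H x) p' = epowr (mmax (wmeasure v) fv x) p * ennreal ((1 / u x) powr p')"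
            using p p' elim by (simp add: H_def G_def epowr_mult epowr_epowr p'_def)
          moreover have "u x * (1 / u x) powr p' = v x"
          proof -
            have "1 - p' = - 1 / (p - 1)" using p by (simp add: p'_def field_simps)
            moreover have "u x * (1 / u x) powr p' = u x powr (1 - p')"
              using elim by (simp add: powr_divide powr_diff)
            ultimately show ?thesis using elim by simp
          qed
          then have "ennreal (u x) * ennreal ((1 / u x) powr p') = ennreal (v x)"
            using elim by (simp flip: ennreal_mult)
          ultimately show ?case by (metis mult.assoc mult.commute)
        qed
      qed
    qed
    also have "\<dots> \<le> ennreal CV * (\<integral>\<^sup>+x. epowr (fv x) p \<partial>wmeasure v)"
      by (rule CV(2)) measurable
    also have "(\<integral>\<^sup>+x. epowr (fv x) p \<partial>wmeasure v) = wint p u f"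
    proof (subst nn_integral_wmeasure; (measurable)?)
      show "(\<integral>\<^sup>+x. ennreal (v x) * epowr (fv x) p \<partial>lebesgue) = wint p u f"
      proof (rule nn_integral_cong_AE)
        show "AE x in lebesgue. ennreal (v x) * epowr (fv x) p = epowr (f x) p * ennreal (u x)"
          using dual
        proof eventually_elim
          case (elim x)
          have v: "v x > 0" using elim by auto
          have "epowr (fv x) p = epowr (f x) p * ennreal ((1 / v x) powr p)"
            using p v by (simp add: fv_def epowr_mult)
          moreover have "v x * (1 / v x) powr p = u x"
          proof -
            have "v x * (1 / v x) powr p = v x powr (1 - p)"
              using v by (simp add: powr_divide powr_diff)
            also have "\<dots> = u x powr (- 1 / (p - 1) * (1 - p))" using elim by (simp add: powr_powr)
            also have "- 1 / (p - 1) * (1 - p) = 1" using p by (simp add: field_simps)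
            finally show ?thesis using elim by simp
          qed
          then have "ennreal (v x) * ennreal ((1 / v x) powr p) = ennreal (u x)"
            using v by (simp flip: ennreal_mult)
          ultimately show ?case by (metis mult.assoc mult.commute)
        qed
      qed
    qed
    finally have "wint p u (maxop f)
      \<le> ennreal (K powr p') * (ennreal CU * (ennreal CV * wint p u f))"
      by (simp add: mult_left_mono)
    also have "\<dots> = ennreal (K powr p' * (CU * CV)) * wint p u f"
      using CU(1) CV(1) by (simp add: ennreal_mult mult.assoc)
    finally show ?thesis .
  qed
  show ?thesis
  proof (intro exI[of _ "K powr p' * (CU * CV) + 1"] conjI ballI)
    show "0 < K powr p' * (CU * CV) + 1" using CU(1) CV(1) by (intro add_nonneg_pos) auto
    fix f :: "real^'n \<Rightarrow> ennreal" assume "f \<in> borel_measurable lebesgue"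
    from main[OF this] show "wint p u (maxop f)
        \<le> ennreal (K powr p' * (CU * CV) + 1) * wint p u f"
      by (rule order_trans) (intro mult_right_mono ennreal_leI, auto)
  qed
qed

end

section \<open>From the definition of \<open>Ap_class\<close> to a Muckenhoupt pair\<close>

lemma weight_measurable:
  assumes "weight w" shows "w \<in> borel_measurable lebesgue"
proof -
  have m: "(\<lambda>x. indicator (cball 0 (real n)) x * w x) \<in> borel_measurable lebesgue" for n
  proof -
    have "set_integrable lebesgue (cball 0 (real n)) w" using assms by (simp add: weight_def)
    then show ?thesis by (simp add: set_integrable_def borel_measurable_integrable)
  qed
  have "(\<lambda>n. indicator (cball 0 (real n)) x * w x) \<longlonglongrightarrow> w x" for x
  proof (rule tendsto_eventually)
    obtain N where "norm x \<le> real N" using real_arch_simple by blast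
    then show "\<forall>\<^sub>F n in sequentially. indicator (cball 0 (real n)) x * w x = w x"
      unfolding eventually_sequentially by (intro exI[of _ N]) auto
  qed
  then show ?thesis by (rule borel_measurable_LIMSEQ_real[OF _ m])
qed

lemma weight_nonneg: "weight w \<Longrightarrow> 0 \<le> w x"
  by (simp add: weight_def)

lemma weight_finite:
  assumes "weight w" shows "emeasure (wmeasure w) (cb a h) < top"
proof -
  have "set_integrable lebesgue (cb a h) w" using assms by (simp add: weight_def)
  then have "(\<integral>\<^sup>+x. ennreal (norm (indicator (cb a h) x *\<^sub>R w x)) \<partial>lebesgue) < \<infinity>"
    by (auto simp: set_integrable_def integrable_iff_bounded)
  also have "(\<integral>\<^sup>+x. ennreal (norm (indicator (cb a h) x *\<^sub>R w x)) \<partial>lebesgue)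
      = (\<integral>\<^sup>+x. ennreal (w x) * indicator (cb a h) x \<partial>lebesgue)"
    using weight_nonneg[OF assms] by (intro nn_integral_cong) (auto split: split_indicator)
  also have "\<dots> = emeasure (wmeasure w) (cb a h)"
    using weight_measurable[OF assms] by (simp add: emeasure_wmeasure)
  finally show ?thesis by simp
qed

text \<open>The weight that vanishes almost everywhere has to be treated apart: it is not doubling,
  and its \<open>A_p\<close> product is 0 times infinity.\<close>

lemma weight_cases:
  assumes "weight w"
  obtains (zero) "AE x in lebesgue. w x = 0"
    | (pos) a h where "h > 0" "emeasure (wmeasure w) (cb a h) > 0"
proof (cases "\<forall>a h. h > 0 \<longrightarrow> emeasure (wmeasure w) (cb a h) = 0")
  case True
  have "AE x in lebesgue. w x = 0"
  proof (rule AE_cubesI)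
    fix a :: "real^'a" and h :: real assume "h > 0"
    then have "(\<integral>\<^sup>+x. ennreal (w x) * indicator (cb a h) x \<partial>lebesgue) = 0"
      using True weight_measurable[OF assms] by (simp add: emeasure_wmeasure)
    then have "AE x in lebesgue. ennreal (w x) * indicator (cb a h) x = 0"
      using weight_measurable[OF assms] by (subst (asm) nn_integral_0_iff_AE) auto
    then show "AE x in lebesgue. x \<in> cb a h \<longrightarrow> w x = 0"
      by eventually_elim (use weight_nonneg[OF assms] in \<open>auto simp: ennreal_eq_0_iff antisym\<close>)
  qed
  then show thesis by (rule zero)
qed (use pos in \<open>auto simp: zero_less_iff_neq_zero\<close>)

lemma avg_weight:
  fixes a :: "real^'n"
  assumes "weight w" "h > 0"
  shows "avg (cb a h) (\<lambda>y. ennreal (w y)) = ennreal (measure (wmeasure w) (cb a h) / h ^ CARD('n))"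
proof -
  have "avg (cb a h) (\<lambda>y. ennreal (w y)) = emeasure (wmeasure w) (cb a h) / ennreal (h ^ CARD('n))"
    using assms weight_measurable[OF assms(1)] by (simp add: avg_def emeasure_wmeasure emeasure_cb)
  also have "emeasure (wmeasure w) (cb a h) = ennreal (measure (wmeasure w) (cb a h))"
    using weight_finite[OF assms(1), of a h] by (simp add: emeasure_eq_ennreal_measure)
  finally show ?thesis using assms by (simp add: divide_ennreal)
qed

text \<open>Any cube lies in a larger one on which \<open>w\<close> has positive average. There an
  infinite dual average would make the \<open>A_p\<close> product infinite. So \<open>dualw\<close>
  is locally integrable, which forces \<open>w\<close> to be positive almost everywhere.\<close>

lemma Ap_imp_muckenhoupt_pair:
  fixes w :: "real^'n \<Rightarrow> real"
  assumes p: "p > 1" and w: "weight w" and Ap: "Ap_class p w"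
    and nz: "h0 > 0" "emeasure (wmeasure w) (cb a0 h0) > 0"
  shows "\<exists>K. muckenhoupt_pair w (\<lambda>x. w x powr (- 1 / (p - 1))) p K"
proof -
  have wm [measurable]: "w \<in> borel_measurable lebesgue" by (rule weight_measurable[OF w])
  have dm [measurable]: "dualw p w \<in> borel_measurable lebesgue"
    unfolding dualw_def[abs_def] by measurable
  obtain C where C: "\<And>a h. h > 0 \<Longrightarrow>
      avg (cb a h) (\<lambda>y. ennreal (w y)) * epowr (avg (cb a h) (dualw p w)) (p - 1) \<le> ennreal C"
    using Ap unfolding Ap_class_def using cube_cb by blast
  have fin: "(\<integral>\<^sup>+x. dualw p w x * indicator (cb a h) x \<partial>lebesgue) < top" if h: "h > 0" for a h
  proof -
    define m where "m = norm a + norm a0 + h + h0"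
    let ?Q = "cb (- m *\<^sub>R One :: real^'n) (2 * m)"
    have m: "m > 0" using h nz by (simp add: m_def add_nonneg_pos)
    have s: "cb a h \<subseteq> ?Q" "cb a0 h0 \<subseteq> ?Q"
      by (rule subset_big_cube; use h nz in \<open>simp add: m_def\<close>)+
    have "0 < emeasure (wmeasure w) ?Q"
      using nz(2) by (rule less_le_trans) (rule emeasure_mono, use s in auto)
    then have "0 < measure (wmeasure w) ?Q"
      using weight_finite[OF w, of "- m *\<^sub>R One" "2 * m"]
      by (metis emeasure_eq_ennreal_measure ennreal_less_zero_iff less_irrefl)
    then have pos: "avg ?Q (\<lambda>y. ennreal (w y)) > 0" using m by (subst avg_weight[OF w]) auto
    have "avg ?Q (dualw p w) \<noteq> top"
    proof
      assume "avg ?Q (dualw p w) = top"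
      then have "top \<le> ennreal C" using C[of "2 * m" "- m *\<^sub>R One"] m pos by (simp add: ennreal_mult_top split: if_splits)
      then show False by (simp add: top_unique)
    qed
    then have "(\<integral>\<^sup>+x. dualw p w x * indicator ?Q x \<partial>lebesgue) \<noteq> top"
      using m by (auto simp: avg_def emeasure_cb ennreal_top_divide)
    moreover have "(\<integral>\<^sup>+x. dualw p w x * indicator (cb a h) x \<partial>lebesgue) \<le> (\<integral>\<^sup>+x. dualw p w x * indicator ?Q x \<partial>lebesgue)"
      using s(1) by (intro nn_integral_mono mult_left_mono) (auto split: split_indicator)
    ultimately show ?thesis unfolding less_top[symmetric] by (rule neq_top_trans)
  qed
  have wpos: "AE x in lebesgue. 0 < w x"
  proof (rule AE_cubesI)
    fix a :: "real^'n" and h :: real assume h: "h > 0"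
    have "AE x in lebesgue. dualw p w x * indicator (cb a h) x \<noteq> \<infinity>"
      using fin[OF h, of a] by (intro nn_integral_PInf_AE) auto
    then show "AE x in lebesgue. x \<in> cb a h \<longrightarrow> 0 < w x"
      by eventually_elim (use weight_nonneg[OF w] in \<open>auto simp: dualw_def order_less_le\<close>)
  qed
  define v where "v = (\<lambda>x. w x powr (- 1 / (p - 1)))"
  have vm [measurable]: "v \<in> borel_measurable lebesgue" unfolding v_def by measurable
  have ev: "emeasure (wmeasure v) (cb a h) = (\<integral>\<^sup>+x. dualw p w x * indicator (cb a h) x \<partial>lebesgue)" for a h
    unfolding emeasure_wmeasure[OF vm cb_lebesgue]
  proof (rule nn_integral_cong_AE)
    show "AE x in lebesgue. ennreal (v x) * indicator (cb a h) x = dualw p w x * indicator (cb a h) x"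
      using wpos by eventually_elim (simp add: v_def dualw_def)
  qed
  have finv: "emeasure (wmeasure v) (cb a h) < top" if "h > 0" for a h
    using fin[OF that] by (simp add: ev)
  have "muckenhoupt_pair w v p (max C 1)"
  proof
    fix a :: "real^'n" and h :: real assume h: "h > 0"
    define d where "d = h ^ CARD('n)"
    have d: "d > 0" using h by (simp add: d_def)
    let ?U = "measure (wmeasure w) (cb a h)" and ?V = "measure (wmeasure v) (cb a h)"
    have "avg (cb a h) (dualw p w) = ennreal (?V / d)"
      using finv[OF h, of a] h d unfolding avg_def ev[symmetric]
      by (simp add: emeasure_eq_ennreal_measure[of "wmeasure v"] emeasure_cb d_def divide_ennreal)
    then have "ennreal (?U / d) * ennreal ((?V / d) powr (p - 1)) \<le> ennreal C"
      using C[OF h, of a] d h by (simp add: avg_weight[OF w h] d_def)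
    then have "ennreal (?U / d * (?V / d) powr (p - 1)) \<le> ennreal (max C 1)"
      using d by (subst ennreal_mult) (auto intro: order_trans ennreal_leI)
    then have "?U / d * (?V / d) powr (p - 1) \<le> max C 1" by (subst (asm) ennreal_le_iff) auto
    then have "?U * ?V powr (p - 1) \<le> max C 1 * (d * d powr (p - 1))"
      using d by (simp add: powr_divide field_simps)
    also have "d * d powr (p - 1) = d powr p" using d by (simp add: powr_diff)
    finally show "?U * ?V powr (p - 1) \<le> max C 1 * (h ^ CARD('n)) powr p" by (simp add: d_def)
  qed (use p wpos finv weight_finite[OF w] in \<open>auto simp: v_def\<close>)
  then show ?thesis unfolding v_def by blast
qed

section \<open>Lower bounds for maximal functions of cubes, and the implication from
  \<open>A_p\<close>\<close>

lemma maxop_indicator_ge_decay: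
  "ennreal (1 / (2 * (1 + norm x)) ^ CARD('n)) \<le> maxop (indicator (cb (0 :: real^'n) 1)) x"
proof -
  \<comment> \<open>The origin-centred cube with half-side \<open>m\<close> contains both the unit
    cube and \<open>x\<close>.\<close>
  define m where "m = 1 + norm x"
  have m: "m > 0" by (simp add: m_def add_pos_nonneg)
  let ?Q = "cb (- m *\<^sub>R One :: real^'n) (2 * m)"
  have s: "cb (0 :: real^'n) 1 \<subseteq> ?Q" "x \<in> ?Q"
    using subset_big_cube[of "0 :: real^'n" 1 m] subset_big_cube[of x 0 m] cb_ne[of 0 x] by (auto simp: m_def)
  have "(\<integral>\<^sup>+y. indicator (cb 0 1) y * indicator ?Q y \<partial>lebesgue) = (\<integral>\<^sup>+y. indicator (cb (0 :: real^'n) 1) y \<partial>lebesgue)"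
    using s by (intro nn_integral_cong) (auto split: split_indicator)
  also have "\<dots> = 1" by (simp add: emeasure_cb)
  finally have "ennreal (1 / (2 * m) ^ CARD('n)) =
      (\<integral>\<^sup>+y. indicator (cb 0 1) y * indicator ?Q y \<partial>lebesgue) / emeasure lebesgue ?Q"
    using m by (simp add: emeasure_cb divide_ennreal flip: ennreal_1)
  also have "\<dots> \<le> maxop (indicator (cb 0 1)) x"
    unfolding maxop_def using s m by (intro SUP_upper) auto
  finally show ?thesis by (simp add: m_def)
qed

lemma maxop_indicator_ge_1:
  fixes Q :: "(real^'n) set"
  assumes "cube Q" "x \<in> Q" shows "1 \<le> maxop (indicator Q) x"
proof -
  obtain a h where h: "h > 0" "Q = cb a h" using assms by (auto simp: cube_iff)
  have "(\<integral>\<^sup>+y. indicator Q y * indicator Q y \<partial>lebesgue) = (\<integral>\<^sup>+y. indicator Q y \<partial>lebesgue)"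
    by (intro nn_integral_cong) (auto split: split_indicator)
  then have "1 = (\<integral>\<^sup>+y. indicator Q y * indicator Q y \<partial>lebesgue) / emeasure lebesgue Q"
    using h by (simp add: emeasure_cb divide_ennreal)
  also have "\<dots> \<le> maxop (indicator Q) x"
    unfolding maxop_def using assms by (intro SUP_upper) auto
  finally show ?thesis .
qed

lemma Ap_imp_Wp_Cp:
  fixes w :: "real^'n \<Rightarrow> real"
  assumes p: "p > 1" and w: "weight w" and Ap: "Ap_class p w"
  shows "Wp_class p w \<and> Cp_class p w"
  using w
proof (cases rule: weight_cases)
  case zero
  have z: "(\<integral>\<^sup>+x. f x * ennreal (w x) \<partial>lebesgue) = 0" "(\<integral>\<^sup>+x. ennreal (w x) * f x \<partial>lebesgue) = 0" for f
  proof -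
    have "(\<integral>\<^sup>+x. f x * ennreal (w x) \<partial>lebesgue) = (\<integral>\<^sup>+x. 0 \<partial>(lebesgue :: (real^'n) measure))"
      using zero by (intro nn_integral_cong_AE) (auto elim: eventually_mono)
    then show "(\<integral>\<^sup>+x. f x * ennreal (w x) \<partial>lebesgue) = 0" by simp
    then show "(\<integral>\<^sup>+x. ennreal (w x) * f x \<partial>lebesgue) = 0" by (simp add: mult.commute)
  qed
  have "(\<integral>\<^sup>+x. ennreal (w x / (1 + norm x) powr (real CARD('n) * p)) \<partial>lebesgue) = (\<integral>\<^sup>+x. 0 \<partial>(lebesgue :: (real^'n) measure))"
    using zero by (intro nn_integral_cong_AE) (auto elim: eventually_mono)
  then have "Np_class p w" by (simp add: Np_class_def)
  then show ?thesis
    by (auto simp: Wp_class_def Cp_class_def z intro!: exI[of _ "1::real"])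
next
  case (pos a0 h0)
  define v where "v = (\<lambda>x. w x powr (- 1 / (p - 1)))"
  obtain K where K: "muckenhoupt_pair w v p K"
    using Ap_imp_muckenhoupt_pair[OF p w Ap pos] unfolding v_def by blast
  interpret muckenhoupt_pair w v p K by (rule K)
  obtain C where C: "C > 0" "\<And>f. f \<in> borel_measurable lebesgue \<Longrightarrow>
    wint p w (maxop f)
      \<le> ennreal C * wint p w f"
    using norm_inequality by blast
  have "Np_class p w"
  proof -
    let ?Q = "cb (0 :: real^'n) 1"
    \<comment> \<open>The maximal function of the unit cube decays no faster than
      \<open>(1 + |x|)^(-n)\<close>, so its p-th power dominates the kernel in
      \<open>Np_class\<close>; the norm inequality then bounds the integral by a multiple of the
      mass of the unit cube.\<close>
    have le: "ennreal (w x / (1 + norm x) powr (real CARD('n) * p))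
      \<le> ennreal (2 powr (real CARD('n) * p)) * (epowr (maxop (indicator ?Q) x) p * ennreal (w x))" for x :: "real^'n"
    proof -
      define m where "m = 1 + norm x"
      have m: "m > 0" by (simp add: m_def add_pos_nonneg)
      have eq: "w x / m powr (real CARD('n) * p) = 2 powr (real CARD('n) * p) * ((1 / (2 * m) ^ CARD('n)) powr p * w x)"
        using m by (simp add: powr_divide powr_mult powr_powr flip: powr_realpow)
      have "ennreal (w x / m powr (real CARD('n) * p))
        = ennreal (2 powr (real CARD('n) * p)) * (epowr (ennreal (1 / (2 * m) ^ CARD('n))) p * ennreal (w x))"
        unfolding eq using weight_nonneg[OF w, of x] m by (simp add: ennreal_mult)
      also have "\<dots> \<le> ennreal (2 powr (real CARD('n) * p)) * (epowr (maxop (indicator ?Q) x) p * ennreal (w x))"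
        using maxop_indicator_ge_decay[of x] p m_def by (intro mult_left_mono mult_right_mono epowr_mono) auto
      finally show ?thesis by (simp add: m_def)
    qed
    have "(\<integral>\<^sup>+x. ennreal (w x / (1 + norm x) powr (real CARD('n) * p)) \<partial>lebesgue) \<le>
      (\<integral>\<^sup>+x. ennreal (2 powr (real CARD('n) * p)) * (epowr (maxop (indicator ?Q) x) p * ennreal (w x)) \<partial>lebesgue)"
      by (intro nn_integral_mono le)
    also have "\<dots> = ennreal (2 powr (real CARD('n) * p)) * wint p w (maxop (indicator ?Q))"
      by (rule nn_integral_cmult) measurable
    also have "\<dots> \<le> ennreal (2 powr (real CARD('n) * p)) * (ennreal C * wint p w (indicator ?Q))"
      by (intro mult_left_mono C) auto
    also have "wint p w (indicator ?Q) = emeasure (wmeasure w) ?Q"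
      unfolding emeasure_wmeasure[OF u_meas cb_lebesgue]
      by (intro nn_integral_cong) (auto split: split_indicator)
    also have "ennreal (2 powr (real CARD('n) * p)) * (ennreal C * emeasure (wmeasure w) ?Q) < top"
      using fin_u[of 1 0] by (simp add: ennreal_mult_less_top)
    finally show ?thesis by (simp add: Np_class_def)
  qed
  moreover have "Wp_class p w"
    unfolding Wp_class_def
  proof (intro conjI exI[of _ C] allI impI)
    fix f :: "real^'n \<Rightarrow> real"
    show "wint p w (maxop (Mreal f))
      \<le> ennreal C * wint p w (Mreal f)"
      by (rule C(2)) (simp add: Mreal_def)
  qed (use C(1) \<open>Np_class p w\<close> in auto)
  moreover have "Cp_class p w"
  proof -
    interpret L: cube_lower "wmeasure w" "2 powr p * K" p by (rule lower)
    obtain B \<delta> where B: "B > 0" "\<delta> > 0" "\<And>a h E. h > 0 \<Longrightarrow> E \<in> sets lebesgue \<Longrightarrow> E \<subseteq> cb a h \<Longrightarrow>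
      measure (wmeasure w) E \<le> B * (vol E / vol (cb a h)) powr \<delta> * measure (wmeasure w) (cb a h)"
      using cube_doubling_pair.power_bound[OF L.pair] cube_doubling_pair.const_pos[OF L.pair]
        cube_doubling_pair.delta_pos[OF L.pair] by metis
    show ?thesis
      unfolding Cp_class_def
    proof (rule exI[of _ B], rule conjI[OF B(1)], rule exI[of _ \<delta>], rule conjI[OF B(2)], intro allI impI)
      fix Q E :: "(real^'n) set"
      assume Q: "cube Q" and E: "E \<in> sets lebesgue" "E \<subseteq> Q"
      obtain a h where h: "h > 0" and Qab: "Q = cb a h" using Q by (auto simp: cube_iff)
      have le: "emeasure lebesgue E = ennreal (vol E)"
        using cube_doubling.emeasure_eq[OF cube_doubling_lebesgue h, of E a] E(2) Qab by simp
      \<comment> \<open>The right-hand side of \<open>C_p\<close> is at least w(Q), because the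
        maximal function of the cube is at least 1 on it. So the \<open>A_infty\<close> bound with
        w(Q) suffices.\<close>
      have wQ: "emeasure (wmeasure w) Q \<le> wint p w (maxop (indicator Q))"
        unfolding Qab emeasure_wmeasure[OF u_meas cb_lebesgue] unfolding Qab[symmetric]
      proof (rule nn_integral_mono)
        fix x
        show "ennreal (w x) * indicator Q x \<le> epowr (maxop (indicator Q) x) p * ennreal (w x)"
        proof (cases "x \<in> Q")
          case True
          then have "epowr 1 p \<le> epowr (maxop (indicator Q) x) p"
            using p by (intro epowr_mono maxop_indicator_ge_1 Q) auto
          then have "1 * ennreal (w x) \<le> epowr (maxop (indicator Q) x) p * ennreal (w x)"
            by (intro mult_right_mono) auto
          then show ?thesis using True by simp
        qed simp
      qed
      have "(\<integral>\<^sup>+x. ennreal (w x) * indicator E x \<partial>lebesgue) = ennreal (measure (wmeasure w) E)"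
        using L.meas_eq[OF h, of E a] E Qab by (simp add: emeasure_wmeasure)
      also have "\<dots> \<le> ennreal (B * (vol E / vol Q) powr \<delta> * measure (wmeasure w) Q)"
        unfolding Qab by (intro ennreal_leI B(3) h E(1) E(2)[unfolded Qab])
      also have "\<dots> = ennreal B * epowr (emeasure lebesgue E / emeasure lebesgue Q) \<delta> * emeasure (wmeasure w) Q"
        using h B(1) L.meas_eq[OF h, of Q a] unfolding Qab
        by (simp add: le emeasure_cb measure_cb divide_ennreal ennreal_mult)
      also have "\<dots> \<le> ennreal B * epowr (emeasure lebesgue E / emeasure lebesgue Q) \<delta>
          * wint p w (maxop (indicator Q))"
        by (intro mult_left_mono wQ) simp
      finally show "(\<integral>\<^sup>+x. ennreal (w x) * indicator E x \<partial>lebesgue)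
        \<le> ennreal B * epowr (emeasure lebesgue E / emeasure lebesgue Q) \<delta>
          * wint p w (maxop (indicator Q))" .
    qed
  qed
  ultimately show ?thesis by blast
qed

subsection \<open>Maximal functions of sets and the class \<open>W\<^sub>p\<close>\<close>

text \<open>The constants do not depend on \<open>\<nu>\<close>, which will run through a family of \<open>A\<^sub>1\<close> weights.\<close>
lemma cube_lower_power_bound:
  "\<exists>C>0. \<exists>\<delta>>0. \<forall>\<nu> :: (real^'n) measure. cube_lower \<nu> A q \<longrightarrow>
    (\<forall>a h E. h > 0 \<longrightarrow> E \<in> sets lebesgue \<longrightarrow> E \<subseteq> cb a h \<longrightarrow>
      measure \<nu> E \<le> C * (vol E / vol (cb a h)) powr \<delta> * measure \<nu> (cb a h))"
\<comment> \<open>\<open>const\<close> and \<open>delta\<close> are expressions in the locale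
  parameters alone, here determined by the dimension, \<open>A\<close> and \<open>q\<close>. A
  particular \<open>\<nu>0\<close> serves only to show that they are positive; without one the claim
  is vacuous.\<close>
proof (cases "\<exists>\<nu> :: (real^'n) measure. cube_lower \<nu> A q")
  case True
  then obtain \<nu>0 :: "(real^'n) measure" where \<nu>0: "cube_lower \<nu>0 A q" by blast
  show ?thesis
    using cube_doubling_pair.const_pos[OF cube_lower.pair[OF \<nu>0]]
      cube_doubling_pair.delta_pos[OF cube_lower.pair[OF \<nu>0]]
      cube_doubling_pair.power_bound[OF cube_lower.pair]
    by blast
next
  case False
  then show ?thesis by (auto intro!: exI[of _ "1::real"])
qed

section \<open>Testing maximal functions of sets on single cubes\<close>

lemma maxop_mono: "(\<And>y. f y \<le> g y) \<Longrightarrow> maxop f x \<le> maxop g x"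
  unfolding maxop_def
  by (intro SUP_mono') (auto intro!: divide_right_mono_ennreal nn_integral_mono mult_right_mono)

lemma cube_emeasure:
  fixes Q :: "(real^'n) set"
  assumes "cube Q"
  shows "0 < emeasure lebesgue Q" "emeasure lebesgue Q < top" "Q \<in> sets lebesgue"
proof -
  obtain a h where "h > 0" "Q = cb a h" using assms by (auto simp: cube_iff)
  then show "0 < emeasure lebesgue Q" "emeasure lebesgue Q < top" "Q \<in> sets lebesgue"
    by (auto simp: emeasure_cb)
qed

lemma maxop_le:
  assumes "\<And>y. f y \<le> c" shows "maxop f x \<le> c"
  unfolding maxop_def
proof (rule SUP_least, clarify)
  fix Q :: "(real^'a) set" assume Q: "cube Q"
  have "set_nn_integral lebesgue Q f \<le> (\<integral>\<^sup>+y. c * indicator Q y \<partial>lebesgue)"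
    using assms by (intro nn_integral_mono mult_right_mono) auto
  also have "\<dots> = c * emeasure lebesgue Q"
    using cube_emeasure(3)[OF Q] by (rule nn_integral_cmult_indicator)
  finally have "set_nn_integral lebesgue Q f / emeasure lebesgue Q \<le> c * emeasure lebesgue Q / emeasure lebesgue Q"
    by (rule divide_right_mono_ennreal)
  also have "\<dots> = c" using cube_emeasure(1,2)[OF Q] by (intro ennreal_mult_divide_eq) auto
  finally show "set_nn_integral lebesgue Q f / emeasure lebesgue Q \<le> c" .
qed

lemma nn_integral_indicator_Int:
  assumes "E \<in> sets M" "Q \<in> sets M"
  shows "(\<integral>\<^sup>+y. indicator E y * indicator Q y \<partial>M) = emeasure M (E \<inter> Q)"
proof -
  have "(\<integral>\<^sup>+y. indicator E y * indicator Q y \<partial>M) = (\<integral>\<^sup>+y. indicator (E \<inter> Q) y \<partial>M)"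
    by (intro nn_integral_cong) (auto split: split_indicator)
  then show ?thesis using assms by simp
qed

lemma emeasure_Int_cb:
  assumes "k > 0"
  shows "emeasure lebesgue (E \<inter> cb b k) = ennreal (vol (E \<inter> cb b k))"
  using cube_doubling.emeasure_eq[OF cube_doubling_lebesgue assms, of "E \<inter> cb b k" b] by simp

lemma maxop_indicator_leI:
  fixes E :: "(real^'n) set"
  assumes E: "E \<in> sets lebesgue"
    and le: "\<And>b k. k > 0 \<Longrightarrow> x \<in> cb b k \<Longrightarrow> ennreal (vol (E \<inter> cb b k) / k ^ CARD('n)) \<le> c"
  shows "maxop (indicator E) x \<le> c"
  unfolding maxop_def
proof (rule SUP_least, clarify)
  fix Q :: "(real^'n) set" assume "cube Q" "x \<in> Q"
  then obtain b k where k: "k > 0" "Q = cb b k" by (auto simp: cube_iff)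
  have "(\<integral>\<^sup>+y. indicator E y * indicator Q y \<partial>lebesgue) / emeasure lebesgue Q
      = ennreal (vol (E \<inter> cb b k) / k ^ CARD('n))"
    using k E by (simp add: nn_integral_indicator_Int emeasure_Int_cb emeasure_cb divide_ennreal)
  also have "\<dots> \<le> c" using k \<open>x \<in> Q\<close> by (intro le) auto
  finally show "(\<integral>\<^sup>+y. indicator E y * indicator Q y \<partial>lebesgue) / emeasure lebesgue Q \<le> c" .
qed

lemma maxop_indicator_ge:
  fixes E :: "(real^'n) set"
  assumes E: "E \<in> sets lebesgue" and k: "k > 0" "x \<in> cb b k"
  shows "ennreal (vol (E \<inter> cb b k) / k ^ CARD('n)) \<le> maxop (indicator E) x"
proof -
  have "ennreal (vol (E \<inter> cb b k) / k ^ CARD('n)) =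
      (\<integral>\<^sup>+y. indicator E y * indicator (cb b k) y \<partial>lebesgue) / emeasure lebesgue (cb b k)"
    using k E by (simp add: nn_integral_indicator_Int emeasure_Int_cb emeasure_cb divide_ennreal)
  also have "\<dots> \<le> maxop (indicator E) x"
    unfolding maxop_def using k by (intro SUP_upper) auto
  finally show ?thesis .
qed

lemma measure_Int_cb_le:
  assumes "E \<in> sets lebesgue" "k > 0"
  shows "vol (E \<inter> cb (b :: real^'n) k) \<le> k ^ CARD('n)"
  using cube_doubling.measure_mono[OF cube_doubling_lebesgue assms(2), of "E \<inter> cb b k" "cb b k" b] assms
  by (simp add: measure_cb)

text \<open>A cube of side \<open>k\<close> containing \<open>x\<close> and meeting the fixed cube
  forces \<open>1 + norm x\<close> to be at most a constant times \<open>max 1 k\<close>. If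
  \<open>k\<close> is at most 1, density at most 1 suffices; otherwise the density is at most
  \<open>(h / k)^n\<close>.\<close>

lemma maxop_indicator_decay:
  fixes a :: "real^'n"
  assumes h: "h > 0"
  shows "\<exists>B>0. \<forall>x. maxop (indicator (cb a h)) x \<le> ennreal (B / (1 + norm x) ^ CARD('n))"
proof -
  obtain \<rho> where \<rho>: "\<rho> > 0" "\<And>z. z \<in> cb a h \<Longrightarrow> norm z \<le> \<rho>"
    using compact_imp_bounded[OF compact_cb[of a h]] by (auto simp: bounded_pos)
  define c where "c = 1 + \<rho> + real CARD('n)"
  have c: "c > 0" using \<rho>(1) by (simp add: c_def add_pos_pos)
  define B where "B = c ^ CARD('n) * (1 + h ^ CARD('n))"
  have "maxop (indicator (cb a h)) x \<le> ennreal (B / (1 + norm x) ^ CARD('n))" for x :: "real^'n"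
  proof (rule maxop_indicator_leI)
    fix b :: "real^'n" and k :: real assume k: "k > 0" and x: "x \<in> cb b k"
    define r where "r = vol (cb a h \<inter> cb b k) / k ^ CARD('n)"
    have nx: "0 < 1 + norm x" by (simp add: add_pos_nonneg)
    have "r * (1 + norm x) ^ CARD('n) \<le> B"
    proof (cases "cb a h \<inter> cb b k = {}")
      case True
      then show ?thesis using c h by (simp add: r_def B_def)
    next
      case False
      then obtain z where z: "z \<in> cb a h" "z \<in> cb b k" by blast
      have "norm (x - z) \<le> (\<Sum>i\<in>UNIV. \<bar>(x - z) $ i\<bar>)" by (rule norm_le_l1_cart)
      also have "\<dots> \<le> (\<Sum>i\<in>(UNIV :: 'n set). k)"
      proof (rule sum_mono)
        fix i show "\<bar>(x - z) $ i\<bar> \<le> k"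
          using x[unfolded mem_cb, rule_format, of i] z(2)[unfolded mem_cb, rule_format, of i]
            unfolding vector_minus_component by linarith
      qed
      finally have "norm (x - z) \<le> real CARD('n) * k" by simp
      then have n: "1 + norm x \<le> 1 + \<rho> + real CARD('n) * k"
        using \<rho>(2)[OF z(1)] norm_triangle_sub[of x z] by linarith
      have r1: "r \<le> 1" using measure_Int_cb_le[OF cb_lebesgue k, of a h b] k by (simp add: r_def)
      have r0: "r \<ge> 0" using k by (simp add: r_def)
      show ?thesis
      proof (cases "k \<le> 1")
        case True
        then have "real CARD('n) * k \<le> real CARD('n)" by simp
        then have "1 + norm x \<le> c" unfolding c_def using n by linarith
        then have "(1 + norm x) ^ CARD('n) \<le> c ^ CARD('n)" using nx by (intro power_mono) auto
        then have "r * (1 + norm x) ^ CARD('n) \<le> 1 * c ^ CARD('n)"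
          using r0 r1 c nx by (intro mult_mono) auto
        also have "\<dots> \<le> B" using c h by (simp add: B_def)
        finally show ?thesis .
      next
        case False
        have "1 + \<rho> \<le> (1 + \<rho>) * k" using False \<rho>(1) by simp
        then have "1 + norm x \<le> c * k" using n by (simp add: c_def algebra_simps)
        then have 1: "(1 + norm x) ^ CARD('n) \<le> c ^ CARD('n) * k ^ CARD('n)"
          using nx power_mono[of "1 + norm x" "c * k" "CARD('n)"] by (simp add: power_mult_distrib)
        have "vol (cb b k \<inter> cb a h) \<le> h ^ CARD('n)"
          by (rule measure_Int_cb_le[OF cb_lebesgue h])
        then have 2: "r \<le> h ^ CARD('n) / k ^ CARD('n)"
          using k by (simp add: r_def divide_right_mono Int_commute)
        have "r * (1 + norm x) ^ CARD('n) \<le> h ^ CARD('n) / k ^ CARD('n) * (c ^ CARD('n) * k ^ CARD('n))"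
          using 1 2 r0 nx h k by (intro mult_mono) auto
        also have "\<dots> = c ^ CARD('n) * h ^ CARD('n)" using k by simp
        also have "\<dots> \<le> B" using c by (simp add: B_def)
        finally show ?thesis .
      qed
    qed
    then show "ennreal (vol (cb a h \<inter> cb b k) / k ^ CARD('n)) \<le> ennreal (B / (1 + norm x) ^ CARD('n))"
      using nx unfolding r_def[symmetric] by (intro ennreal_leI) (simp add: pos_le_divide_eq)
  qed simp
  moreover have "B > 0" using c h by (simp add: B_def add_pos_pos)
  ultimately show ?thesis by blast
qed

text \<open>The decay of the maximal function of a cube matches the kernel in \<open>N_p\<close>.
  This supplies the finite right-hand side without which the \<open>W_p\<close> inequality says
  nothing.\<close>

lemma Np_finite:
  fixes w :: "real^'n \<Rightarrow> real"
  assumes p: "p > 1" and w: "weight w" and Np: "Np_class p w" and h: "h > 0"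
  shows "wint p w (maxop (indicator (cb a h))) < top"
proof -
  have [measurable]: "w \<in> borel_measurable lebesgue" by (rule weight_measurable[OF w])
  obtain B where B: "B > 0" "\<And>x :: real^'n. maxop (indicator (cb a h)) x \<le> ennreal (B / (1 + norm x) ^ CARD('n))"
    using maxop_indicator_decay[OF h, of a] by blast
  have le: "epowr (maxop (indicator (cb a h)) x) p * ennreal (w x)
      \<le> ennreal (B powr p) * ennreal (w x / (1 + norm x) powr (real CARD('n) * p))" for x
  proof -
    define m where "m = 1 + norm x"
    have m: "m > 0" by (simp add: m_def add_pos_nonneg)
    have "epowr (maxop (indicator (cb a h)) x) p * ennreal (w x) \<le> epowr (ennreal (B / m ^ CARD('n))) p * ennreal (w x)"
      unfolding m_def using p by (intro mult_right_mono epowr_mono B(2)) auto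
    also have "\<dots> = ennreal (B powr p) * ennreal (w x / m powr (real CARD('n) * p))"
      using B(1) m weight_nonneg[OF w, of x]
      by (simp add: powr_divide powr_powr flip: powr_realpow ennreal_mult)
    finally show ?thesis by (simp add: m_def)
  qed
  have "wint p w (maxop (indicator (cb a h)))
    \<le> (\<integral>\<^sup>+x. ennreal (B powr p) * ennreal (w x / (1 + norm x) powr (real CARD('n) * p)) \<partial>lebesgue)"
    by (intro nn_integral_mono le)
  also have "\<dots> = ennreal (B powr p) * (\<integral>\<^sup>+x. ennreal (w x / (1 + norm x) powr (real CARD('n) * p)) \<partial>lebesgue)"
  proof (rule nn_integral_cmult)
    have "(\<lambda>x::real^'n. norm x) \<in> borel_measurable lebesgue"
      by (intro measurable_completion) simp
    then show "(\<lambda>x. ennreal (w x / (1 + norm x) powr (real CARD('n) * p))) \<in> borel_measurable lebesgue"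
      by measurable
  qed
  also have "\<dots> < top" using Np by (simp add: Np_class_def ennreal_mult_less_top)
  finally show ?thesis .
qed

text \<open>A substitute for Minkowski's inequality. Of the factor
  \<open>(\<theta> * \<theta>) ^ k\<close>, one half goes to \<open>b k\<close>, making each
  \<open>\<theta> ^ k * b k\<close> at most the p-th root of the right-hand sum; the other half is
  summed as a geometric series, at most 2.\<close>

lemma epowr_suminf_le:
  fixes b :: "nat \<Rightarrow> ennreal"
  assumes p: "p > 0" and \<theta>: "0 < \<theta>" "\<theta> \<le> 1/2"
  shows "epowr (\<Sum>k. ennreal ((\<theta> * \<theta>) ^ k) * b k) p \<le> ennreal (2 powr p) * (\<Sum>k. ennreal ((\<theta> powr p) ^ k) * epowr (b k) p)"
proof -
  define T where "T = (\<Sum>k. ennreal ((\<theta> powr p) ^ k) * epowr (b k) p)"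
  have each: "ennreal (\<theta> ^ k) * b k \<le> epowr T (1 / p)" for k
  proof -
    have "epowr (ennreal (\<theta> ^ k) * b k) p = ennreal ((\<theta> powr p) ^ k) * epowr (b k) p"
      using p \<theta> by (simp add: epowr_mult powr_powr mult.commute flip: powr_realpow)
    also have "\<dots> \<le> (\<Sum>k\<in>{k}. ennreal ((\<theta> powr p) ^ k) * epowr (b k) p)" by simp
    also have "\<dots> \<le> T" unfolding T_def by (rule sum_le_suminf) auto
    finally have "epowr (epowr (ennreal (\<theta> ^ k) * b k) p) (1 / p) \<le> epowr T (1 / p)"
      using p by (intro epowr_mono) auto
    then show ?thesis using p by (simp add: epowr_epowr)
  qed
  have "(\<Sum>k. ennreal ((\<theta> * \<theta>) ^ k) * b k) \<le> (\<Sum>k. ennreal (\<theta> ^ k) * epowr T (1 / p))"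
  proof (rule suminf_le)
    fix k
    have "ennreal ((\<theta> * \<theta>) ^ k) * b k = ennreal (\<theta> ^ k) * (ennreal (\<theta> ^ k) * b k)"
      using \<theta> by (simp add: power_mult_distrib ennreal_mult mult.assoc)
    also have "\<dots> \<le> ennreal (\<theta> ^ k) * epowr T (1 / p)" by (intro mult_left_mono each) simp
    finally show "ennreal ((\<theta> * \<theta>) ^ k) * b k \<le> ennreal (\<theta> ^ k) * epowr T (1 / p)" .
  qed auto
  also have "\<dots> = (\<Sum>k. ennreal (\<theta> ^ k)) * epowr T (1 / p)" by simp
  also have "(\<Sum>k. ennreal (\<theta> ^ k)) = ennreal (1 / (1 - \<theta>))"
    using \<theta> by (intro suminf_ennreal_eq geometric_sums) auto
  also have "ennreal (1 / (1 - \<theta>)) * epowr T (1 / p) \<le> ennreal 2 * epowr T (1 / p)"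
    using \<theta> by (intro mult_right_mono ennreal_leI) (auto simp: field_simps)
  finally have "epowr (\<Sum>k. ennreal ((\<theta> * \<theta>) ^ k) * b k) p \<le> epowr (ennreal 2 * epowr T (1 / p)) p"
    using p by (intro epowr_mono) auto
  also have "\<dots> = ennreal (2 powr p) * T"
    using p epowr_mult[of p "ennreal 2" "epowr T (1 / p)"] by (simp add: epowr_epowr del: ennreal_numeral)
  finally show ?thesis by (simp add: T_def)
qed

text \<open>The \<open>A_1\<close> condition is assumed at every point of a cube; integrating it
  over the subset gives \<open>lower\<close> with exponent 1. The bound \<open>B\<close> makes
  masses of cubes finite, and \<open>E\<close>, where \<open>R\<close> is at least 1, makes the
  measure nontrivial.\<close>

lemma cube_lower_A1:
  fixes R :: "real^'n \<Rightarrow> ennreal" and a :: "real^'n"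
  assumes R [measurable]: "R \<in> borel_measurable lebesgue" and bd: "\<And>x. R x \<le> ennreal B"
    and E: "E \<in> sets lebesgue" "E \<subseteq> cb a h" "h > 0" "vol E > 0" "\<And>x. x \<in> E \<Longrightarrow> 1 \<le> R x"
    and A: "A > 0" and A1: "\<And>b k x. k > 0 \<Longrightarrow> x \<in> cb b k \<Longrightarrow>
      (set_nn_integral lebesgue (cb b k) R) / emeasure lebesgue (cb b k) \<le> ennreal A * R x"
  shows "cube_lower (density lebesgue R) A 1"
proof
  have em: "emeasure (density lebesgue R) S = set_nn_integral lebesgue S R" if "S \<in> sets lebesgue" for S
    using that by (intro emeasure_density) auto
  have fin: "emeasure (density lebesgue R) (cb b k) < top" if "k > 0" for b :: "real^'n" and k
  proof -
    have "emeasure (density lebesgue R) (cb b k) \<le> (\<integral>\<^sup>+y. ennreal B * indicator (cb b k) y \<partial>lebesgue)"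
      unfolding em[OF cb_lebesgue] by (intro nn_integral_mono mult_right_mono bd) auto
    also have "\<dots> < top" using that by (simp add: nn_integral_cmult_indicator emeasure_cb ennreal_mult_less_top)
    finally show ?thesis .
  qed
  then show "emeasure (density lebesgue R) (cb b k) < top" if "k > 0" for b :: "real^'n" and k using that .
  show "\<exists>b k. k > 0 \<and> emeasure (density lebesgue R) (cb (b :: real^'n) k) > 0"
  proof (intro exI conjI)
    have "0 < emeasure lebesgue E"
      using E(4) by (simp add: measure_def enn2real_positive_iff)
    also have "emeasure lebesgue E = (\<integral>\<^sup>+y. indicator E y \<partial>lebesgue)" using E(1) by simp
    also have "\<dots> \<le> set_nn_integral lebesgue (cb a h) R"
      using E(2,5) by (intro nn_integral_mono) (auto split: split_indicator)
    finally show "emeasure (density lebesgue R) (cb a h) > 0" by (simp add: em)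
  qed (rule E(3))
  show "N \<in> null_sets (density lebesgue R)" if "N \<in> null_sets lebesgue" for N
    using absolutely_continuousI_density[OF R] that by (auto simp: absolutely_continuous_def)
  fix b :: "real^'n" and k F assume k: "k > 0" and F: "F \<in> sets lebesgue" "F \<subseteq> cb b k"
  let ?m = "measure (density lebesgue R)"
  have e1: "emeasure (density lebesgue R) (cb b k) = ennreal (?m (cb b k))"
    using fin[OF k, of b] by (simp add: emeasure_eq_ennreal_measure)
  have "emeasure (density lebesgue R) F \<le> emeasure (density lebesgue R) (cb b k)"
    using F by (intro emeasure_mono) auto
  then have "emeasure (density lebesgue R) F < top" using fin[OF k, of b] by (rule le_less_trans)
  then have e2: "emeasure (density lebesgue R) F = ennreal (?m F)"
    by (intro emeasure_eq_ennreal_measure) simp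
  have lF: "emeasure lebesgue F = ennreal (vol F)"
    using cube_doubling.emeasure_eq[OF cube_doubling_lebesgue k F(2)] .
  have "ennreal (?m (cb b k) / k ^ CARD('n)) * emeasure lebesgue F
     = (\<integral>\<^sup>+y. ennreal (?m (cb b k) / k ^ CARD('n)) * indicator F y \<partial>lebesgue)"
    using F(1) by (simp add: nn_integral_cmult_indicator)
  also have "\<dots> \<le> (\<integral>\<^sup>+y. ennreal A * (R y * indicator F y) \<partial>lebesgue)"
  proof (rule nn_integral_mono)
    fix y
    show "ennreal (?m (cb b k) / k ^ CARD('n)) * indicator F y \<le> ennreal A * (R y * indicator F y)"
    proof (cases "y \<in> F")
      case True
      have "ennreal (?m (cb b k) / k ^ CARD('n)) = set_nn_integral lebesgue (cb b k) R / emeasure lebesgue (cb b k)"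
        using k e1 by (simp add: em emeasure_cb divide_ennreal)
      also have "\<dots> \<le> ennreal A * R y" using True F(2) by (intro A1 k) auto
      finally show ?thesis using True by simp
    qed simp
  qed
  also have "\<dots> = ennreal A * emeasure (density lebesgue R) F"
    using F(1) by (simp add: nn_integral_cmult em)
  finally have "ennreal (?m (cb b k) / k ^ CARD('n) * vol F) \<le> ennreal (A * ?m F)"
    using k A by (simp only: e2 lF ennreal_mult measure_nonneg divide_nonneg_nonneg zero_le_power less_imp_le)
  then have "?m (cb b k) / k ^ CARD('n) * vol F \<le> A * ?m F"
    using A by (subst (asm) ennreal_le_iff) auto
  then show "(vol F / k ^ CARD('n)) powr 1 * ?m (cb b k) \<le> A * ?m F"
    using k by (simp add: mult.commute)
qed auto

section \<open>Iterated maximal functions and the drop of the exponent\<close>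

locale Wp_weight =
  fixes w :: "real^'n \<Rightarrow> real" and p :: real
  assumes p: "p > 1" and w: "weight w" and Wp: "Wp_class p w"
begin

lemma w_meas [measurable]: "w \<in> borel_measurable lebesgue"
  by (rule weight_measurable[OF w])

primrec iter :: "(real^'n) set \<Rightarrow> nat \<Rightarrow> real^'n \<Rightarrow> ennreal" where
  "iter E 0 = indicator E"
| "iter E (Suc k) = maxop (iter E k)"

lemma iter_measurable [measurable]: "E \<in> sets lebesgue \<Longrightarrow> iter E k \<in> borel_measurable lebesgue"
  by (induction k) auto

lemma iter_le_1: "iter E k x \<le> 1"
proof (induction k arbitrary: x)
  case (Suc k)
  then show ?case by (simp add: maxop_le)
qed (auto split: split_indicator)

text \<open>Each use of the \<open>W_p\<close> inequality costs a factor \<open>C\<close> and needs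
  the previous integral to be finite; \<open>Np_finite\<close> provides the start, and the bound
  itself propagates finiteness.\<close>

lemma iter_bound:
  "\<exists>C>0. \<forall>E a h k. h > 0 \<longrightarrow> E \<in> sets lebesgue \<longrightarrow> E \<subseteq> cb a h \<longrightarrow>
     wint p w (maxop (indicator E)) < top \<and>
     wint p w (iter E (Suc k))
       \<le> ennreal (C ^ k) * wint p w (maxop (indicator E))"
proof -
  obtain C where C: "C > 0" "\<And>f. f \<in> borel_measurable lebesgue \<Longrightarrow>
        wint p w (Mreal f) < \<infinity> \<Longrightarrow>
        wint p w (maxop (Mreal f))
          \<le> ennreal C * wint p w (Mreal f)"
    using Wp unfolding Wp_class_def by blast
  have "wint p w (maxop (indicator E)) < top \<and>
     wint p w (iter E (Suc k))
       \<le> ennreal (C ^ k) * wint p w (maxop (indicator E))"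
    if h: "h > 0" and E: "E \<in> sets lebesgue" "E \<subseteq> cb a h" for E a h k
  proof -
    let ?I = "\<lambda>k. wint p w (iter E (Suc k))"
    have "?I 0 \<le> wint p w (maxop (indicator (cb a h)))"
      using p E(2) by (intro nn_integral_mono mult_right_mono epowr_mono)
        (auto intro!: maxop_mono split: split_indicator)
    also have "\<dots> < top" using Wp by (intro Np_finite p w h) (simp add: Wp_class_def)
    finally have 0: "?I 0 < top" .
    have "?I k \<le> ennreal (C ^ k) * ?I 0"
    proof (induction k)
      case (Suc k)
      \<comment> \<open>\<open>W_p\<close> is stated for real-valued functions; since the iterates
        are at most 1, nothing is lost in the conversion.\<close>
      define f where "f = (\<lambda>x. enn2real (iter E k x))"
      have f: "f \<in> borel_measurable lebesgue" unfolding f_def using E(1) by measurable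
      have "ennreal \<bar>f y\<bar> = iter E k y" for y
        using iter_le_1[of E k y] by (simp add: f_def le_less_trans)
      then have M: "Mreal f = iter E (Suc k)" by (simp add: Mreal_def)
      have "ennreal (C ^ k) * ?I 0 < top" using 0 by (simp add: ennreal_mult_less_top)
      with Suc.IH have "?I k < top" by (rule le_less_trans)
      then have "?I (Suc k) \<le> ennreal C * ?I k" using C(2)[OF f] by (simp add: M)
      also have "\<dots> \<le> ennreal C * (ennreal (C ^ k) * ?I 0)" by (intro mult_left_mono Suc.IH) simp
      also have "\<dots> = ennreal (C ^ Suc k) * ?I 0" using C(1) by (simp add: ennreal_mult mult.assoc)
      finally show ?case .
    qed simp
    then show ?thesis using 0 by simp
  qed
  then show ?thesis using C(1) by blast
qed

text \<open>The sum of the Rubio de Francia algorithm is an \<open>A\<^sub>1\<close> weight dominating \<open>\<chi>\<^sub>E\<close>;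
  the gain in its \<open>A\<^sub>\<infinity>\<close> property lowers the exponent of \<open>M\<chi>\<^sub>E\<close>.\<close>
lemma lower_exponent:
  "\<exists>s C. 0 < s \<and> s < p \<and> C > 0 \<and> (\<forall>E a h. h > 0 \<longrightarrow> E \<in> sets lebesgue \<longrightarrow> E \<subseteq> cb a h \<longrightarrow>
     wint p w (maxop (indicator E)) < top \<and>
     wint s w (maxop (indicator E))
       \<le> ennreal C * wint p w (maxop (indicator E)))"
proof -
  obtain C where C: "C > 0" and it: "\<And>E a h k. h > 0 \<Longrightarrow> E \<in> sets lebesgue \<Longrightarrow> E \<subseteq> cb a h \<Longrightarrow>
     wint p w (maxop (indicator E)) < top \<and>
     wint p w (iter E (Suc k))
       \<le> ennreal (C ^ k) * wint p w (maxop (indicator E))"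
    using iter_bound by blast
  \<comment> \<open>Small enough that \<open>\<theta> powr p\<close> beats the growth rate
    \<open>C\<close> of the iterated norms, leaving a ratio of at most 1/2. The weight
    \<open>\<epsilon>\<close> is the square of \<open>\<theta>\<close>, as
    \<open>epowr_suminf_le\<close> requires.\<close>
  define \<theta> where "\<theta> = min (1/2) ((1 / (2 * C)) powr (1 / p))"
  have \<theta>: "0 < \<theta>" "\<theta> \<le> 1/2" using C by (auto simp: \<theta>_def)
  have "\<theta> powr p \<le> ((1 / (2 * C)) powr (1 / p)) powr p"
    using p C by (intro powr_mono2) (auto simp: \<theta>_def)
  also have "\<dots> = 1 / (2 * C)" using p C by (simp add: powr_powr)
  finally have \<theta>C: "\<theta> powr p * C \<le> 1/2" using C by (simp add: field_simps)
  define \<epsilon> where "\<epsilon> = \<theta> * \<theta>"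
  have "\<theta> * \<theta> \<le> (1/2) * (1/2)" using \<theta> by (intro mult_mono) auto
  then have \<epsilon>: "0 < \<epsilon>" "\<epsilon> \<le> 1/4" using \<theta> by (auto simp: \<epsilon>_def)
  obtain B0 \<delta>0 where B0: "B0 > 0" "\<delta>0 > 0" and pb: "\<And>\<nu> :: (real^'n) measure. \<And>a h E. cube_lower \<nu> (1 / \<epsilon>) 1 \<Longrightarrow>
      h > 0 \<Longrightarrow> E \<in> sets lebesgue \<Longrightarrow> E \<subseteq> cb a h \<Longrightarrow>
      measure \<nu> E \<le> B0 * (vol E / vol (cb a h)) powr \<delta>0 * measure \<nu> (cb a h)"
    using cube_lower_power_bound[of "1 / \<epsilon>" 1] by metis
  \<comment> \<open>Capped to keep \<open>1 - \<delta>\<close> positive; since densities are at most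
    1, a smaller exponent only weakens the power bound.\<close>
  define \<delta> where "\<delta> = min \<delta>0 (1/2)"
  have \<delta>: "0 < \<delta>" "\<delta> < 1" "\<delta> \<le> \<delta>0" using B0 by (auto simp: \<delta>_def)
  define s where "s = (1 - \<delta>) * p"
  have s: "0 < s" "s < p" using \<delta> p by (auto simp: s_def)
  define B where "B = B0 powr p * (2 powr p * 2)"
  have "B > 0" using B0 by (simp add: B_def)
  have main: "wint s w (maxop (indicator E))
       \<le> ennreal B * wint p w (maxop (indicator E))"
    if h: "h > 0" and E [measurable]: "E \<in> sets lebesgue" and sub: "E \<subseteq> cb a h" for E a h
  proof (cases "vol E = 0")
    case True
    have "maxop (indicator E) x \<le> 0" for x
    proof (rule maxop_indicator_leI[OF E])
      fix b :: "real^'n" and k :: real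
      have "vol (E \<inter> cb b k) \<le> vol E"
        by (rule cube_doubling.measure_mono[OF cube_doubling_lebesgue h _ sub]) auto
      then have "vol (E \<inter> cb b k) = 0" using True by (simp add: antisym)
      then show "ennreal (vol (E \<inter> cb b k) / k ^ CARD('n)) \<le> 0" by simp
    qed
    then show ?thesis by simp
  next
    case False
    then have Epos: "vol E > 0" by (simp add: order_less_le)
    \<comment> \<open>\<open>S\<close> applies one more maximal operator to each term of
      \<open>R\<close>, so \<open>R\<close> is the indicator of \<open>E\<close> plus
      \<open>\<epsilon> * S\<close>. Averages of \<open>R\<close> over a cube are at most
      \<open>S\<close> at each of its points, and \<open>\<epsilon> * S\<close> is at most
      \<open>R\<close>: hence the \<open>A_1\<close> constant \<open>1 / \<epsilon>\<close>, valid
      everywhere. The terms of \<open>S\<close> are also the ones bounded by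
      \<open>iter_bound\<close>.\<close>
    define S where "S = (\<lambda>x. \<Sum>k. ennreal (\<epsilon> ^ k) * iter E (Suc k) x)"
    define R where "R = (\<lambda>x. \<Sum>k. ennreal (\<epsilon> ^ k) * iter E k x)"
    have [measurable]: "S \<in> borel_measurable lebesgue" unfolding S_def by measurable
    have [measurable]: "R \<in> borel_measurable lebesgue" unfolding R_def by measurable
    have RS: "R x = indicator E x + ennreal \<epsilon> * S x" for x
    proof -
      have "R x = (\<Sum>k. ennreal (\<epsilon> ^ Suc k) * iter E (Suc k) x) + ennreal (\<epsilon> ^ 0) * iter E 0 x"
        unfolding R_def by (rule sums_unique[symmetric], rule sums_Suc) (auto intro: summable_sums)
      also have "(\<Sum>k. ennreal (\<epsilon> ^ Suc k) * iter E (Suc k) x) = (\<Sum>k. ennreal \<epsilon> * (ennreal (\<epsilon> ^ k) * iter E (Suc k) x))"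
        using \<epsilon> by (intro suminf_cong) (simp add: ennreal_mult mult.assoc)
      also have "\<dots> = ennreal \<epsilon> * S x" unfolding S_def by simp
      finally show ?thesis by (simp add: add.commute)
    qed
    have S_ge: "set_nn_integral lebesgue (cb b k) R / emeasure lebesgue (cb b k) \<le> S x"
      if k: "k > 0" and x: "x \<in> cb b k" for b k x
    proof -
      have "set_nn_integral lebesgue (cb b k) R
          = (\<integral>\<^sup>+y. (\<Sum>j. ennreal (\<epsilon> ^ j) * (iter E j y * indicator (cb b k) y)) \<partial>lebesgue)"
        unfolding R_def by (intro nn_integral_cong) (simp add: mult.assoc[symmetric])
      also have "\<dots> = (\<Sum>j. \<integral>\<^sup>+y. ennreal (\<epsilon> ^ j) * (iter E j y * indicator (cb b k) y) \<partial>lebesgue)"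
        by (rule nn_integral_suminf) measurable
      also have "\<dots> = (\<Sum>j. ennreal (\<epsilon> ^ j) * set_nn_integral lebesgue (cb b k) (iter E j))"
        by (intro suminf_cong nn_integral_cmult) measurable
      finally have "set_nn_integral lebesgue (cb b k) R / emeasure lebesgue (cb b k)
        = (\<Sum>j. ennreal (\<epsilon> ^ j) * ((set_nn_integral lebesgue (cb b k) (iter E j)) / emeasure lebesgue (cb b k)))"
        by (simp add: divide_ennreal_def mult.assoc flip: ennreal_suminf_multc)
      also have "\<dots> \<le> S x"
        unfolding S_def
      proof (intro suminf_le mult_left_mono)
        fix j
        show "set_nn_integral lebesgue (cb b k) (iter E j) / emeasure lebesgue (cb b k) \<le> iter E (Suc j) x"
          unfolding iter.simps maxop_def using k x by (intro SUP_upper) auto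
      qed auto
      finally show ?thesis .
    qed
    define \<nu> where "\<nu> = density lebesgue R"
    have low: "cube_lower \<nu> (1 / \<epsilon>) 1"
      unfolding \<nu>_def
    proof (rule cube_lower_A1[OF _ _ E sub h Epos])
      fix x
      have "R x \<le> (\<Sum>k. ennreal (\<epsilon> ^ k))"
        unfolding R_def
      proof (rule suminf_le)
        fix k show "ennreal (\<epsilon> ^ k) * iter E k x \<le> ennreal (\<epsilon> ^ k)"
          using mult_left_mono[OF iter_le_1[of E k x], of "ennreal (\<epsilon> ^ k)"] by simp
      qed auto
      also have "\<dots> = ennreal (1 / (1 - \<epsilon>))" using \<epsilon> by (intro suminf_ennreal_eq geometric_sums) auto
      finally show "R x \<le> ennreal (1 / (1 - \<epsilon>))" .
      show "1 \<le> R x" if "x \<in> E" using that by (simp add: RS)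
    next
      fix b x :: "real^'n" and k :: real assume k: "k > 0" "x \<in> cb b k"
      have "S x = ennreal (1 / \<epsilon>) * (ennreal \<epsilon> * S x)"
        using \<epsilon> by (simp add: mult.assoc[symmetric] flip: ennreal_mult)
      also have "\<dots> \<le> ennreal (1 / \<epsilon>) * R x" by (intro mult_left_mono) (auto simp: RS)
      finally show "set_nn_integral lebesgue (cb b k) R / emeasure lebesgue (cb b k) \<le> ennreal (1 / \<epsilon>) * R x"
        using S_ge[OF k] by (rule order_trans[rotated])
    qed (use \<epsilon> in auto)
    interpret cube_lower \<nu> "1 / \<epsilon>" 1 by (rule low)
    \<comment> \<open>Let \<open>r\<close> be the density of \<open>E\<close> in a cube
      \<open>Q\<close> around \<open>x\<close>. As \<open>R\<close> is at least 1 on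
      \<open>E\<close>, \<open>r |Q| \<le> \<nu>(E \<inter> Q) \<le> B0 r^\<delta> \<nu>(Q)\<close>.
      Cancelling \<open>r^\<delta>\<close> bounds \<open>r powr (1 - \<delta>)\<close> by
      \<open>B0\<close> times the average of \<open>R\<close>, hence by
      \<open>B0 * S x\<close>.\<close>
    have pw: "maxop (indicator E) x \<le> epowr (ennreal B0 * S x) (1 / (1 - \<delta>))" for x
    proof (rule maxop_indicator_leI[OF E])
      fix b :: "real^'n" and k :: real assume k: "k > 0" and x: "x \<in> cb b k"
      let ?F = "E \<inter> cb b k"
      define r where "r = vol ?F / k ^ CARD('n)"
      have r: "0 \<le> r" "r \<le> 1" using measure_Int_cb_le[OF E k, of b] k by (auto simp: r_def)
      have dk: "k ^ CARD('n) > 0" using k by simp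
      show "ennreal r \<le> epowr (ennreal B0 * S x) (1 / (1 - \<delta>))"
      proof (cases "r = 0")
        case False
        then have r0: "r > 0" using r by simp
        have "emeasure lebesgue ?F \<le> emeasure \<nu> ?F"
        proof -
          have "emeasure lebesgue ?F = (\<integral>\<^sup>+y. indicator ?F y \<partial>lebesgue)" by simp
          also have "\<dots> \<le> set_nn_integral lebesgue ?F R"
            by (intro nn_integral_mono) (auto simp: RS split: split_indicator)
          also have "\<dots> = emeasure \<nu> ?F" unfolding \<nu>_def by (rule emeasure_density[symmetric]) auto
          finally show ?thesis .
        qed
        then have "vol ?F \<le> measure \<nu> ?F"
          using k by (simp add: emeasure_Int_cb meas_eq[OF k, of ?F b])
        also have "\<dots> \<le> B0 * (vol ?F / vol (cb b k)) powr \<delta>0 * measure \<nu> (cb b k)"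
          by (rule pb[OF low k]) auto
        also have "vol ?F / vol (cb b k) = r"
          using k by (simp add: r_def measure_cb)
        also have "B0 * r powr \<delta>0 * measure \<nu> (cb b k) \<le> B0 * r powr \<delta> * measure \<nu> (cb b k)"
          using B0 r0 r \<delta> by (intro mult_right_mono mult_left_mono powr_mono') auto
        finally have "r * k ^ CARD('n) \<le> B0 * r powr \<delta> * measure \<nu> (cb b k)"
          using k by (simp add: r_def)
        moreover have "r = r powr \<delta> * r powr (1 - \<delta>)" using r0 by (simp flip: powr_add)
        ultimately have "(r powr \<delta> * r powr (1 - \<delta>)) * k ^ CARD('n) \<le> B0 * r powr \<delta> * measure \<nu> (cb b k)"
          by metis
        then have "r powr \<delta> * (r powr (1 - \<delta>) * k ^ CARD('n)) \<le> r powr \<delta> * (B0 * measure \<nu> (cb b k))"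
          by (simp only: mult_ac)
        then have "r powr (1 - \<delta>) * k ^ CARD('n) \<le> B0 * measure \<nu> (cb b k)"
          using r0 by simp
        then have "r powr (1 - \<delta>) \<le> B0 * (measure \<nu> (cb b k) / k ^ CARD('n))"
          using dk by (simp add: pos_le_divide_eq)
        then have "ennreal (r powr (1 - \<delta>)) \<le> ennreal B0 * ennreal (measure \<nu> (cb b k) / k ^ CARD('n))"
          using B0 dk by (simp flip: ennreal_mult add: ennreal_leI)
        also have "ennreal (measure \<nu> (cb b k) / k ^ CARD('n))
            = set_nn_integral lebesgue (cb b k) R / emeasure lebesgue (cb b k)"
        proof -
          have "set_nn_integral lebesgue (cb b k) R = emeasure \<nu> (cb b k)"
            unfolding \<nu>_def by (rule emeasure_density[symmetric]) auto
          then show ?thesis using meas_eq[OF k order_refl, of b] k by (simp add: emeasure_cb divide_ennreal)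
        qed
        also have "ennreal B0 * \<dots> \<le> ennreal B0 * S x" by (intro mult_left_mono S_ge k x) simp
        finally have "epowr (ennreal (r powr (1 - \<delta>))) (1 / (1 - \<delta>)) \<le> epowr (ennreal B0 * S x) (1 / (1 - \<delta>))"
          using \<delta> by (intro epowr_mono) auto
        then show ?thesis using r0 \<delta> by (simp add: powr_powr)
      qed simp
    qed
    have "epowr (maxop (indicator E) x) s \<le> ennreal (B0 powr p) * epowr (S x) p" for x
    proof -
      have "epowr (maxop (indicator E) x) s \<le> epowr (epowr (ennreal B0 * S x) (1 / (1 - \<delta>))) s"
        using s by (intro epowr_mono pw) auto
      also have "\<dots> = epowr (ennreal B0 * S x) p" using \<delta> by (simp add: epowr_epowr s_def)
      also have "\<dots> = ennreal (B0 powr p) * epowr (S x) p" using p B0 by (simp add: epowr_mult)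
      finally show ?thesis .
    qed
    note pw1 = this
    have pw2: "epowr (maxop (indicator E) x) s \<le> ennreal (B0 powr p) *
        (ennreal (2 powr p) * (\<Sum>k. ennreal ((\<theta> powr p) ^ k) * epowr (iter E (Suc k) x) p))" for x
    proof -
      have "epowr (S x) p \<le> ennreal (2 powr p) * (\<Sum>k. ennreal ((\<theta> powr p) ^ k) * epowr (iter E (Suc k) x) p)"
        unfolding S_def \<epsilon>_def using p \<theta> by (intro epowr_suminf_le) auto
      then show ?thesis using pw1[of x] by (meson mult_left_mono order_trans zero_le)
    qed
    let ?I = "\<lambda>k. wint p w (iter E (Suc k))"
    let ?J = "wint p w (maxop (indicator E))"
    have "wint s w (maxop (indicator E))
      \<le> (\<integral>\<^sup>+x. ennreal (B0 powr p) * (ennreal (2 powr p) *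
          (\<Sum>k. ennreal ((\<theta> powr p) ^ k) * (epowr (iter E (Suc k) x) p * ennreal (w x)))) \<partial>lebesgue)"
    proof (rule nn_integral_mono)
      fix x
      have "epowr (maxop (indicator E) x) s * ennreal (w x) \<le> (ennreal (B0 powr p) *
        (ennreal (2 powr p) * (\<Sum>k. ennreal ((\<theta> powr p) ^ k) * epowr (iter E (Suc k) x) p))) * ennreal (w x)"
        by (intro mult_right_mono pw2) simp
      also have "\<dots> = ennreal (B0 powr p) * (ennreal (2 powr p) *
          (\<Sum>k. ennreal ((\<theta> powr p) ^ k) * (epowr (iter E (Suc k) x) p * ennreal (w x))))"
        by (simp only: mult.assoc ennreal_suminf_multc[symmetric])
      finally show "epowr (maxop (indicator E) x) s * ennreal (w x) \<le> ennreal (B0 powr p) * (ennreal (2 powr p) *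
          (\<Sum>k. ennreal ((\<theta> powr p) ^ k) * (epowr (iter E (Suc k) x) p * ennreal (w x))))" .
    qed
    also have "\<dots> = ennreal (B0 powr p) * (ennreal (2 powr p) *
       (\<integral>\<^sup>+x. (\<Sum>k. ennreal ((\<theta> powr p) ^ k) * (epowr (iter E (Suc k) x) p * ennreal (w x))) \<partial>lebesgue))"
    proof -
      have "(\<lambda>x. \<Sum>k. ennreal ((\<theta> powr p) ^ k) * (epowr (iter E (Suc k) x) p * ennreal (w x))) \<in> borel_measurable lebesgue"
        by measurable
      then show ?thesis by (simp add: nn_integral_cmult)
    qed
    also have "(\<integral>\<^sup>+x. (\<Sum>k. ennreal ((\<theta> powr p) ^ k) * (epowr (iter E (Suc k) x) p * ennreal (w x))) \<partial>lebesgue)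
      = (\<Sum>k. \<integral>\<^sup>+x. ennreal ((\<theta> powr p) ^ k) * (epowr (iter E (Suc k) x) p * ennreal (w x)) \<partial>lebesgue)"
      by (rule nn_integral_suminf) measurable
    also have "\<dots> = (\<Sum>k. ennreal ((\<theta> powr p) ^ k) * ?I k)"
      by (intro suminf_cong nn_integral_cmult) measurable
    also have "\<dots> \<le> (\<Sum>k. ennreal ((1/2) ^ k) * ?J)"
    proof (rule suminf_le)
      fix k
      have "ennreal ((\<theta> powr p) ^ k) * ?I k \<le> ennreal ((\<theta> powr p) ^ k) * (ennreal (C ^ k) * ?J)"
        using it[OF h E sub, of k] by (intro mult_left_mono) auto
      also have "\<dots> = ennreal ((\<theta> powr p * C) ^ k) * ?J"
        using C by (simp add: power_mult_distrib ennreal_mult mult.assoc)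
      also have "\<dots> \<le> ennreal ((1/2) ^ k) * ?J"
        using \<theta>C C by (intro mult_right_mono ennreal_leI power_mono) auto
      finally show "ennreal ((\<theta> powr p) ^ k) * ?I k \<le> ennreal ((1/2) ^ k) * ?J" .
    qed auto
    also have "\<dots> = (\<Sum>k. ennreal ((1/2) ^ k)) * ?J" by simp
    also have "(\<Sum>k. ennreal ((1/2) ^ k)) = ennreal (1 / (1 - 1/2))"
      by (intro suminf_ennreal_eq geometric_sums) auto
    finally have "wint s w (maxop (indicator E))
      \<le> ennreal (B0 powr p) * (ennreal (2 powr p) * (ennreal 2 * ?J))"
      by (simp add: mult_left_mono)
    also have "\<dots> = ennreal B * ?J"
    proof -
      have "ennreal B = ennreal (B0 powr p) * (ennreal (2 powr p) * ennreal 2)"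
        unfolding B_def by (simp add: ennreal_mult del: ennreal_numeral)
      then show ?thesis by (simp only: mult.assoc)
    qed
    finally show ?thesis .
  qed
  show ?thesis
  proof (rule exI[of _ s], rule exI[of _ B], intro conjI allI impI)
    fix E :: "(real^'n) set" and a h assume E: "h > 0" "E \<in> sets lebesgue" "E \<subseteq> cb a h"
    show "wint p w (maxop (indicator E)) < top"
      using it[OF E] by (rule conjunct1)
    show "wint s w (maxop (indicator E))
       \<le> ennreal B * wint p w (maxop (indicator E))"
      by (rule main[OF E])
  qed (use s \<open>B > 0\<close> in auto)
qed

end

section \<open>Superlevel sets and shrunken cubes\<close>

lemma less_maxop_indicator:
  fixes E :: "(real^'n) set"
  assumes "E \<in> sets lebesgue" "0 \<le> t" "ennreal t < maxop (indicator E) x"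
  shows "\<exists>b k. k > 0 \<and> x \<in> cb b k \<and> t * k ^ CARD('n) < vol (E \<inter> cb b k)"
proof (rule ccontr)
  assume n: "\<not> ?thesis"
  have "maxop (indicator E) x \<le> ennreal t"
  proof (rule maxop_indicator_leI[OF assms(1)], rule ennreal_leI)
    fix b :: "real^'n" and k :: real assume "k > 0" "x \<in> cb b k"
    then show "vol (E \<inter> cb b k) / k ^ CARD('n) \<le> t"
      using n by (force simp: pos_divide_le_eq not_less)
  qed
  then show False using assms(3) by simp
qed

text \<open>The concentric cube of side \<open>h / L\<close> carries a comparable maximal function, while its own
  superlevel set stays inside the original cube.\<close>

definition shrink :: "real \<Rightarrow> real^'n \<Rightarrow> real \<Rightarrow> (real^'n) set" where
  "shrink L a h = cb (a + ((h - h / L) / 2) *\<^sub>R One) (h / L)"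

lemma mem_shrink: "x \<in> shrink L a h \<longleftrightarrow>
    (\<forall>i. a $ i + (h - h / L) / 2 \<le> x $ i \<and> x $ i \<le> a $ i + (h - h / L) / 2 + h / L)"
  unfolding shrink_def mem_cb
  by (simp only: vector_add_component vector_scaleR_component One_nth) simp

text \<open>A cube of side \<open>k\<close> in which the shrunken cube has density above
  \<open>t\<close> satisfies \<open>t * k < h / L\<close>. The value of \<open>L\<close> is the one
  for which \<open>h / (L * t)\<close> equals the margin \<open>(h - h / L) / 2\<close>, so such a
  cube cannot leave the original one.\<close>

lemma superlevel_shrink:
  fixes a :: "real^'n"
  assumes h: "h > 0" and t: "0 < t" "t < 1" and L: "L = 1 + 2 / t"
  shows "{x. ennreal t < maxop (indicator (shrink L a h)) x} \<subseteq> cb a h"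
proof
  fix x assume "x \<in> {x. ennreal t < maxop (indicator (shrink L a h)) x}"
  then obtain b k where k: "k > 0" "x \<in> cb b k" "t * k ^ CARD('n) < vol (shrink L a h \<inter> cb b k)"
    using less_maxop_indicator[of "shrink L a h" t x] t by (auto simp: shrink_def)
  have L0: "L > 0" using t by (simp add: L add_pos_pos)
  have "(t * k) ^ CARD('n) = t ^ CARD('n) * k ^ CARD('n)" by (simp add: power_mult_distrib)
  also have "\<dots> \<le> t * k ^ CARD('n)"
    using t k power_decreasing[of 1 "CARD('n)" t] by (intro mult_right_mono) (auto simp: Suc_leI)
  also have "\<dots> < vol (cb b k \<inter> shrink L a h)" using k by (simp add: Int_commute)
  also have "\<dots> \<le> (h / L) ^ CARD('n)"
    unfolding shrink_def using h L0 by (intro measure_Int_cb_le) auto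
  finally have "t * k < h / L" using h L0 by (auto dest: power_less_imp_less_base)
  then have "k < h / L / t" using t by (simp only: pos_less_divide_eq mult.commute)
  also have "h / L / t = (h - h / L) / 2"
  proof -
    have "h - h / L = h * (L - 1) / L" using L0 by (simp add: field_simps)
    also have "L - 1 = 2 / t" by (simp add: L)
    finally show ?thesis by (simp add: mult.commute)
  qed
  finally have kh: "k < (h - h / L) / 2" .
  have "shrink L a h \<inter> cb b k \<noteq> {}"
  proof
    assume "shrink L a h \<inter> cb b k = {}"
    moreover have "0 \<le> t * k ^ CARD('n)" using t k by simp
    ultimately show False using k(3) by simp
  qed
  then obtain z where z: "z \<in> shrink L a h" "z \<in> cb b k" by blast
  show "x \<in> cb a h"
    unfolding mem_cb
  proof
    fix i
    show "a $ i \<le> x $ i \<and> x $ i \<le> a $ i + h"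
      using z(1)[unfolded mem_shrink, rule_format, of i] z(2)[unfolded mem_cb, rule_format, of i]
        k(2)[unfolded mem_cb, rule_format, of i] kh by (auto simp: field_simps)
  qed
qed

text \<open>If the test cube meets \<open>cb a h\<close>, some cube of side \<open>h + k\<close>
  contains both and serves as test cube for the shrunken one. The density \<open>r\<close> is at
  most \<open>(2 * h / (h + k))^n\<close>, through density at most 1 if \<open>k \<le> h\<close> and
  through \<open>(h / k)^n\<close> otherwise.\<close>

lemma maxop_shrink:
  fixes a :: "real^'n"
  assumes h: "h > 0" and L: "L \<ge> 1"
  shows "maxop (indicator (cb a h)) x \<le> ennreal ((2 * L) ^ CARD('n)) * maxop (indicator (shrink L a h)) x"
proof (rule maxop_indicator_leI)
  fix b :: "real^'n" and k :: real assume k: "k > 0" and x: "x \<in> cb b k"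
  define r where "r = vol (cb a h \<inter> cb b k) / k ^ CARD('n)"
  show "ennreal r \<le> ennreal ((2 * L) ^ CARD('n)) * maxop (indicator (shrink L a h)) x"
  proof (cases "cb a h \<inter> cb b k = {}")
    case False
    then obtain z where z: "z \<in> cb a h" "z \<in> cb b k" by blast
    define c where "c = (\<chi> i. min (a $ i) (b $ i))"
    have sub: "cb a h \<subseteq> cb c (h + k)" "cb b k \<subseteq> cb c (h + k)"
    proof -
      have "y \<in> cb c (h + k)" if "y \<in> cb a h \<or> y \<in> cb b k" for y
        unfolding mem_cb
      proof
        fix i
        have zi: "a $ i \<le> z $ i" "z $ i \<le> a $ i + h" "b $ i \<le> z $ i" "z $ i \<le> b $ i + k"
          using z by (auto simp: mem_cb)
        have "a $ i \<le> y $ i \<and> y $ i \<le> a $ i + h \<or> b $ i \<le> y $ i \<and> y $ i \<le> b $ i + k"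
          using that by (auto simp: mem_cb)
        then show "c $ i \<le> y $ i \<and> y $ i \<le> c $ i + (h + k)"
          using zi by (auto simp: c_def min_def)
      qed
      then show "cb a h \<subseteq> cb c (h + k)" "cb b k \<subseteq> cb c (h + k)" by blast+
    qed
    have ss: "shrink L a h \<subseteq> cb a h"
    proof
      fix y assume y: "y \<in> shrink L a h"
      have hl: "h / L \<le> h" using h L by (simp add: field_simps)
      show "y \<in> cb a h"
        unfolding mem_cb
      proof
        fix i show "a $ i \<le> y $ i \<and> y $ i \<le> a $ i + h"
          using y[unfolded mem_shrink, rule_format, of i] hl by (auto simp: field_simps)
      qed
    qed
    have "shrink L a h \<inter> cb c (h + k) = shrink L a h" using ss sub(1) by blast
    then have m: "vol (shrink L a h \<inter> cb c (h + k)) = (h / L) ^ CARD('n)"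
      using h L by (simp add: shrink_def measure_cb)
    have ge: "ennreal ((h / L) ^ CARD('n) / (h + k) ^ CARD('n)) \<le> maxop (indicator (shrink L a h)) x"
      using maxop_indicator_ge[of "shrink L a h" "h + k" x c] h k x sub(2) m by (auto simp: shrink_def)
    have "r \<le> (2 * h / (h + k)) ^ CARD('n)"
    proof (cases "k \<le> h")
      case True
      have "r \<le> 1" using measure_Int_cb_le[OF cb_lebesgue k, of a h b] k by (simp add: r_def)
      also have "1 \<le> (2 * h / (h + k)) ^ CARD('n)" using True h k by (intro one_le_power) simp
      finally show ?thesis .
    next
      case False
      have "vol (cb b k \<inter> cb a h) \<le> h ^ CARD('n)"
        by (rule measure_Int_cb_le[OF cb_lebesgue h])
      then have "r \<le> (h / k) ^ CARD('n)"
        using k by (simp add: r_def divide_right_mono Int_commute power_divide)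
      also have "\<dots> \<le> (2 * h / (h + k)) ^ CARD('n)"
        using False h k by (intro power_mono) (auto simp: field_simps)
      finally show ?thesis .
    qed
    also have "\<dots> = (2 * L) ^ CARD('n) * ((h / L) ^ CARD('n) / (h + k) ^ CARD('n))"
      using L by (simp add: power_divide power_mult_distrib)
    finally have "ennreal r \<le> ennreal ((2 * L) ^ CARD('n)) * ennreal ((h / L) ^ CARD('n) / (h + k) ^ CARD('n))"
      using L h k by (simp flip: ennreal_mult add: ennreal_leI)
    also have "\<dots> \<le> ennreal ((2 * L) ^ CARD('n)) * maxop (indicator (shrink L a h)) x"
      by (intro mult_left_mono ge) simp
    finally show ?thesis .
  qed (simp add: r_def)
qed simp

section \<open>Absorbing small values, and removing the tail for cubes\<close>

context Wp_weight
begin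

text \<open>Where the maximal function is at most \<open>t\<close>, its p-th power is at most
  \<open>t powr (p - s)\<close> times its s-th power, and \<open>t\<close> is chosen to make this at
  most half after multiplication by \<open>C\<close>. Where it exceeds \<open>t\<close>, its p-th
  power is at most 1.\<close>

lemma superlevel_bound:
  "\<exists>s C t. 0 < s \<and> s < p \<and> C > 0 \<and> 0 < t \<and> t < 1 \<and> (\<forall>E a h. h > 0 \<longrightarrow> E \<in> sets lebesgue \<longrightarrow> E \<subseteq> cb a h \<longrightarrow>
     wint s w (maxop (indicator E))
       \<le> ennreal C * emeasure (wmeasure w) {x. ennreal t < maxop (indicator E) x})"
proof -
  obtain s C where s: "0 < s" "s < p" "C > 0" and le: "\<And>E a h. h > 0 \<Longrightarrow> E \<in> sets lebesgue \<Longrightarrow> E \<subseteq> cb a h \<Longrightarrow>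
     wint p w (maxop (indicator E)) < top \<and>
     wint s w (maxop (indicator E))
       \<le> ennreal C * wint p w (maxop (indicator E))"
    using lower_exponent by blast
  define t where "t = min (1/2) ((1 / (2 * C)) powr (1 / (p - s)))"
  have t: "0 < t" "t < 1" using s by (auto simp: t_def)
  have "t powr (p - s) \<le> ((1 / (2 * C)) powr (1 / (p - s))) powr (p - s)"
    using s by (intro powr_mono2) (auto simp: t_def)
  also have "\<dots> = 1 / (2 * C)" using s by (simp add: powr_powr)
  finally have tC: "C * t powr (p - s) \<le> 1/2" using s by (simp add: field_simps)
  have main: "wint s w (maxop (indicator E))
       \<le> ennreal (2 * C) * emeasure (wmeasure w) {x. ennreal t < maxop (indicator E) x}"
    if h: "h > 0" and E: "E \<in> sets lebesgue" and sub: "E \<subseteq> cb a h" for E a h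
  proof -
    let ?m = "maxop (indicator E)"
    let ?S = "{x. ennreal t < ?m x}"
    let ?X = "wint s w ?m"
    let ?A = "emeasure (wmeasure w) ?S"
    have S: "?S \<in> sets lebesgue" using open_maxop by (rule open_lebesgue)
    have pw: "ennreal C * epowr (?m x) p \<le> ennreal C * indicator ?S x + ennreal (1/2) * epowr (?m x) s" for x
    proof -
      have "?m x \<le> 1" by (intro maxop_le) (auto split: split_indicator)
      then obtain r where r: "?m x = ennreal r" "0 \<le> r" "r \<le> 1" by (cases "?m x") (auto simp: ennreal_le_1 top_unique)
      show ?thesis
      proof (cases "t < r")
        case True
        have "r powr p \<le> 1" using r p powr_mono2[of p r 1] by simp
        then have "C * r powr p \<le> C * 1" using s by (intro mult_left_mono) auto
        then have "ennreal (C * r powr p) \<le> ennreal C" by (simp add: ennreal_leI)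
        then have "ennreal C * epowr (?m x) p \<le> ennreal C * indicator ?S x"
          using True r s t by (simp add: ennreal_less_iff ennreal_mult)
        then show ?thesis by (rule order_trans) simp
      next
        case False
        have "r powr p = r powr (p - s) * r powr s" by (simp flip: powr_add)
        then have "C * r powr p = C * r powr (p - s) * r powr s" by simp
        also have "\<dots> \<le> C * t powr (p - s) * r powr s"
          using False r s by (intro mult_right_mono mult_left_mono powr_mono2) auto
        also have "\<dots> \<le> 1/2 * r powr s" by (rule mult_right_mono[OF tC]) simp
        finally have "ennreal (C * r powr p) \<le> ennreal (1/2 * r powr s)" by (rule ennreal_leI)
        then have "ennreal C * epowr (?m x) p \<le> ennreal (1/2) * epowr (?m x) s"
          unfolding r(1) epowr_ennreal[OF r(2)] using s by (simp only: ennreal_mult less_imp_le powr_ge_zero divide_nonneg_nonneg zero_le_one zero_le_numeral)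
        then show ?thesis by (rule order_trans) simp
      qed
    qed
    have "?X \<le> ennreal C * wint p w ?m"
      using le[OF h E sub] by blast
    also have "\<dots> = (\<integral>\<^sup>+x. ennreal C * epowr (?m x) p * ennreal (w x) \<partial>lebesgue)"
      by (subst nn_integral_cmult[symmetric]) (auto simp: mult.assoc)
    also have "\<dots> \<le> (\<integral>\<^sup>+x. (ennreal C * indicator ?S x + ennreal (1/2) * epowr (?m x) s) * ennreal (w x) \<partial>lebesgue)"
      by (intro nn_integral_mono mult_right_mono pw) simp
    also have "\<dots> = (\<integral>\<^sup>+x. ennreal C * (ennreal (w x) * indicator ?S x) + ennreal (1/2) * (epowr (?m x) s * ennreal (w x)) \<partial>lebesgue)"
      by (intro nn_integral_cong) (simp only: distrib_right mult.assoc mult.commute[of "indicator _ _"])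
    also have "\<dots> = ennreal C * ?A + ennreal (1/2) * ?X"
      using S by (subst nn_integral_add) (auto simp: nn_integral_cmult emeasure_wmeasure)
    finally have X: "?X \<le> ennreal C * ?A + ennreal (1/2) * ?X" .
    \<comment> \<open>Subtracting half of \<open>?X\<close> is legitimate only if \<open>?X\<close>
      is finite, which the finite integral with exponent \<open>p\<close> guarantees.\<close>
    have "ennreal C * wint p w ?m < top"
      using le[OF h E sub] by (simp add: ennreal_mult_less_top)
    then have "?X < top" using le[OF h E sub] by (meson le_less_trans)
    then obtain X where Xr: "?X = ennreal X" "X \<ge> 0" by (cases ?X) auto
    show ?thesis
    proof (cases ?A)
      case (real A)
      have "0 \<le> C" "0 \<le> (1/2::real)" using s by auto
      then have "ennreal (C * A + 1/2 * X) = ennreal C * ennreal A + ennreal (1/2) * ennreal X"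
        using real(1) Xr(2) by (simp only: ennreal_plus ennreal_mult mult_nonneg_nonneg)
      then have "ennreal X \<le> ennreal (C * A + 1/2 * X)" using X unfolding Xr(1) real(2) by (simp only:)
      then have "X \<le> C * A + 1/2 * X" using s real Xr by (subst (asm) ennreal_le_iff) auto
      then have "ennreal X \<le> ennreal (2 * C * A)" by (intro ennreal_leI) simp
      then show ?thesis using real s Xr by (simp add: ennreal_mult)
    next
      case top
      then show ?thesis using s by (simp add: ennreal_mult_top)
    qed
  qed
  show ?thesis
  proof (rule exI[of _ s], rule exI[of _ "2 * C"], rule exI[of _ t], intro conjI allI impI)
    fix E :: "(real^'n) set" and a h assume "h > 0" "E \<in> sets lebesgue" "E \<subseteq> cb a h"
    then show "wint s w (maxop (indicator E))
       \<le> ennreal (2 * C) * emeasure (wmeasure w) {x. ennreal t < maxop (indicator E) x}"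
      by (rule main)
  qed (use s t in auto)
qed

lemma epowr_mono_exp:
  assumes "x \<le> 1" "0 < s" "s \<le> r" shows "epowr x r \<le> epowr x s"
proof -
  obtain y where "x = ennreal y" "0 \<le> y" "y \<le> 1" using assms(1) by (cases x) (auto simp: ennreal_le_1 top_unique)
  then show ?thesis using assms by (auto intro!: ennreal_leI powr_mono')
qed

text \<open>The superlevel estimate is applied to the shrunken cube, whose superlevel set does not
  leave the original cube, while its maximal function still controls that of the original. This is
  what replaces the tail in \<open>C_p\<close> by w(Q).\<close>

lemma local_bound:
  "\<exists>C>0. \<forall>a h. h > 0 \<longrightarrow>
     wint p w (maxop (indicator (cb a h)))
       \<le> ennreal C * emeasure (wmeasure w) (cb a h)"
proof -
  obtain s C t where s: "0 < s" "s < p" "C > 0" and t: "0 < t" "t < 1"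
    and le: "\<And>E a h. h > 0 \<Longrightarrow> E \<in> sets lebesgue \<Longrightarrow> E \<subseteq> cb a h \<Longrightarrow>
     wint s w (maxop (indicator E))
       \<le> ennreal C * emeasure (wmeasure w) {x. ennreal t < maxop (indicator E) x}"
    using superlevel_bound by blast
  define L where "L = 1 + 2 / t"
  have L: "L \<ge> 1" using t by (simp add: L_def)
  define B where "B = ((2 * L) ^ CARD('n)) powr p"
  have B: "B > 0" using L by (simp add: B_def)
  have main: "wint p w (maxop (indicator (cb a h)))
       \<le> ennreal (B * C) * emeasure (wmeasure w) (cb a h)" if h: "h > 0" for a h
  proof -
    let ?m = "maxop (indicator (shrink L a h))"
    have pw: "epowr (maxop (indicator (cb a h)) x) p \<le> ennreal B * epowr (?m x) s" for x
    proof -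
      have "epowr (maxop (indicator (cb a h)) x) p \<le> epowr (ennreal ((2 * L) ^ CARD('n)) * ?m x) p"
        using p by (intro epowr_mono maxop_shrink h L) auto
      also have "\<dots> = ennreal B * epowr (?m x) p"
        using p L by (simp add: epowr_mult B_def)
      also have "epowr (?m x) p \<le> epowr (?m x) s"
        using s by (intro epowr_mono_exp maxop_le) (auto split: split_indicator)
      finally show ?thesis by (simp add: mult_left_mono)
    qed
    have "wint p w (maxop (indicator (cb a h)))
      \<le> (\<integral>\<^sup>+x. ennreal B * (epowr (?m x) s * ennreal (w x)) \<partial>lebesgue)"
      using mult_right_mono[OF pw] by (intro nn_integral_mono) (simp add: mult.assoc)
    also have "\<dots> = ennreal B * wint s w ?m"
      by (rule nn_integral_cmult) measurable
    also have "\<dots> \<le> ennreal B * (ennreal C * emeasure (wmeasure w) {x. ennreal t < ?m x})"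
      by (intro mult_left_mono le[of "h / L" _ "a + ((h - h / L) / 2) *\<^sub>R One"]) (use h L in \<open>auto simp: shrink_def\<close>)
    also have "\<dots> \<le> ennreal B * (ennreal C * emeasure (wmeasure w) (cb a h))"
      using superlevel_shrink[OF h t L_def] by (intro mult_left_mono emeasure_mono) auto
    also have "\<dots> = ennreal (B * C) * emeasure (wmeasure w) (cb a h)"
      using B s by (simp add: ennreal_mult mult.assoc)
    finally show ?thesis .
  qed
  show ?thesis by (rule exI[of _ "B * C"]) (use B s main in auto)
qed

end

subsection \<open>From \<open>W\<^sub>p\<close> and \<open>C\<^sub>p\<close> to \<open>A\<^sub>p\<close>\<close>

text \<open>The dual weight is summed over the dyadic level sets \<open>E k\<close> of
  \<open>w\<close> below its average \<open>W\<close>. Passing to the next level raises the bound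
  for the dual weight by \<open>\<kappa>\<close> and shrinks the volume bound by
  \<open>\<gamma>\<close>, so all depends on \<open>\<kappa> * \<gamma> < 1\<close>.\<close>

lemma lower_imp_Ap:
  fixes w :: "real^'n \<Rightarrow> real"
  assumes p: "p > 1" and w: "weight w" and s: "1 < s" "s < p" and low: "cube_lower (wmeasure w) C s"
  shows "Ap_class p w"
proof -
  interpret cube_lower "wmeasure w" C s by (rule low)
  have wm [measurable]: "w \<in> borel_measurable lebesgue" by (rule weight_measurable[OF w])
  have dm [measurable]: "dualw p w \<in> borel_measurable lebesgue"
    unfolding dualw_def[abs_def] by measurable
  note C1 = C_ge_1
  define r where "r = 1 / (p - 1)"
  have r: "r > 0" using p by (simp add: r_def)
  define \<kappa> where "\<kappa> = (2::real) powr r"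
  define \<gamma> where "\<gamma> = (1/2::real) powr (1 / (s - 1))"
  define G where "G = C powr (1 / (s - 1))"
  have pos: "\<kappa> > 0" "\<gamma> > 0" "G > 0" using C1 by (auto simp: \<kappa>_def \<gamma>_def G_def)
  \<comment> \<open>This is where s < p is used: the product is 2 to the power 1/(p-1) -
    1/(s-1).\<close>
  have \<kappa>\<gamma>: "\<kappa> * \<gamma> < 1"
  proof -
    have "\<kappa> * \<gamma> = 2 powr (r - 1 / (s - 1))"
      by (simp add: \<kappa>_def \<gamma>_def powr_divide powr_diff)
    also have "1 / (p - 1) < 1 / (s - 1)" using s by (intro divide_strict_left_mono) auto
    then have "r - 1 / (s - 1) < 0" by (simp add: r_def)
    then have "2 powr (r - 1 / (s - 1)) < (2::real) powr 0" by (intro powr_less_mono) auto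
    finally show ?thesis by simp
  qed
  define T where "T = 1 + \<kappa> * G * (1 / (1 - \<kappa> * \<gamma>))"
  have T: "T > 0" using pos \<kappa>\<gamma> by (simp add: T_def add_pos_pos)
  have "avg Q (\<lambda>y. ennreal (w y)) * epowr (avg Q (dualw p w)) (p - 1) \<le> ennreal (T powr (p - 1))"
    if "cube Q" for Q :: "(real^'n) set"
  proof -
    obtain a h where h: "h > 0" and Q: "Q = cb a h" using \<open>cube Q\<close> by (auto simp: cube_iff)
    define d where "d = h ^ CARD('n)"
    have d: "d > 0" using h by (simp add: d_def)
    define W where "W = measure (wmeasure w) Q / d"
    have W: "W > 0" using nu_pos[OF h, of a] d by (simp add: W_def Q)
    have lowE: "(vol E / d) powr s * (W * d) \<le> C * measure (wmeasure w) E"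
      if "E \<in> sets lebesgue" "E \<subseteq> Q" for E
      using lower[OF h that[unfolded Q]] h by (simp add: W_def Q d_def)
    define E where "E k = {x \<in> Q. w x \<le> W / 2 ^ k}" for k :: nat
    have E [measurable]: "E k \<in> sets lebesgue" for k
    proof -
      have "{x \<in> space lebesgue. w x \<le> W / 2 ^ k} \<in> sets lebesgue" by measurable
      moreover have "E k = Q \<inter> {x \<in> space lebesgue. w x \<le> W / 2 ^ k}" by (auto simp: E_def)
      ultimately show ?thesis by (simp add: Q)
    qed
    have EQ: "E k \<subseteq> Q" for k by (auto simp: E_def)
    have eE: "emeasure lebesgue S = ennreal (vol S)" if "S \<subseteq> Q" for S
      using cube_doubling.emeasure_eq[OF cube_doubling_lebesgue h that[unfolded Q]] .
    \<comment> \<open>\<open>lower\<close> for \<open>E k\<close> meets the trivial upper bound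
      \<open>w \<le> W / 2 ^ k\<close> on that set. Cancelling one factor \<open>\<rho>\<close>
      leaves \<open>\<rho> powr (s - 1) \<le> C / 2 ^ k\<close>, and s > 1 allows the root to be
      taken.\<close>
    have small: "vol (E k) \<le> d * (G * \<gamma> ^ k)" for k
    proof -
      define \<rho> where "\<rho> = vol (E k) / d"
      have \<rho>0: "\<rho> \<ge> 0" using d by (simp add: \<rho>_def)
      have "\<rho> \<le> G * \<gamma> ^ k"
      proof (cases "\<rho> = 0")
        case False
        with \<rho>0 have \<rho>: "\<rho> > 0" by simp
        have "ennreal (measure (wmeasure w) (E k)) = emeasure (wmeasure w) (E k)"
          using meas_eq[OF h EQ[unfolded Q]] by simp
        also have "\<dots> \<le> (\<integral>\<^sup>+x. ennreal (W / 2 ^ k) * indicator (E k) x \<partial>lebesgue)"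
          unfolding emeasure_wmeasure[OF wm E]
          by (intro nn_integral_mono) (auto simp: E_def intro!: ennreal_leI split: split_indicator)
        also have "\<dots> = ennreal (W / 2 ^ k * (\<rho> * d))"
          using W d \<rho> by (simp add: nn_integral_cmult_indicator eE[OF EQ] \<rho>_def flip: ennreal_mult)
        finally have "measure (wmeasure w) (E k) \<le> W / 2 ^ k * (\<rho> * d)"
          using W d \<rho> by (subst (asm) ennreal_le_iff) auto
        then have "C * measure (wmeasure w) (E k) \<le> C * (W / 2 ^ k * (\<rho> * d))"
          using C1 by (intro mult_left_mono) auto
        with lowE[OF E EQ, of k] have "\<rho> powr s * (W * d) \<le> C * (W / 2 ^ k * (\<rho> * d))"
          unfolding \<rho>_def by linarith
        then have "\<rho> powr s \<le> C / 2 ^ k * \<rho>"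
          using W d by (simp add: field_simps)
        moreover have "\<rho> powr s = \<rho> powr (s - 1) * \<rho>" using \<rho> by (simp add: powr_diff)
        ultimately have "\<rho> powr (s - 1) * \<rho> \<le> C / 2 ^ k * \<rho>" by (simp only:)
        then have "\<rho> powr (s - 1) \<le> C / 2 ^ k" using \<rho> by (rule mult_right_le_imp_le)
        then have "(\<rho> powr (s - 1)) powr (1 / (s - 1)) \<le> (C / 2 ^ k) powr (1 / (s - 1))"
          using s by (intro powr_mono2) auto
        also have "\<dots> = G * \<gamma> ^ k"
          using C1 by (simp add: G_def \<gamma>_def powr_divide powr_powr mult.commute power_divide flip: powr_realpow)
        finally show ?thesis using s \<rho> by (simp add: powr_powr)
      qed (use pos in simp)
      then show ?thesis using d by (simp add: \<rho>_def field_simps)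
    qed
    \<comment> \<open>Where \<open>w\<close> vanishes \<open>dualw\<close> is infinite. The zero set
      has no mass, so \<open>lower\<close> makes it a Lebesgue null set.\<close>
    have null: "AE x in lebesgue. x \<in> Q \<longrightarrow> w x \<noteq> 0"
    proof -
      define Z where "Z = {x \<in> Q. w x = 0}"
      have "{x \<in> space lebesgue. w x = 0} \<in> sets lebesgue" by measurable
      moreover have "Z = Q \<inter> {x \<in> space lebesgue. w x = 0}" by (auto simp: Z_def)
      ultimately have Z: "Z \<in> sets lebesgue" "Z \<subseteq> Q" by (auto simp: Q)
      have "emeasure (wmeasure w) Z = (\<integral>\<^sup>+x. 0 \<partial>(lebesgue :: (real^'n) measure))"
        unfolding emeasure_wmeasure[OF wm Z(1)]
        by (intro nn_integral_cong) (auto simp: Z_def split: split_indicator)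
      then have "measure (wmeasure w) Z = 0" by (simp add: measure_def)
      then have "(vol Z / d) powr s * (W * d) \<le> 0" using lowE[OF Z] by simp
      then have "(vol Z / d) powr s = 0"
        using W d by (simp add: mult_le_0_iff)
      then have "vol Z = 0" using d by simp
      then have "Z \<in> null_sets lebesgue" using eE[OF Z(2)] Z(1) by (intro null_setsI) auto
      then have "AE x in lebesgue. x \<notin> Z" by (rule AE_not_in)
      then show ?thesis by eventually_elim (auto simp: Z_def)
    qed
    have pw: "dualw p w x \<le> ennreal (W powr (- r)) * (1 + (\<Sum>k. ennreal (\<kappa> ^ Suc k) * indicator (E k) x))"
      if x: "x \<in> Q" "w x \<noteq> 0" for x
    proof -
      have wx: "w x > 0" using x weight_nonneg[OF w, of x] by simp
      have dx: "dualw p w x = ennreal (w x powr (- r))" using x by (simp add: dualw_def r_def)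
      show ?thesis
      proof (cases "W < w x")
        case True
        then have "w x powr (- r) \<le> W powr (- r)" using r W by (intro powr_mono2') auto
        then have "dualw p w x \<le> ennreal (W powr (- r)) * 1" by (simp add: dx ennreal_leI)
        also have "\<dots> \<le> ennreal (W powr (- r)) * (1 + (\<Sum>k. ennreal (\<kappa> ^ Suc k) * indicator (E k) x))"
          by (intro mult_left_mono) auto
        finally show ?thesis .
      next
        case False
        \<comment> \<open>The aim is the \<open>k\<close> with
          \<open>W / 2 ^ Suc k < w x \<le> W / 2 ^ k\<close>; the k-th term of the series alone then
          dominates \<open>dualw p w x\<close>.\<close>
        obtain N0 where "(1/2::real) ^ N0 < w x / W"
          using real_arch_pow_inv[of "w x / W" "1/2"] wx W by auto
        then have N0: "W / 2 ^ N0 < w x" using W by (simp add: field_simps)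
        define N where "N = (LEAST N. W / 2 ^ N < w x)"
        have N: "W / 2 ^ N < w x" unfolding N_def using N0 by (rule LeastI)
        have "N \<noteq> 0" using N False by (intro notI) simp
        then obtain k where k: "N = Suc k" by (cases N) auto
        have "\<not> W / 2 ^ k < w x" using not_less_Least[of k "\<lambda>N. W / 2 ^ N < w x"] k by (simp add: N_def)
        then have xk: "x \<in> E k" using x by (simp add: E_def)
        have "w x powr (- r) \<le> (W / 2 ^ Suc k) powr (- r)"
          using N r W unfolding k by (intro powr_mono2') auto
        also have "\<dots> = W powr (- r) * \<kappa> ^ Suc k"
          using W unfolding \<kappa>_def
          by (simp add: powr_divide powr_powr powr_minus mult.commute divide_simps flip: powr_realpow power_Suc)
        finally have "dualw p w x \<le> ennreal (W powr (- r)) * (ennreal (\<kappa> ^ Suc k) * indicator (E k) x)"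
          using pos xk by (simp add: dx ennreal_leI flip: ennreal_mult)
        also have "ennreal (\<kappa> ^ Suc k) * indicator (E k) x = (\<Sum>j\<in>{k}. ennreal (\<kappa> ^ Suc j) * indicator (E j) x)"
          by (simp only: sum.insert finite.emptyI empty_iff not_False_eq_True sum.empty add_0_right)
        also have "\<dots> \<le> (\<Sum>k. ennreal (\<kappa> ^ Suc k) * indicator (E k) x)" by (rule sum_le_suminf) auto
        also have "\<dots> \<le> 1 + (\<Sum>k. ennreal (\<kappa> ^ Suc k) * indicator (E k) x)" by simp
        finally show ?thesis by (simp add: mult_left_mono)
      qed
    qed
    have "(\<integral>\<^sup>+x. dualw p w x * indicator Q x \<partial>lebesgue) \<le>
      (\<integral>\<^sup>+x. ennreal (W powr (- r)) * (indicator Q x + (\<Sum>k. ennreal (\<kappa> ^ Suc k) * indicator (E k) x)) \<partial>lebesgue)"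
    proof (rule nn_integral_mono_AE)
      show "AE x in lebesgue. dualw p w x * indicator Q x \<le>
        ennreal (W powr (- r)) * (indicator Q x + (\<Sum>k. ennreal (\<kappa> ^ Suc k) * indicator (E k) x))"
        using null by eventually_elim (use pw in \<open>auto split: split_indicator\<close>)
    qed
    also have "\<dots> = ennreal (W powr (- r)) * (emeasure lebesgue Q + (\<integral>\<^sup>+x. (\<Sum>k. ennreal (\<kappa> ^ Suc k) * indicator (E k) x) \<partial>lebesgue))"
      by (subst nn_integral_cmult) (auto simp: nn_integral_add Q)
    also have "(\<integral>\<^sup>+x. (\<Sum>k. ennreal (\<kappa> ^ Suc k) * indicator (E k) x) \<partial>lebesgue)
        = (\<Sum>k. \<integral>\<^sup>+x. ennreal (\<kappa> ^ Suc k) * indicator (E k) x \<partial>lebesgue)"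
      by (rule nn_integral_suminf) measurable
    also have "\<dots> = (\<Sum>k. ennreal (\<kappa> ^ Suc k) * ennreal (vol (E k)))"
      by (intro suminf_cong) (simp add: nn_integral_cmult_indicator eE[OF EQ])
    also have "\<dots> \<le> (\<Sum>k. ennreal (\<kappa> * G * d * (\<kappa> * \<gamma>) ^ k))"
    proof (rule suminf_le)
      fix k
      have "\<kappa> ^ Suc k * vol (E k) \<le> \<kappa> ^ Suc k * (d * (G * \<gamma> ^ k))"
        using pos by (intro mult_left_mono small) auto
      also have "\<dots> = \<kappa> * G * d * (\<kappa> * \<gamma>) ^ k" by (simp add: power_mult_distrib mult_ac)
      finally show "ennreal (\<kappa> ^ Suc k) * ennreal (vol (E k)) \<le> ennreal (\<kappa> * G * d * (\<kappa> * \<gamma>) ^ k)"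
        using pos by (subst ennreal_mult[symmetric]) (auto intro: ennreal_leI)
    qed auto
    also have "\<dots> = ennreal (\<kappa> * G * d * (1 / (1 - \<kappa> * \<gamma>)))"
      using pos d \<kappa>\<gamma> by (intro suminf_ennreal_eq sums_mult geometric_sums) auto
    also have "emeasure lebesgue Q = ennreal d" using h by (simp add: Q emeasure_cb d_def)
    also have "ennreal d + ennreal (\<kappa> * G * d * (1 / (1 - \<kappa> * \<gamma>))) = ennreal (d * T)"
      using d pos \<kappa>\<gamma> by (simp add: T_def algebra_simps flip: ennreal_plus)
    also have "ennreal (W powr (- r)) * ennreal (d * T) = ennreal (W powr (- r) * (d * T))"
      using d T by (simp add: ennreal_mult)
    finally have int: "(\<integral>\<^sup>+x. dualw p w x * indicator Q x \<partial>lebesgue) \<le> ennreal (W powr (- r) * (d * T))"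
      by (simp add: mult_left_mono add_left_mono)
    have "avg Q (dualw p w) \<le> ennreal (W powr (- r) * (d * T)) / ennreal d"
      unfolding avg_def using int h by (simp add: Q emeasure_cb d_def divide_right_mono_ennreal)
    also have "\<dots> = ennreal (W powr (- r) * T)" using d T by (simp add: divide_ennreal)
    finally have "epowr (avg Q (dualw p w)) (p - 1) \<le> epowr (ennreal (W powr (- r) * T)) (p - 1)"
      using p by (intro epowr_mono) auto
    also have "\<dots> = ennreal (T powr (p - 1) / W)"
    proof -
      have "- r * (p - 1) = - 1" using p by (simp add: r_def)
      then have "(W powr (- r) * T) powr (p - 1) = W powr (- 1) * T powr (p - 1)"
        using W T by (simp add: powr_mult powr_powr)
      then show ?thesis using W T by (simp add: powr_minus_divide)
    qed
    finally have "ennreal W * epowr (avg Q (dualw p w)) (p - 1) \<le> ennreal W * ennreal (T powr (p - 1) / W)"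
      by (rule mult_left_mono) simp
    also have "\<dots> = ennreal (T powr (p - 1))" using W by (simp flip: ennreal_mult)
    finally show ?thesis using avg_weight[OF w h, of a] by (simp add: W_def d_def Q)
  qed
  then show ?thesis unfolding Ap_class_def by blast
qed

context Wp_weight
begin

text \<open>On the larger cube the maximal function of the smaller one is at least the ratio of
  volumes, so \<open>local_bound\<close> controls the mass of the larger cube. This yields
  positivity on all cubes and doubling.\<close>

lemma compare_cubes:
  "\<exists>C>0. \<forall>a b h k. h > 0 \<longrightarrow> k > 0 \<longrightarrow> cb a h \<subseteq> cb b k \<longrightarrow>
    ennreal ((h ^ CARD('n) / k ^ CARD('n)) powr p) * emeasure (wmeasure w) (cb b k)
      \<le> ennreal C * emeasure (wmeasure w) (cb a h)"
proof -
  obtain C where C: "C > 0" "\<And>a h. h > 0 \<Longrightarrow>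
     wint p w (maxop (indicator (cb a h)))
       \<le> ennreal C * emeasure (wmeasure w) (cb a h)"
    using local_bound by blast
  have "ennreal ((h ^ CARD('n) / k ^ CARD('n)) powr p) * emeasure (wmeasure w) (cb b k)
      \<le> ennreal C * emeasure (wmeasure w) (cb a h)"
    if h: "h > 0" and k: "k > 0" and sub: "cb a h \<subseteq> cb b k" for a b h k
  proof -
    let ?c = "ennreal ((h ^ CARD('n) / k ^ CARD('n)) powr p)"
    have "?c * emeasure (wmeasure w) (cb b k) = (\<integral>\<^sup>+x. ?c * (ennreal (w x) * indicator (cb b k) x) \<partial>lebesgue)"
      by (simp add: emeasure_wmeasure nn_integral_cmult)
    also have "\<dots> \<le> wint p w (maxop (indicator (cb a h)))"
    proof (rule nn_integral_mono)
      fix x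
      show "?c * (ennreal (w x) * indicator (cb b k) x) \<le> epowr (maxop (indicator (cb a h)) x) p * ennreal (w x)"
      proof (cases "x \<in> cb b k")
        case True
        have "cb a h \<inter> cb b k = cb a h" using sub by blast
        then have "ennreal (h ^ CARD('n) / k ^ CARD('n)) \<le> maxop (indicator (cb a h)) x"
          using maxop_indicator_ge[OF cb_lebesgue k True, of a h] h by (simp add: measure_cb)
        then have "epowr (ennreal (h ^ CARD('n) / k ^ CARD('n))) p \<le> epowr (maxop (indicator (cb a h)) x) p"
          using p by (intro epowr_mono) auto
        then show ?thesis using True h k by (simp add: mult_right_mono)
      qed simp
    qed
    also have "\<dots> \<le> ennreal C * emeasure (wmeasure w) (cb a h)" by (rule C(2)[OF h])
    finally show ?thesis .
  qed
  then show ?thesis using C(1) by blast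
qed

text \<open>On a cube containing \<open>E\<close> the maximal function of \<open>E\<close> is at
  least \<open>|E|/|Q|\<close>, so \<open>superlevel_bound\<close> controls
  \<open>(|E|/|Q|)^s w(Q)\<close> by the mass of a superlevel set. \<open>C_p\<close> is used to
  bring that mass down to w(E).\<close>

lemma Cp_imp_lower:
  assumes Cp: "Cp_class p w" and nz: "h0 > 0" "emeasure (wmeasure w) (cb a0 h0) > 0"
  shows "\<exists>C s. 1 < s \<and> s < p \<and> cube_lower (wmeasure w) C s"
proof -
  obtain A where A: "A > 0" "\<And>a b h k. h > 0 \<Longrightarrow> k > 0 \<Longrightarrow> cb a h \<subseteq> cb b k \<Longrightarrow>
    ennreal ((h ^ CARD('n) / k ^ CARD('n)) powr p) * emeasure (wmeasure w) (cb b k)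
      \<le> ennreal A * emeasure (wmeasure w) (cb a h)"
    using compare_cubes by blast
  note ac = null_sets_wmeasure[OF w_meas]
  have wpos: "emeasure (wmeasure w) (cb a h) > 0" if h: "h > 0" for a h
  proof -
    define m where "m = norm a + norm a0 + h + h0"
    have m: "m > 0" using h nz by (simp add: m_def add_nonneg_pos)
    have sub: "cb a h \<subseteq> cb (- m *\<^sub>R One) (2 * m)" "cb a0 h0 \<subseteq> cb (- m *\<^sub>R One) (2 * m)"
      by (rule subset_big_cube; use h nz in \<open>simp add: m_def\<close>)+
    have "0 < emeasure (wmeasure w) (cb (- m *\<^sub>R One) (2 * m))"
      using nz(2) by (rule less_le_trans) (rule emeasure_mono, use sub in auto)
    moreover have "0 < ennreal ((h ^ CARD('n) / (2 * m) ^ CARD('n)) powr p)" using h m by simp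
    ultimately have "0 < ennreal ((h ^ CARD('n) / (2 * m) ^ CARD('n)) powr p) * emeasure (wmeasure w) (cb (- m *\<^sub>R One) (2 * m))"
      by (simp add: ennreal_zero_less_mult_iff)
    also have "\<dots> \<le> ennreal A * emeasure (wmeasure w) (cb a h)"
      using h m sub(1) by (intro A(2)) auto
    finally show ?thesis by (simp add: ennreal_zero_less_mult_iff)
  qed
  define D where "D = A * (5 ^ CARD('n)) powr p"
  interpret W: cube_doubling "wmeasure w" D
  proof
    fix a :: "real^'n" and h :: real assume h: "h > 0"
    define c where "c = (5 ^ CARD('n) :: real) powr p"
    have c: "c > 0" by (simp add: c_def)
    have sub: "cb a h \<subseteq> dil5 a h" by (rule cb_subset_dil5[OF h])
    have "(h ^ CARD('n) / (5 * h) ^ CARD('n)) powr p = 1 / c"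
      using h by (simp add: power_mult_distrib powr_divide c_def)
    then have le: "ennreal (1 / c) * emeasure (wmeasure w) (dil5 a h) \<le> ennreal A * emeasure (wmeasure w) (cb a h)"
      using A(2)[of h "5 * h" a "a - (2 * h) *\<^sub>R One"] h sub by (simp add: dil5_def)
    have "emeasure (wmeasure w) (dil5 a h) = ennreal c * (ennreal (1 / c) * emeasure (wmeasure w) (dil5 a h))"
      using c by (simp add: mult.assoc[symmetric] flip: ennreal_mult)
    also have "\<dots> \<le> ennreal c * (ennreal A * emeasure (wmeasure w) (cb a h))"
      by (intro mult_left_mono le) simp
    also have "\<dots> = ennreal D * emeasure (wmeasure w) (cb a h)"
      using A(1) c by (simp add: D_def c_def[symmetric] ennreal_mult mult_ac)
    finally show "emeasure (wmeasure w) (dil5 a h) \<le> ennreal D * emeasure (wmeasure w) (cb a h)" .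
  qed (use weight_finite[OF w] wpos ac in auto)
  obtain B \<delta> where B: "B > 0" "\<delta> > 0" "\<And>Q E. cube Q \<Longrightarrow> E \<in> sets lebesgue \<Longrightarrow> E \<subseteq> Q \<Longrightarrow>
      (\<integral>\<^sup>+ x. ennreal (w x) * indicator E x \<partial>lebesgue)
        \<le> ennreal B * epowr (emeasure lebesgue E / emeasure lebesgue Q) \<delta>
          * wint p w (maxop (indicator Q))"
    using Cp unfolding Cp_class_def by blast
  obtain L where L: "L > 0" "\<And>a h. h > 0 \<Longrightarrow>
     wint p w (maxop (indicator (cb a h)))
       \<le> ennreal L * emeasure (wmeasure w) (cb a h)"
    using local_bound by blast
  have Ainf: "measure (wmeasure w) E \<le> B * L * (vol E / h ^ CARD('n)) powr \<delta> * measure (wmeasure w) (cb a h)"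
    if h: "h > 0" and E: "E \<in> sets lebesgue" "E \<subseteq> cb a h" for E a h
  proof -
    define x where "x = vol E / h ^ CARD('n)"
    have x: "x \<ge> 0" using h by (simp add: x_def)
    have "emeasure lebesgue E / emeasure lebesgue (cb a h) = ennreal x"
      using cube_doubling.emeasure_eq[OF cube_doubling_lebesgue h E(2)] h
      by (simp add: emeasure_cb divide_ennreal x_def)
    then have "emeasure (wmeasure w) E \<le> ennreal B * ennreal (x powr \<delta>)
          * wint p w (maxop (indicator (cb a h)))"
      using B(3)[of "cb a h" E] h E x by (simp add: emeasure_wmeasure)
    also have "\<dots> \<le> ennreal B * ennreal (x powr \<delta>) * (ennreal L * emeasure (wmeasure w) (cb a h))"
      by (intro mult_left_mono L h) simp
    also have "\<dots> = ennreal (B * L * x powr \<delta> * measure (wmeasure w) (cb a h))"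
      using W.emeasure_eq[OF h order_refl, of a] B(1) L(1) by (simp add: ennreal_mult mult_ac)
    finally show ?thesis
      using W.emeasure_eq[OF h E(2)] B(1) L(1) by (simp add: x_def[symmetric])
  qed
  \<comment> \<open>A subset of relative volume at most \<open>\<eta>\<close> carries at most half
    of the mass of the cube.\<close>
  define \<eta> where "\<eta> = min (1/2) ((1 / (2 * B * L)) powr (1 / \<delta>))"
  have \<eta>: "0 < \<eta>" "\<eta> < 1" using B L by (auto simp: \<eta>_def)
  have "\<eta> powr \<delta> \<le> ((1 / (2 * B * L)) powr (1 / \<delta>)) powr \<delta>"
    using B L by (intro powr_mono2) (auto simp: \<eta>_def)
  also have "\<dots> = 1 / (2 * B * L)" using B L by (simp add: powr_powr)
  finally have \<eta>2: "B * L * \<eta> powr \<delta> \<le> 1/2" using B L by (simp add: field_simps)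
  \<comment> \<open>Here the weight is the base measure. If \<open>E\<close> had relative volume
    above \<open>1 - \<eta>\<close>, its complement would carry at most half of the mass, and
    \<open>E\<close> at least half instead of at most 1/3.\<close>
  have P: "cube_doubling_pair (wmeasure w) lebesgue D (5 ^ CARD('n)) (1/3) (1 - \<eta>)"
  proof (intro cube_doubling_pair.intro cube_doubling_pair_axioms.intro W.cube_doubling_axioms cube_doubling_lebesgue)
    fix a :: "real^'n" and h E assume h: "h > 0" and E: "E \<in> sets lebesgue" "E \<subseteq> cb a h"
      and small: "measure (wmeasure w) E \<le> 1/3 * measure (wmeasure w) (cb a h)"
    show "vol E \<le> (1 - \<eta>) * vol (cb a h)"
    proof (rule ccontr)
      assume big: "\<not> ?thesis"
      let ?F = "cb a h - E"
      have F: "?F \<in> sets lebesgue" "?F \<subseteq> cb a h" using E by auto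
      have "vol (cb a h - E) = vol (cb a h) - vol E"
        using E h by (intro measure_Diff) (auto simp: emeasure_cb)
      with big have "vol ?F / h ^ CARD('n) \<le> \<eta>"
        using h by (simp add: measure_cb field_simps)
      then have "(vol ?F / h ^ CARD('n)) powr \<delta> \<le> \<eta> powr \<delta>"
        using B h by (intro powr_mono2) auto
      then have "B * L * (vol ?F / h ^ CARD('n)) powr \<delta> \<le> B * L * \<eta> powr \<delta>"
        using B L by (intro mult_left_mono) auto
      with \<eta>2 have "B * L * (vol ?F / h ^ CARD('n)) powr \<delta> \<le> 1/2" by linarith
      then have "B * L * (vol ?F / h ^ CARD('n)) powr \<delta> * measure (wmeasure w) (cb a h)
          \<le> 1/2 * measure (wmeasure w) (cb a h)" by (intro mult_right_mono) auto
      with Ainf[OF h F] have "measure (wmeasure w) ?F \<le> 1/2 * measure (wmeasure w) (cb a h)" by linarith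
      moreover have "measure (wmeasure w) (cb a h - E) = measure (wmeasure w) (cb a h) - measure (wmeasure w) E"
        using W.fin[OF h, of a] E by (intro measure_Diff) auto
      ultimately show False using small W.measure_pos[OF h, of a] by linarith
    qed
  qed (use \<eta> in auto)
  obtain s C t where s: "0 < s" "s < p" "C > 0" and t: "0 < t" "t < 1"
    and le: "\<And>E a h. h > 0 \<Longrightarrow> E \<in> sets lebesgue \<Longrightarrow> E \<subseteq> cb a h \<Longrightarrow>
     wint s w (maxop (indicator E))
       \<le> ennreal C * emeasure (wmeasure w) {x. ennreal t < maxop (indicator E) x}"
    using superlevel_bound by blast
  obtain c where c: "c > 0" "\<And>a h E. h > 0 \<Longrightarrow> E \<in> sets lebesgue \<Longrightarrow> E \<subseteq> cb a h \<Longrightarrow>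
    measure (wmeasure w) E < c * measure (wmeasure w) (cb a h) \<Longrightarrow> vol E < t * vol (cb a h)"
    using cube_doubling_pair.small_imp_small[OF P t(1)] by metis
  \<comment> \<open>By the choice of \<open>c\<close>, a cube in which \<open>E\<close> has volume
    density above \<open>t\<close> has \<open>w\<close>-density of \<open>E\<close> at least
    \<open>c\<close>; Vitali's lemma for the weight then sums over these cubes.\<close>
  have level: "emeasure (wmeasure w) {x. ennreal t < maxop (indicator E) x} \<le> ennreal (D / c) * emeasure (wmeasure w) E"
    if E: "E \<in> sets lebesgue" for E
  proof -
    define F where "F = {(b, k). k > 0 \<and> t * k ^ CARD('n) < vol (E \<inter> cb b k)}"
    have "{x. ennreal t < maxop (indicator E) x} \<subseteq> (\<Union>(b, k)\<in>F. ob3 b k)"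
    proof
      fix x assume "x \<in> {x. ennreal t < maxop (indicator E) x}"
      then obtain b k where "k > 0" "x \<in> cb b k" "t * k ^ CARD('n) < vol (E \<inter> cb b k)"
        using less_maxop_indicator[OF E, of t x] t by auto
      then have "(b, k) \<in> F" "x \<in> ob3 b k" using cb_subset_ob3[of k b] by (auto simp: F_def)
      then show "x \<in> (\<Union>(b, k)\<in>F. ob3 b k)" by blast
    qed
    then have "emeasure (wmeasure w) {x. ennreal t < maxop (indicator E) x} \<le> emeasure (wmeasure w) (\<Union>(b, k)\<in>F. ob3 b k)"
      by (rule emeasure_mono) (auto intro!: open_lebesgue open_UN)
    also have "\<dots> \<le> ennreal D * emeasure (density (wmeasure w) (\<lambda>x. ennreal (1 / c) * indicator E x)) UNIV"
    proof (rule vitali_measure)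
      fix b k assume "(b, k) \<in> F"
      then have k: "k > 0" "t * vol (cb b k) < vol (E \<inter> cb b k)"
        by (auto simp: F_def measure_cb)
      have "\<not> measure (wmeasure w) (E \<inter> cb b k) < c * measure (wmeasure w) (cb b k)"
        using c(2)[OF k(1), of "E \<inter> cb b k" b] E k(2) by auto
      then have "measure (wmeasure w) (cb b k) \<le> 1 / c * measure (wmeasure w) (E \<inter> cb b k)"
        using c(1) by (simp add: field_simps)
      then show "0 < k \<and> emeasure (wmeasure w) (cb b k) \<le> emeasure (density (wmeasure w) (\<lambda>x. ennreal (1 / c) * indicator E x)) (cb b k)"
        using k c(1) E W.emeasure_eq[OF k(1), of "E \<inter> cb b k" b] W.emeasure_eq[OF k(1) order_refl, of b]
        by (subst emeasure_density_indicator) (auto intro!: ennreal_leI simp flip: ennreal_mult)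
    qed (auto simp: W.dbl)
    also have "\<dots> = ennreal D * (ennreal (1 / c) * emeasure (wmeasure w) E)"
      using E by (subst emeasure_density_indicator) auto
    also have "\<dots> = ennreal (D / c) * emeasure (wmeasure w) E"
      using W.D_ge_1[of 1] c(1) by (simp add: mult.assoc[symmetric] flip: ennreal_mult)
    finally show ?thesis .
  qed
  \<comment> \<open>Raised above 1 as \<open>lower_imp_Ap\<close> requires, still below
    \<open>p\<close>; since densities are at most 1, the larger exponent gives a weaker
    inequality.\<close>
  define s' where "s' = max s ((1 + p) / 2)"
  have s': "1 < s'" "s' < p" "s \<le> s'" using s p by (auto simp: s'_def less_max_iff_disj)
  have "cube_lower (wmeasure w) (C * (D / c)) s'"
  proof
    fix a :: "real^'n" and h E assume h: "h > 0" and E: "E \<in> sets lebesgue" "E \<subseteq> cb a h"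
    define x where "x = vol E / h ^ CARD('n)"
    have "E \<inter> cb a h = E" using E(2) by blast
    then have x: "0 \<le> x" "x \<le> 1" "\<And>y. y \<in> cb a h \<Longrightarrow> ennreal x \<le> maxop (indicator E) y"
      using measure_Int_cb_le[OF E(1) h, of a] maxop_indicator_ge[OF E(1) h, of _ a] h by (auto simp: x_def)
    have "ennreal (x powr s') * emeasure (wmeasure w) (cb a h)
        = (\<integral>\<^sup>+y. ennreal (x powr s') * (ennreal (w y) * indicator (cb a h) y) \<partial>lebesgue)"
      by (simp add: emeasure_wmeasure nn_integral_cmult)
    also have "\<dots> \<le> (\<integral>\<^sup>+y. epowr (maxop (indicator E) y) s * ennreal (w y) \<partial>lebesgue)"
    proof (rule nn_integral_mono)
      fix y
      show "ennreal (x powr s') * (ennreal (w y) * indicator (cb a h) y) \<le> epowr (maxop (indicator E) y) s * ennreal (w y)"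
      proof (cases "y \<in> cb a h")
        case True
        have "ennreal (x powr s') \<le> ennreal (x powr s)" using x s' by (intro ennreal_leI powr_mono') auto
        also have "\<dots> = epowr (ennreal x) s" using x by simp
        also have "\<dots> \<le> epowr (maxop (indicator E) y) s" using s by (intro epowr_mono x True) auto
        finally show ?thesis using True by (simp add: mult_right_mono)
      qed simp
    qed
    also have "\<dots> \<le> ennreal C * emeasure (wmeasure w) {x. ennreal t < maxop (indicator E) x}"
      by (rule le[OF h E])
    also have "\<dots> \<le> ennreal C * (ennreal (D / c) * emeasure (wmeasure w) E)"
      by (intro mult_left_mono level E) simp
    finally have "ennreal (x powr s') * ennreal (measure (wmeasure w) (cb a h))
        \<le> ennreal C * (ennreal (D / c) * ennreal (measure (wmeasure w) E))"
      unfolding W.emeasure_eq[OF h order_refl, of a] W.emeasure_eq[OF h E(2)] .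
    moreover have "0 \<le> C" "0 \<le> D / c" using s(3) c(1) W.D_ge_1[of 1] by auto
    ultimately have "ennreal (x powr s' * measure (wmeasure w) (cb a h)) \<le> ennreal (C * (D / c) * measure (wmeasure w) E)"
      by (simp only: ennreal_mult mult_nonneg_nonneg measure_nonneg powr_ge_zero mult.assoc)
    then have "x powr s' * measure (wmeasure w) (cb a h) \<le> C * (D / c) * measure (wmeasure w) E"
      using s c W.D_ge_1[of 1] by (subst (asm) ennreal_le_iff) auto
    then show "(vol E / h ^ CARD('n)) powr s' * measure (wmeasure w) (cb a h) \<le> C * (D / c) * measure (wmeasure w) E"
      by (simp add: x_def)
  qed (use s' weight_finite[OF w] nz ac in auto)
  then show ?thesis using s' by blast
qed

end

theorem theorem1p2:
  fixes w :: "real^'n \<Rightarrow> real" and p :: real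
  assumes "p > 1" and "weight w"
  shows "Ap_class p w \<longleftrightarrow> Wp_class p w \<and> Cp_class p w"
proof
  assume "Ap_class p w"
  with assms show "Wp_class p w \<and> Cp_class p w" by (rule Ap_imp_Wp_Cp)
next
  assume WC: "Wp_class p w \<and> Cp_class p w"
  then interpret Wp_weight w p using assms by unfold_locales auto
  from assms(2) show "Ap_class p w"
  proof (cases rule: weight_cases)
    case zero
    have "avg Q (\<lambda>y. ennreal (w y)) = 0" for Q
    proof -
      have "(\<integral>\<^sup>+y. ennreal (w y) * indicator Q y \<partial>lebesgue) = (\<integral>\<^sup>+y. 0 \<partial>(lebesgue :: (real^'n) measure))"
        using zero by (intro nn_integral_cong_AE) (auto elim: eventually_mono)
      then show ?thesis by (simp add: avg_def)
    qed
    then show ?thesis by (simp add: Ap_class_def) \<comment> \<open>here \<open>0 \<cdot> \<infinity> = 0\<close> is used: the dual average is infinite\<close>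
  next
    case (pos a0 h0)
    then obtain C s where "1 < s" "s < p" "cube_lower (wmeasure w) C s"
      using Cp_imp_lower WC by blast
    with assms show ?thesis by (intro lower_imp_Ap)
  qed
qed

end
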